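(* Let $N_r>N_t\ge 1$, $\eta=1/\sigma^2>0$, let $\mathbf\Sigma$ be the $N_t\times N_t$ transmit covariance matrix and $\mathbf F$ a nonsingular $N_t\times N_t$ precoding matrix. For the precoded MIMO system with zero-forcing detection described in the context, the average symbol error probability (SEP) with precoding matrix $\mathbf F$ for $M$-ary PAM, PSK and square QAM signals is given by $$\mathrm P(\mathbf F)=\frac1{N_t}\sum_{k=1}^{N_t}G\Big(\big[(\mathbf F^H\mathbf\Sigma\mathbf F)^{-1}\big]_{kk}\Big),$$ where $G(x)$ is convex for $0<x<T$, and $G$, $T$ are as follows. 1. For PAM signals, $$G(x)=G_{\mathrm{PAM}}(x)=\frac{2(M-1)}{M\pi}\int_0^{\pi/2}\Big(1+\frac{3\eta}{(M^2-1)x\sin^2\theta}\Big)^{-(N_r-N_t+1)}d\theta,\qquad T=T_{\mathrm{PAM}}=\frac{3\eta(N_r-N_t)}{2(M^2-1)}.$$ 2. For PSK signals, $$G(x)=G_{\mathrm{PSK}}(x)=\frac1\pi\int_0^{(M-1)\pi/M}\Big(1+\frac{\eta\sin^2(\pi/M)}{x\sin^2\theta}\Big)^{-(N_r-N_t+1)}d\theta,\qquad T=T_{\mathrm{PSK}}=\frac{\eta(N_r-N_t)\sin^2(\pi/M)}{2}.$$ 3. For QAM signals, $$G(x)=G_{\mathrm{QAM}}(x)=\frac{4(\sqrt M-1)}{\sqrt M\,\pi}\int_{\pi/4}^{\pi/2}\Big(1+\frac{3\eta}{2(M-1)x\sin^2\theta}\Big)^{-(N_r-N_t+1)}d\theta+\frac{4(\sqrt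 M-1)}{M\pi}\int_0^{\pi/4}\Big(1+\frac{3\eta}{2(M-1)x\sin^2\theta}\Big)^{-(N_r-N_t+1)}d\theta,$$ $$T=T_{\mathrm{QAM}}=\frac{3\eta(N_r-N_t)}{4(M-1)}.$$
   Context: System model. The received vector is $\mathbf r=\mathbf H\mathbf F\mathbf s+\boldsymbol\xi\in\mathbb C^{N_r}$, where: $\mathbf H$ is an $N_r\times N_t$ random matrix whose rows $\mathbf h_1^T,\dots,\mathbf h_{N_r}^T$ are i.i.d. zero-mean circularly-symmetric complex Gaussian with $\mathbb E[(\mathbf h_m^T)^H\mathbf h_m^T]=\mathbf\Sigma$, a Hermitian positive definite $N_t\times N_t$ matrix; $\mathbf F$ is an $N_t\times N_t$ nonsingular deterministic precoding matrix; $\boldsymbol\xi$ is circularly-symmetric complex Gaussian noise with covariance $\sigma^2\mathbf I$; $\mathbf s=[s_1,\dots,s_{N_t}]^T$ has i.i.d. entries, each uniform on a constellation $\mathcal S\subset\mathbb C$ of size $M$; $\mathbf H,\mathbf s,\boldsymbol\xi$ are independent. The covariance matrix of $\mathbf s$ is $\mathbf I$, i.e. $\mathcal S$ has unit average energy. The system SNR is $\eta=1/\sigma^2$. Constellations. $M$-PAM ($M\ge2$): $\{\delta(2i-1-M):i=1,\dots,M\}\subset\mathbb R$ with $\delta=\sqrt{3/(M^2-1)}$. $M$-PSK ($M\ge2$): $\{e^{2\pi j i/M}:i=0,\dots,M-1\}$ (with $j=\sqrt{-1}$). Square $M$-QAM ($\sqrt M\ge 2$ an integer): $\{a+jb\}$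 with $a,b$ ranging over $\{\delta(2i-1-\sqrt M):i=1,\dots,\sqrt M\}$, $\delta=\sqrt{3/(2(M-1))}$. Zero-forcing detection. With $(\mathbf H\mathbf F)^+=(\mathbf F^H\mathbf H^H\mathbf H\mathbf F)^{-1}\mathbf F^H\mathbf H^H$ (which exists almost surely), the receiver forms $\mathbf r'=(\mathbf H\mathbf F)^+\mathbf r$ and decides $\hat s_k=\arg\min_{s\in\mathcal S}|r'_k-s|^2$ for each $k$. Average SEP. $\mathrm P(\mathbf F)=\frac1{N_t}\sum_{k=1}^{N_t}\Pr(\hat s_k\ne s_k)$, the probability being over $\mathbf H$, $\mathbf s$ and $\boldsymbol\xi$. *)

theory Defs
  imports "HOL-Probability.Probability"
begin

definition adj :: "complex ^ 'n ^ 'm \<Rightarrow> complex ^ 'm ^ 'n" where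
  "adj A = (\<chi> i j. cnj (A $ j $ i))"

definition hermitian_pos_def :: "complex ^ 'n ^ 'n \<Rightarrow> bool" where
  "hermitian_pos_def A \<longleftrightarrow>
     adj A = A \<and> (\<forall>v. v \<noteq> 0 \<longrightarrow> 0 < Re (\<Sum>i\<in>UNIV. cnj (v $ i) * (A *v v) $ i))"

definition std_gaussian :: "'v::euclidean_space measure" where
  "std_gaussian = density lborel (\<lambda>x. ennreal (\<Prod>b\<in>Basis. std_normal_density (x \<bullet> b)))"

(* Gaussian vectors are the affine images of a standard Gaussian vector.  For
   'v = complex ^ 'n the map L is only required to be real-linear, so that the real and
   imaginary parts of X are jointly Gaussian with an arbitrary real covariance. *)
definition gaussian_vector :: "'a measure \<Rightarrow> ('a \<Rightarrow> 'v::euclidean_space) \<Rightarrow> bool" where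
  "gaussian_vector P X \<longleftrightarrow> X \<in> borel_measurable P \<and>
     (\<exists>(L :: 'v \<Rightarrow> 'v) \<mu>. linear L \<and> distr P borel X = distr std_gaussian borel (\<lambda>z. \<mu> + L z))"

definition circularly_symmetric :: "'a measure \<Rightarrow> ('a \<Rightarrow> complex ^ 'n) \<Rightarrow> bool" where
  "circularly_symmetric P X \<longleftrightarrow>
     (\<forall>\<phi>::real. distr P borel (\<lambda>\<omega>. cis \<phi> *s X \<omega>) = distr P borel X)"

(* prob_space.indep_vars needs a common codomain; this is its definition for three random
   variables of different types. *)
definition indep_triple :: "'a measure \<Rightarrow> ('a \<Rightarrow> 'b::topological_space) \<Rightarrow> ('a \<Rightarrow> 'c::topological_space)
    \<Rightarrow> ('a \<Rightarrow> 'd::topological_space) \<Rightarrow> bool" where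
  "indep_triple P X Y Z \<longleftrightarrow>
     X \<in> borel_measurable P \<and> Y \<in> borel_measurable P \<and> Z \<in> borel_measurable P \<and>
     prob_space.indep_sets P
       (\<lambda>i. [{X -` A \<inter> space P | A. A \<in> sets borel},
             {Y -` A \<inter> space P | A. A \<in> sets borel},
             {Z -` A \<inter> space P | A. A \<in> sets borel}] ! i) {0, 1, 2}"

definition covariance_matrix :: "'a measure \<Rightarrow> ('a \<Rightarrow> complex ^ 'n) \<Rightarrow> complex ^ 'n ^ 'n" where
  "covariance_matrix P X =
     (\<chi> i j. integral\<^sup>L P (\<lambda>\<omega>. (X \<omega> $ i - integral\<^sup>L P (\<lambda>\<omega>. X \<omega> $ i)) *
                               cnj (X \<omega> $ j - integral\<^sup>L P (\<lambda>\<omega>. X \<omega> $ j))))"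

(* The number of levels L is a real because it is instantiated with sqrt M for square QAM. *)
definition amplitude_levels :: "real \<Rightarrow> real \<Rightarrow> real set" where
  "amplitude_levels \<delta> L = {\<delta> * (2 * real i - 1 - L) | i::nat. 1 \<le> i \<and> real i \<le> L}"

definition PAM :: "nat \<Rightarrow> complex set" where
  "PAM M = complex_of_real ` amplitude_levels (sqrt (3 / ((real M)\<^sup>2 - 1))) (real M)"

definition PSK :: "nat \<Rightarrow> complex set" where
  "PSK M = (\<lambda>i::nat. cis (2 * pi * real i / real M)) ` {0..<M}"

definition QAM :: "nat \<Rightarrow> complex set" where
  "QAM M = (let A = amplitude_levels (sqrt (3 / (2 * (real M - 1)))) (sqrt (real M))
            in {Complex a b | a b. a \<in> A \<and> b \<in> A})"

definition received :: "complex ^ 'n ^ 'r \<Rightarrow> complex ^ 'n ^ 'n \<Rightarrow> complex ^ 'n \<Rightarrow> complex ^ 'r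
    \<Rightarrow> complex ^ 'r" where
  "received H F s \<xi> = (H ** F) *v s + \<xi>"

definition pseudo_inv :: "complex ^ 'n ^ 'r \<Rightarrow> complex ^ 'r ^ 'n" where
  "pseudo_inv A = matrix_inv (adj A ** A) ** adj A"

(* Ties are resolved by the fixed choice built into arg_min; it depends only on the set of
   nearest constellation points, so z \<mapsto> nearest_symbol S z is Borel for finite S. *)
definition nearest_symbol :: "complex set \<Rightarrow> complex \<Rightarrow> complex" where
  "nearest_symbol S z = arg_min_on (\<lambda>a. (cmod (z - a))\<^sup>2) S"

definition zf_decision :: "complex set \<Rightarrow> complex ^ 'n ^ 'r \<Rightarrow> complex ^ 'n ^ 'n \<Rightarrow> complex ^ 'r
    \<Rightarrow> complex ^ 'n" where
  "zf_decision S H F r = (\<chi> k. nearest_symbol S ((pseudo_inv (H ** F) *v r) $ k))"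

definition average_SEP :: "'a measure \<Rightarrow> complex set \<Rightarrow> ('a \<Rightarrow> complex ^ 'n ^ 'r)
    \<Rightarrow> ('a \<Rightarrow> complex ^ 'n) \<Rightarrow> ('a \<Rightarrow> complex ^ 'r) \<Rightarrow> complex ^ 'n ^ 'n \<Rightarrow> real" where
  "average_SEP P S H s \<xi> F =
     1 / real CARD('n) * (\<Sum>k\<in>UNIV. measure P {\<omega> \<in> space P.
        zf_decision S (H \<omega>) F (received (H \<omega>) F (s \<omega>) (\<xi> \<omega>)) $ k \<noteq> s \<omega> $ k})"

definition G_PAM :: "real \<Rightarrow> nat \<Rightarrow> nat \<Rightarrow> nat \<Rightarrow> real \<Rightarrow> real" where
  "G_PAM \<eta> Nr Nt M x =
     2 * (real M - 1) / (real M * pi) *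
       integral {0..pi/2} (\<lambda>\<theta>.
         (1 + 3 * \<eta> / (((real M)\<^sup>2 - 1) * x * (sin \<theta>)\<^sup>2)) powi (- (int Nr - int Nt + 1)))"

definition T_PAM :: "real \<Rightarrow> nat \<Rightarrow> nat \<Rightarrow> nat \<Rightarrow> real" where
  "T_PAM \<eta> Nr Nt M = 3 * \<eta> * (real Nr - real Nt) / (2 * ((real M)\<^sup>2 - 1))"

definition G_PSK :: "real \<Rightarrow> nat \<Rightarrow> nat \<Rightarrow> nat \<Rightarrow> real \<Rightarrow> real" where
  "G_PSK \<eta> Nr Nt M x =
     1 / pi *
       integral {0..(real M - 1) * pi / real M} (\<lambda>\<theta>.
         (1 + \<eta> * (sin (pi / real M))\<^sup>2 / (x * (sin \<theta>)\<^sup>2)) powi (- (int Nr - int Nt + 1)))"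

definition T_PSK :: "real \<Rightarrow> nat \<Rightarrow> nat \<Rightarrow> nat \<Rightarrow> real" where
  "T_PSK \<eta> Nr Nt M = \<eta> * (real Nr - real Nt) * (sin (pi / real M))\<^sup>2 / 2"

definition G_QAM :: "real \<Rightarrow> nat \<Rightarrow> nat \<Rightarrow> nat \<Rightarrow> real \<Rightarrow> real" where
  "G_QAM \<eta> Nr Nt M x =
     4 * (sqrt (real M) - 1) / (sqrt (real M) * pi) *
       integral {pi/4..pi/2} (\<lambda>\<theta>.
         (1 + 3 * \<eta> / (2 * (real M - 1) * x * (sin \<theta>)\<^sup>2)) powi (- (int Nr - int Nt + 1)))
   + 4 * (sqrt (real M) - 1) / (real M * pi) *
       integral {0..pi/4} (\<lambda>\<theta>.
         (1 + 3 * \<eta> / (2 * (real M - 1) * x * (sin \<theta>)\<^sup>2)) powi (- (int Nr - int Nt + 1)))"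

definition T_QAM :: "real \<Rightarrow> nat \<Rightarrow> nat \<Rightarrow> nat \<Rightarrow> real" where
  "T_QAM \<eta> Nr Nt M = 3 * \<eta> * (real Nr - real Nt) / (4 * (real M - 1))"

end

theory Submission imports Defs begin

text \<open>
  All Gaussian laws are handled through one fact: the standard Gaussian measure is invariant under
  orthogonal maps. Let \<open>A = H F\<close> and \<open>R = F\<^sup>H \<Sigma> F\<close>. The vector \<open>A (R\<^sup>-\<^sup>1 e\<^sub>k)\<close> is uncorrelated with every
  column of \<open>A\<close> except the \<open>k\<close>-th, so it may be replaced by an independent copy, which only moves
  column \<open>k\<close>. Hence, with \<open>V\<close> the span of the other columns and \<open>w\<close> the \<open>k\<close>-th row of the
  pseudo-inverse of \<open>A\<close>, the quantity \<open>1 / |w|\<^sup>2 = dist(a\<^sub>k, V)\<^sup>2\<close> is a multiple of the squared distance of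
  a standard Gaussian vector to an independent subspace, and its Laplace transform is explicit.

  Given the channel, the detector sees symbol \<open>k\<close> through circular Gaussian noise of deviation
  proportional to \<open>|w|\<close>, and Craig's polar-coordinate formula writes the error probability as an
  integral over angles of \<open>exp (- c / (|w|\<^sup>2 sin\<^sup>2 \<theta>))\<close>. Exchanging that integral with the expectation
  over the channel gives \<open>G\<close>, whose integrand \<open>x \<mapsto> (x / (x + c))\<^sup>N\<close> is convex as long as \<open>2 x \<le> (N - 1) c\<close>.
\<close>

section \<open>Standard Gaussian vectors\<close>

text \<open>Every correlated law is a push-forward of \<open>std_gaussian\<close> along a
  real-linear map. Degenerate covariances then need no separate case, and neither densities of
  correlated vectors nor characteristic functions enter. Craig's form makes this sufficient: the
  channel enters the error probability only through exponentials in 1 / |w|^2, so one Laplace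
  transform is needed and not the law of |w|. The exponent Nr - Nt + 1 is half of a real dimension:
  the orthogonal complement of Nt - 1 columns in C^Nr has 2 (Nr - Nt + 1) real directions, and each
  contributes a factor (1 + 2 c)^(-1/2). All three constellations share one parameter d, the square
  of half the minimum distance between symbols, and the argument of \<open>G\<close> enters through
  \<eta> d / (x sin^2 \<theta>). This constant is smallest at \<theta> = \<pi>/2, which is the angle
  that decides the bound T = (Nr - Nt) \<eta> d / 2.\<close>

lemma nn_integral_lborel_plus:
  fixes c :: "'v::euclidean_space"
  assumes [measurable]: "f \<in> borel_measurable borel"
  shows "(\<integral>\<^sup>+x. f (c + x) \<partial>lborel) = (\<integral>\<^sup>+x. f x \<partial>lborel)"
proof -
  have "(\<integral>\<^sup>+x. f x \<partial>lborel) = (\<integral>\<^sup>+x. f x \<partial>distr lborel borel ((+) c))"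
    by (simp add: lborel_distr_plus)
  then show ?thesis by (simp add: nn_integral_distr)
qed

lemma nn_integral_lborel_minus:
  fixes c :: "'v::euclidean_space"
  assumes [measurable]: "f \<in> borel_measurable borel"
  shows "(\<integral>\<^sup>+x. f (c - x) \<partial>lborel) = (\<integral>\<^sup>+x. f x \<partial>lborel)"
proof -
  have "lborel = distr lborel borel (\<lambda>x::'v. c + (-1) *\<^sub>R x)"
    using lborel_affine[of "-1" c] by (simp add: density_1 one_ennreal_def[symmetric])
  then have "(\<integral>\<^sup>+x. f x \<partial>lborel) = (\<integral>\<^sup>+x. f x \<partial>distr lborel borel (\<lambda>x::'v. c + (-1) *\<^sub>R x))"
    by simp
  then show ?thesis by (simp add: nn_integral_distr)
qed

lemma linear_borel_measurable:
  fixes T :: "'v::euclidean_space \<Rightarrow> 'w::euclidean_space"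
  assumes "linear T"
  shows "T \<in> borel \<rightarrow>\<^sub>M borel"
  using assms by (intro borel_measurable_continuous_onI linear_continuous_on) (simp add: linear_conv_bounded_linear)

text \<open>Double counting instead of a determinant: the integral of 1_A(x) 1_B(x + T y) is
  evaluated in both orders, with \<open>B\<close> the unit ball, which \<open>T\<close> preserves.
  Integrating over y first gives |A| |B| by translation invariance; shifting x by T y and then
  reflecting in y gives |T^-1 A| |B|. The factor |B| cancels because it is positive and
  finite.\<close>

lemma distr_lborel_orthogonal_transformation:
  fixes T :: "'v::euclidean_space \<Rightarrow> 'v"
  assumes T: "orthogonal_transformation T"
  shows "distr lborel borel T = lborel"
proof (rule measure_eqI)
  have lin: "linear T" using T by (rule orthogonal_transformation_linear)
  note mT[measurable] = linear_borel_measurable[OF lin]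
  have bij: "bij T" using T by (rule orthogonal_transformation_bij)
  have Tinv: "T (inv T x) = x" for x using bij by (simp add: bij_is_surj surj_f_inv_f)
  fix A assume "A \<in> sets (distr lborel borel T)"
  then have [measurable]: "A \<in> sets borel" by simp
  define B where "B = ball (0::'v) 1"
  have [measurable]: "B \<in> sets borel" by (simp add: B_def)
  define \<beta> where "\<beta> = emeasure lborel B"
  have b: "\<beta> < \<infinity>" "\<beta> \<noteq> 0"
  proof -
    show "\<beta> < \<infinity>" unfolding \<beta>_def B_def by (rule emeasure_lborel_ball_finite)
    show "\<beta> \<noteq> 0" unfolding \<beta>_def B_def
      using content_ball_pos[of 1 "0::'v"] by (auto simp: measure_def)
  qed
  have TB: "indicator B (T y) = (indicator B y :: ennreal)" for y
    using T by (auto simp: B_def indicator_def orthogonal_transformation_norm)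
  let ?f = "\<lambda>x y. indicator A x * indicator B (x + T y) :: ennreal"
  have "(\<integral>\<^sup>+x. \<integral>\<^sup>+y. ?f x y \<partial>lborel \<partial>lborel) = (\<integral>\<^sup>+x. indicator A x * \<beta> \<partial>lborel)"
  proof (rule nn_integral_cong)
    fix x :: 'v
    have "(\<integral>\<^sup>+y. ?f x y \<partial>lborel) = indicator A x * (\<integral>\<^sup>+y. indicator B (T (inv T x + y)) \<partial>lborel)"
      by (subst nn_integral_cmult[symmetric]) (auto simp: linear_add[OF lin] Tinv)
    also have "(\<integral>\<^sup>+y. indicator B (T (inv T x + y)) \<partial>lborel) = (\<integral>\<^sup>+y. indicator B y \<partial>lborel)"
      by (subst nn_integral_lborel_plus) (simp_all add: TB)
    finally show "(\<integral>\<^sup>+y. ?f x y \<partial>lborel) = indicator A x * \<beta>" by (simp add: \<beta>_def)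
  qed
  then have 1: "(\<integral>\<^sup>+x. \<integral>\<^sup>+y. ?f x y \<partial>lborel \<partial>lborel) = emeasure lborel A * \<beta>"
    by (simp add: nn_integral_multc)
  have "(\<integral>\<^sup>+x. \<integral>\<^sup>+y. ?f x y \<partial>lborel \<partial>lborel) = (\<integral>\<^sup>+y. \<integral>\<^sup>+x. ?f x y \<partial>lborel \<partial>lborel)"
    by (rule lborel_pair.Fubini'[symmetric]) measurable
  also have "\<dots> = (\<integral>\<^sup>+y. \<integral>\<^sup>+x. indicator A (x - T y) * indicator B x \<partial>lborel \<partial>lborel)"
  proof (rule nn_integral_cong)
    fix y :: 'v
    have "(\<integral>\<^sup>+x. indicator A (x - T y) * indicator B x \<partial>lborel)
       = (\<integral>\<^sup>+x. indicator A ((T y + x) - T y) * indicator B (T y + x) \<partial>lborel)"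
      by (subst nn_integral_lborel_plus) simp_all
    then show "(\<integral>\<^sup>+x. ?f x y \<partial>lborel) = (\<integral>\<^sup>+x. indicator A (x - T y) * indicator B x \<partial>lborel)"
      by (simp add: add.commute)
  qed
  also have "\<dots> = (\<integral>\<^sup>+x. \<integral>\<^sup>+y. indicator A (x - T y) * indicator B x \<partial>lborel \<partial>lborel)"
    by (rule lborel_pair.Fubini') measurable
  also have "\<dots> = (\<integral>\<^sup>+x. emeasure lborel (T -` A) * indicator B x \<partial>lborel)"
  proof (rule nn_integral_cong)
    fix x :: 'v
    have [measurable]: "T -` A \<in> sets borel" using measurable_sets[OF mT, of A] by simp
    have "(\<integral>\<^sup>+y. indicator A (x - T y) * indicator B x \<partial>lborel)
        = (\<integral>\<^sup>+y. indicator (T -` A) (inv T x - y) \<partial>lborel) * (indicator B x :: ennreal)"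
      by (subst nn_integral_multc[symmetric])
        (auto intro!: nn_integral_cong simp: indicator_def linear_diff[OF lin] Tinv)
    also have "(\<integral>\<^sup>+y. indicator (T -` A) (inv T x - y) \<partial>lborel) = (\<integral>\<^sup>+y. indicator (T -` A) y \<partial>lborel)"
      by (subst nn_integral_lborel_minus) simp_all
    finally show "(\<integral>\<^sup>+y. indicator A (x - T y) * indicator B x \<partial>lborel)
       = emeasure lborel (T -` A) * indicator B x" by simp
  qed
  also have "\<dots> = emeasure lborel (T -` A) * \<beta>"
    by (simp add: nn_integral_cmult \<beta>_def)
  finally have "emeasure lborel A * \<beta> = emeasure lborel (T -` A) * \<beta>" using 1 by simp
  then have "emeasure lborel A = emeasure lborel (T -` A)"
    using b by (auto simp add: mult.commute[of _ \<beta>] ennreal_mult_cancel_left)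
  then show "emeasure (distr lborel borel T) A = emeasure lborel A"
    by (simp add: emeasure_distr)
qed simp

section \<open>Rotation invariance and product structure of the standard Gaussian measure\<close>

lemma std_gaussian_eq:
  "std_gaussian = density lborel (\<lambda>x::'v::euclidean_space.
     ennreal ((1 / sqrt (2 * pi)) ^ DIM('v) * exp (- (norm x)\<^sup>2 / 2)))"
proof -
  have "(\<Prod>b\<in>Basis. std_normal_density (x \<bullet> b)) =
     (1 / sqrt (2 * pi)) ^ DIM('v) * exp (- (norm x)\<^sup>2 / 2)" for x :: 'v
  proof -
    have "(\<Prod>b\<in>Basis. std_normal_density (x \<bullet> b)) = (1 / sqrt (2 * pi)) ^ DIM('v) * (\<Prod>b\<in>Basis. exp (- (x \<bullet> b)\<^sup>2 / 2))"
      by (simp only: std_normal_density_def prod.distrib prod_constant)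
    also have "(\<Prod>b\<in>Basis. exp (- (x \<bullet> b)\<^sup>2 / 2)) = exp (\<Sum>b\<in>Basis. - (x \<bullet> b)\<^sup>2 / 2)"
      by (simp add: exp_sum)
    also have "(\<Sum>b\<in>Basis. - (x \<bullet> b)\<^sup>2 / 2) = - (norm x)\<^sup>2 / 2"
      unfolding power2_norm_eq_inner
      by (subst euclidean_inner) (simp add: power2_eq_square sum_negf sum_divide_distrib)
    finally show ?thesis .
  qed
  then show ?thesis by (simp add: std_gaussian_def)
qed

lemma sets_std_gaussian [simp, measurable_cong]: "sets std_gaussian = sets borel"
  by (simp add: std_gaussian_def)

lemma space_std_gaussian [simp]: "space std_gaussian = UNIV"
  by (simp add: std_gaussian_def)

lemma nn_integral_std_gaussian_prod:
  assumes [measurable]: "\<And>b. b \<in> Basis \<Longrightarrow> f b \<in> borel_measurable borel"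
  shows "(\<integral>\<^sup>+x. (\<Prod>b\<in>Basis. f b (x \<bullet> b)) \<partial>std_gaussian) =
    (\<Prod>b\<in>(Basis::'v::euclidean_space set). (\<integral>\<^sup>+t. f b t \<partial>density lborel std_normal_density))"
proof -
  have "(\<integral>\<^sup>+x. (\<Prod>b\<in>Basis. f b (x \<bullet> b)) \<partial>std_gaussian) =
    (\<integral>\<^sup>+x. (\<Prod>b\<in>(Basis::'v set). ennreal (std_normal_density (x \<bullet> b)) * f b (x \<bullet> b)) \<partial>lborel)"
    unfolding std_gaussian_def
    by (subst nn_integral_density) (auto simp: prod.distrib prod_ennreal)
  also have "\<dots> = (\<Prod>b\<in>(Basis::'v set). (\<integral>\<^sup>+t. ennreal (std_normal_density t) * f b t \<partial>lborel))"
    by (rule nn_integral_lborel_prod) auto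
  finally show ?thesis
    by (simp add: nn_integral_density)
qed

lemma prob_space_std_gaussian: "prob_space (std_gaussian :: 'v::euclidean_space measure)"
proof
  have "emeasure (density lborel std_normal_density) UNIV = 1"
    using prob_space.emeasure_space_1[OF prob_space_normal_density[of 1 0]] by simp
  then show "emeasure (std_gaussian :: 'v measure) (space std_gaussian) = 1"
    using nn_integral_std_gaussian_prod[of "\<lambda>_::'v. \<lambda>_. 1"] by simp
qed

interpretation std_gaussian: prob_space std_gaussian
  by (rule prob_space_std_gaussian)

lemma distr_std_gaussian_orthogonal_transformation:
  fixes T :: "'v::euclidean_space \<Rightarrow> 'v"
  assumes T: "orthogonal_transformation T"
  shows "distr std_gaussian borel T = std_gaussian"
proof -
  have lin: "linear T" using T by (rule orthogonal_transformation_linear)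
  note [measurable] = linear_borel_measurable[OF lin]
  let ?g = "\<lambda>x::'v. ennreal ((1 / sqrt (2 * pi)) ^ DIM('v) * exp (- (norm x)\<^sup>2 / 2))"
  have "distr std_gaussian borel T = distr (density lborel (?g \<circ> T)) borel T"
    unfolding std_gaussian_eq using T by (simp add: orthogonal_transformation_norm o_def)
  also have "\<dots> = density (distr lborel borel T) ?g"
    by (subst density_distr) (auto simp: o_def)
  also have "\<dots> = std_gaussian"
    by (simp add: distr_lborel_orthogonal_transformation[OF T] std_gaussian_eq)
  finally show ?thesis .
qed

text \<open>The squared norm of a pair is the sum of the squared norms. An independent copy can thus
  be adjoined as second component of one standard Gaussian vector, where an orthogonal map may mix
  the two.\<close>

lemma std_gaussian_pair:
  "(std_gaussian :: ('v::euclidean_space \<times> 'w::euclidean_space) measure) = std_gaussian \<Otimes>\<^sub>M std_gaussian"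
proof -
  have N: "sigma_finite_measure (density lborel (\<lambda>x. ennreal ((1 / sqrt (2 * pi)) ^ DIM('w) * exp (- (norm (x::'w))\<^sup>2 / 2))))"
    using std_gaussian.sigma_finite_measure_axioms[where 'a='w] by (simp only: std_gaussian_eq)
  have "(std_gaussian :: 'v measure) \<Otimes>\<^sub>M (std_gaussian :: 'w measure) =
     density (lborel \<Otimes>\<^sub>M lborel) (\<lambda>(x, y). ennreal ((1 / sqrt (2 * pi)) ^ DIM('v) * exp (- (norm x)\<^sup>2 / 2)) *
       ennreal ((1 / sqrt (2 * pi)) ^ DIM('w) * exp (- (norm y)\<^sup>2 / 2)))"
    unfolding std_gaussian_eq
    by (intro pair_measure_density sigma_finite_lborel N) simp_all
  also have "\<dots> = std_gaussian"
  proof -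
    have "ennreal ((1 / sqrt (2 * pi)) ^ DIM('v) * exp (- (norm x)\<^sup>2 / 2)) *
       ennreal ((1 / sqrt (2 * pi)) ^ DIM('w) * exp (- (norm y)\<^sup>2 / 2)) =
       ennreal ((1 / sqrt (2 * pi)) ^ DIM('v \<times> 'w) * exp (- (norm (x, y))\<^sup>2 / 2))" for x :: 'v and y :: 'w
    proof -
      have "(norm (x, y))\<^sup>2 = (norm x)\<^sup>2 + (norm y)\<^sup>2"
        by (simp add: norm_Pair)
      then have "exp (- (norm (x, y))\<^sup>2 / 2) = exp (- (norm x)\<^sup>2 / 2) * exp (- (norm y)\<^sup>2 / 2)"
        by (simp add: exp_add[symmetric] add_divide_distrib)
      then show ?thesis
        by (subst ennreal_mult[symmetric]) (simp_all add: power_add)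
    qed
    then show ?thesis
      unfolding std_gaussian_eq lborel_prod by (simp add: case_prod_unfold)
  qed
  finally show ?thesis by (rule sym)
qed

lemma distr_pair_snd_prob:
  assumes "prob_space M" "sigma_finite_measure N"
  shows "distr (M \<Otimes>\<^sub>M N) N snd = N"
proof (rule measure_eqI)
  interpret M: prob_space M by fact
  interpret N: sigma_finite_measure N by fact
  fix A assume A: "A \<in> sets (distr (M \<Otimes>\<^sub>M N) N snd)"
  then have "snd -` A \<inter> space (M \<Otimes>\<^sub>M N) = space M \<times> A"
    using sets.sets_into_space[of A N] by (auto simp: space_pair_measure)
  with A show "emeasure (distr (M \<Otimes>\<^sub>M N) N snd) A = emeasure N A"
    by (simp add: emeasure_distr N.emeasure_pair_measure_Times M.emeasure_space_1)
qed simp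

text \<open>The orthogonal map behind both the push-forward and the resampling of a Gaussian vector:
  it exchanges the component of \<open>z\<close> seen by \<open>p\<close> with the independent copy \<open>y\<close>.\<close>

lemma orthogonal_transformation_exchange:
  fixes p :: "'v::euclidean_space \<Rightarrow> 'w::euclidean_space"
  assumes p: "linear p" and iso: "\<And>y. norm (adjoint p y) = norm y"
  shows "orthogonal_transformation (\<lambda>(z, y). (z - adjoint p (p z) + adjoint p y, p z))"
    (is "orthogonal_transformation ?T")
proof -
  define q where "q = adjoint p"
  have q: "linear q" unfolding q_def by (rule adjoint_linear[OF p])
  have pq_inner: "p z \<bullet> y = z \<bullet> q y" for z y
    using adjoint_works[OF p] by (simp add: q_def)
  have qq: "q y \<bullet> q y' = y \<bullet> y'" for y y'
    using iso[of "y + y'"] iso[of y] iso[of y']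
    by (simp add: dot_norm q_def[symmetric] linear_add[OF q])
  \<comment> \<open>Hence \<open>q (p z)\<close> is the orthogonal projection of \<open>z\<close>
    onto the range of the isometry \<open>q\<close>.\<close>
  have pq: "p (q y) = y" for y
    by (rule vector_eq_ldot[THEN iffD1]) (metis pq_inner qq inner_commute)
  show ?thesis unfolding orthogonal_transformation q_def[symmetric]
  proof safe
    show "linear (\<lambda>(z, y). (z - q (p z) + q y, p z))"
      by (rule linearI) (auto simp: linear_add[OF p] linear_add[OF q] linear_cmul[OF p] linear_cmul[OF q] algebra_simps)
    fix z y
    \<comment> \<open>\<open>z\<close> is the orthogonal sum of \<open>?a\<close> and
      \<open>q (p z)\<close>. The map puts \<open>q y\<close> in place of the latter and hands out
      \<open>p z\<close>, which has the same norm, as second component; norms are only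
      redistributed.\<close>
    let ?a = "z - q (p z)"
    have a: "?a \<bullet> q w = 0" for w
      by (simp add: pq_inner[symmetric] linear_diff[OF p] pq)
    have "(norm (?a + q y))\<^sup>2 + (norm (p z))\<^sup>2 = (norm ?a)\<^sup>2 + (norm y)\<^sup>2 + (norm (p z))\<^sup>2"
      using a[of y] by (simp add: power2_norm_eq_inner inner_add inner_commute qq)
    also have "(norm ?a)\<^sup>2 + (norm (p z))\<^sup>2 = (norm (?a + q (p z)))\<^sup>2"
      using a[of "p z"] unfolding power2_norm_eq_inner inner_add_left inner_add_right
      by (simp add: inner_commute[of "q (p z)" ?a] qq)
    then have "(norm ?a)\<^sup>2 + (norm y)\<^sup>2 + (norm (p z))\<^sup>2 = (norm z)\<^sup>2 + (norm y)\<^sup>2"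
      by simp
    finally show "norm (?a + q y, p z) = norm (z, y)"
      by (simp add: norm_Pair)
  qed
qed

text \<open>\<open>p\<close> is the second component of the exchange map, so its law is a marginal
  of the invariant law on the product. This is how rotation invariance reaches maps between spaces
  of different dimension.\<close>

lemma distr_std_gaussian_coisometry:
  fixes p :: "'v::euclidean_space \<Rightarrow> 'w::euclidean_space"
  assumes p: "linear p" and iso: "\<And>y. norm (adjoint p y) = norm y"
  shows "distr std_gaussian borel p = std_gaussian"
proof -
  let ?T = "\<lambda>(z, y). (z - adjoint p (p z) + adjoint p y, p z)"
  let ?S = "std_gaussian :: ('v \<times> 'w) measure"
  have T: "orthogonal_transformation ?T" by (rule orthogonal_transformation_exchange[OF p iso])
  note [measurable] = linear_borel_measurable[OF p]
    linear_borel_measurable[OF orthogonal_transformation_linear[OF T]]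
  have [measurable]: "(fst :: 'v \<times> 'w \<Rightarrow> 'v) \<in> borel_measurable borel"
      "(snd :: 'v \<times> 'w \<Rightarrow> 'w) \<in> borel_measurable borel"
    by (intro linear_borel_measurable, simp add: linear_iff)+
  have fst_law: "distr ?S borel fst = std_gaussian"
    using std_gaussian.distr_pair_fst[where N="std_gaussian :: 'v measure" and ?'a='w]
    unfolding std_gaussian_pair by (simp cong: distr_cong)
  have snd_law: "distr ?S borel snd = std_gaussian"
    using distr_pair_snd_prob[OF prob_space_std_gaussian std_gaussian.sigma_finite_measure_axioms]
    unfolding std_gaussian_pair by (simp cong: distr_cong)
  have "distr std_gaussian borel p = distr (distr ?S borel fst) borel p"
    by (simp add: fst_law)
  also have "\<dots> = distr ?S borel (\<lambda>x. snd (?T x))"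
    by (subst distr_distr) (auto simp: o_def case_prod_unfold)
  also have "\<dots> = distr (distr ?S borel ?T) borel snd"
    by (subst distr_distr) (auto simp: o_def)
  also have "\<dots> = std_gaussian"
    by (simp add: distr_std_gaussian_orthogonal_transformation[OF T] snd_law)
  finally show ?thesis .
qed

lemma adjoint_scaleR:
  fixes f :: "'v::euclidean_space \<Rightarrow> 'w::euclidean_space"
  assumes "linear f"
  shows "adjoint (\<lambda>x. c *\<^sub>R f x) = (\<lambda>y. c *\<^sub>R adjoint f y)"
  by (rule adjoint_unique) (simp add: adjoint_works[OF assms])

lemma distr_std_gaussian_scaled_coisometry:
  fixes L :: "'v::euclidean_space \<Rightarrow> 'w::euclidean_space"
  assumes L: "linear L" and k: "k > 0" and iso: "\<And>y. norm (adjoint L y) = k * norm y"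
  shows "distr std_gaussian borel L = distr std_gaussian borel (\<lambda>y. k *\<^sub>R y)"
proof -
  define p where "p = (\<lambda>x. (1/k) *\<^sub>R L x)"
  have p: "linear p" unfolding p_def using L by (simp add: linear_compose_scale_right)
  have "adjoint p = (\<lambda>y. (1/k) *\<^sub>R adjoint L y)" unfolding p_def by (rule adjoint_scaleR[OF L])
  then have "norm (adjoint p y) = norm y" for y using k by (simp add: iso)
  then have 1: "distr std_gaussian borel p = std_gaussian" by (rule distr_std_gaussian_coisometry[OF p])
  note [measurable] = linear_borel_measurable[OF p]
  have "distr (distr std_gaussian borel p) borel (\<lambda>y. k *\<^sub>R y) = distr std_gaussian borel (\<lambda>x. k *\<^sub>R p x)"
    by (subst distr_distr) (auto simp: o_def)
  then show ?thesis using 1 k by (simp add: p_def)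
qed

section \<open>Moments and resampling\<close>

lemma std_gaussian_real: "(std_gaussian :: real measure) = density lborel std_normal_density"
  by (simp add: std_gaussian_def)

lemma std_gaussian_moments_real:
  "integrable std_gaussian (\<lambda>x::real. x)" "(\<integral>x. (x::real) \<partial>std_gaussian) = 0"
  "integrable std_gaussian (\<lambda>x::real. x\<^sup>2)" "(\<integral>x. (x::real)\<^sup>2 \<partial>std_gaussian) = 1"
proof -
  have 1: "has_bochner_integral lborel (\<lambda>x. std_normal_density x * x) 0"
    by (rule normal_moment_nz_1) simp
  have 2: "has_bochner_integral lborel (\<lambda>x. std_normal_density x * x ^ (2 * 1)) (fact (2 * 1) / (2^1 * fact 1))"
    by (rule std_normal_moment_even)
  have 2: "has_bochner_integral lborel (\<lambda>x. std_normal_density x * x\<^sup>2) 1"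
    using 2 by (simp add: fact_2)
  show "integrable std_gaussian (\<lambda>x::real. x)" "(\<integral>x. (x::real) \<partial>std_gaussian) = 0"
    using 1 unfolding std_gaussian_real has_bochner_integral_iff
    by (auto simp: integrable_density integral_density)
  show "integrable std_gaussian (\<lambda>x::real. x\<^sup>2)" "(\<integral>x. (x::real)\<^sup>2 \<partial>std_gaussian) = 1"
    using 2 unfolding std_gaussian_real has_bochner_integral_iff
    by (auto simp: integrable_density integral_density)
qed

lemma distr_std_gaussian_inner:
  fixes a :: "'v::euclidean_space"
  assumes "a \<noteq> 0"
  shows "distr std_gaussian borel (\<lambda>z. z \<bullet> a) = distr std_gaussian borel (\<lambda>t. norm a * t)"
proof -
  have "adjoint (\<lambda>z. z \<bullet> a) = (\<lambda>t. t *\<^sub>R a)"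
    by (rule adjoint_unique) (simp add: inner_commute)
  then show ?thesis
    using distr_std_gaussian_scaled_coisometry[of "\<lambda>z. z \<bullet> a" "norm a"] assms
    by (simp add: linear_iff inner_add_left)
qed

lemma std_gaussian_inner_moments:
  fixes a :: "'v::euclidean_space"
  shows "integrable std_gaussian (\<lambda>z. z \<bullet> a)" "(\<integral>z. z \<bullet> a \<partial>std_gaussian) = 0"
    and "integrable std_gaussian (\<lambda>z. (z \<bullet> a)\<^sup>2)" "(\<integral>z. (z \<bullet> a)\<^sup>2 \<partial>std_gaussian) = (norm a)\<^sup>2"
proof -
  have A: "integrable std_gaussian (\<lambda>z. z \<bullet> a) \<and> (\<integral>z. z \<bullet> a \<partial>std_gaussian) = 0 \<and>
     integrable std_gaussian (\<lambda>z. (z \<bullet> a)\<^sup>2) \<and> (\<integral>z. (z \<bullet> a)\<^sup>2 \<partial>std_gaussian) = (norm a)\<^sup>2"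
  proof (cases "a = 0")
    case False
    note d = distr_std_gaussian_inner[OF False]
    have "integrable (distr std_gaussian borel (\<lambda>z. z \<bullet> a)) (\<lambda>x. x)"
         "integrable (distr std_gaussian borel (\<lambda>z. z \<bullet> a)) (\<lambda>x. x\<^sup>2)"
         "(\<integral>x. x \<partial>distr std_gaussian borel (\<lambda>z. z \<bullet> a)) = 0"
         "(\<integral>x. x\<^sup>2 \<partial>distr std_gaussian borel (\<lambda>z. z \<bullet> a)) = (norm a)\<^sup>2"
      unfolding d
      by (auto simp: integrable_distr_eq integral_distr power_mult_distrib std_gaussian_moments_real
           intro!: integrable_mult_right)
    then show ?thesis by (simp add: integrable_distr_eq integral_distr)
  qed simp
  then show "integrable std_gaussian (\<lambda>z. z \<bullet> a)" "(\<integral>z. z \<bullet> a \<partial>std_gaussian) = 0"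
    and "integrable std_gaussian (\<lambda>z. (z \<bullet> a)\<^sup>2)" "(\<integral>z. (z \<bullet> a)\<^sup>2 \<partial>std_gaussian) = (norm a)\<^sup>2"
    by auto
qed

lemma std_gaussian_inner_covariance:
  fixes a b :: "'v::euclidean_space"
  shows "integrable std_gaussian (\<lambda>z. (z \<bullet> a) * (z \<bullet> b))" (is ?I)
    and "(\<integral>z. (z \<bullet> a) * (z \<bullet> b) \<partial>std_gaussian) = a \<bullet> b" (is ?E)
proof -
  \<comment> \<open>Polarisation reduces the mixed moment to squares.\<close>
  have *: "(z \<bullet> a) * (z \<bullet> b) = ((z \<bullet> (a + b))\<^sup>2 - (z \<bullet> a)\<^sup>2 - (z \<bullet> b)\<^sup>2) / 2" for z
    by (simp add: inner_add_right power2_eq_square algebra_simps)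
  show ?I unfolding * by (intro integrable_divide Bochner_Integration.integrable_diff std_gaussian_inner_moments)
  have "(\<integral>z. ((z \<bullet> (a + b))\<^sup>2 - (z \<bullet> a)\<^sup>2 - (z \<bullet> b)\<^sup>2) / 2 \<partial>std_gaussian) =
      ((norm (a + b))\<^sup>2 - (norm a)\<^sup>2 - (norm b)\<^sup>2) / 2"
    by (simp add: std_gaussian_inner_moments Bochner_Integration.integrable_diff del: inner_add_right)
  then show ?E unfolding *
    by (simp add: dot_norm)
qed

text \<open>Resampling: the component \<open>U x\<close> of a centred Gaussian vector is replaced by an independent
  Gaussian vector, the rest (uncorrelated with \<open>U x\<close>) being kept.\<close>

lemma gaussian_resample:
  fixes L :: "'v::euclidean_space \<Rightarrow> 'u::euclidean_space" and U :: "'u \<Rightarrow> 'w::euclidean_space"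
    and E :: "'w \<Rightarrow> 'u"
  defines "\<mu> \<equiv> distr std_gaussian borel L"
  assumes L: "linear L" and U: "linear U" and E: "linear E" and k: "k > 0"
    and UE: "\<And>y. U (E y) = y"
    and cov: "\<And>a y. (\<integral>x. (x \<bullet> a) * (U x \<bullet> y) \<partial>\<mu>) = k\<^sup>2 * (E y \<bullet> a)"
  shows "distr (\<mu> \<Otimes>\<^sub>M std_gaussian) borel (\<lambda>(x, y). x + E (k *\<^sub>R y - U x)) = \<mu>"
proof -
  define q where "q = adjoint (\<lambda>z. U (L z))"
  have UL: "linear (\<lambda>z. U (L z))" using linear_compose[OF L U] by (simp add: o_def)
  have q: "linear q" unfolding q_def by (rule adjoint_linear[OF UL])
  note [measurable] = linear_borel_measurable[OF L] linear_borel_measurable[OF U] linear_borel_measurable[OF E]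
  have q_inner: "U (L z) \<bullet> y = z \<bullet> q y" for z y using adjoint_works[OF UL] by (simp add: q_def)
  \<comment> \<open>\<open>L \<circ> q\<close> is the cross covariance of \<open>x\<close> and
    \<open>U x\<close>; the hypothesis \<open>cov\<close> identifies it as \<open>k\<^sup>2\<close>
    times \<open>E\<close>.\<close>
  have "L (q y) \<bullet> a = k\<^sup>2 *\<^sub>R E y \<bullet> a" for a y
  proof -
    have "L (q y) \<bullet> a = q y \<bullet> adjoint L a" by (simp add: adjoint_works[OF L])
    also have "\<dots> = (\<integral>z. (z \<bullet> adjoint L a) * (z \<bullet> q y) \<partial>std_gaussian)"
      by (simp add: std_gaussian_inner_covariance inner_commute)
    also have "\<dots> = (\<integral>z. (L z \<bullet> a) * (U (L z) \<bullet> y) \<partial>std_gaussian)"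
      by (simp add: q_inner adjoint_works[OF L])
    also have "\<dots> = k\<^sup>2 *\<^sub>R E y \<bullet> a"
      unfolding inner_scaleR_left cov[symmetric] \<mu>_def by (subst integral_distr) auto
    finally show ?thesis .
  qed
  then have Lq: "L (q y) = k\<^sup>2 *\<^sub>R E y" for y by (metis vector_eq_rdot)
  \<comment> \<open>Division by \<open>k\<close> makes \<open>p\<close> a coisometry:
    \<open>U \<circ> L \<circ> q\<close> is \<open>k\<^sup>2\<close> times the identity because
    \<open>U \<circ> E\<close> is the identity.\<close>
  define p where "p = (\<lambda>z. (1/k) *\<^sub>R U (L z))"
  have p: "linear p" unfolding p_def using UL by (simp add: linear_compose_scale_right)
  have p_adj: "adjoint p = (\<lambda>y. (1/k) *\<^sub>R q y)" unfolding p_def q_def by (rule adjoint_scaleR[OF UL])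
  have "norm (q y) = k * norm y" for y
  proof -
    have "(norm (q y))\<^sup>2 = U (L (q y)) \<bullet> y" by (simp add: q_inner power2_norm_eq_inner)
    also have "\<dots> = (k * norm y)\<^sup>2"
      by (simp add: Lq linear_cmul[OF U] UE power_mult_distrib power2_norm_eq_inner)
    finally show ?thesis using k by (simp add: power2_eq_iff_nonneg)
  qed
  then have iso: "norm (adjoint p y) = norm y" for y using k by (simp add: p_adj)
  let ?T = "\<lambda>(z, y). (z - adjoint p (p z) + adjoint p y, p z)"
  let ?S = "std_gaussian :: ('v \<times> 'w) measure"
  have T: "orthogonal_transformation ?T" by (rule orthogonal_transformation_exchange[OF p iso])
  note [measurable] = linear_borel_measurable[OF orthogonal_transformation_linear[OF T]]
  have [measurable]: "(fst :: 'v \<times> 'w \<Rightarrow> 'v) \<in> borel_measurable borel"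
      "(snd :: 'v \<times> 'w \<Rightarrow> 'w) \<in> borel_measurable borel"
    by (intro linear_borel_measurable, simp add: linear_iff)+
  have fst_law: "distr ?S borel fst = std_gaussian"
    using std_gaussian.distr_pair_fst[where N="std_gaussian :: 'v measure" and ?'a='w]
    unfolding std_gaussian_pair by (simp cong: distr_cong)
  \<comment> \<open>\<open>L\<close> sends the removed part \<open>adjoint p (p z)\<close> to
    \<open>E (U (L z))\<close> and the inserted part \<open>adjoint p y\<close> to
    \<open>E (k *\<^sub>R y)\<close>.\<close>
  have TL: "L (fst (?T (z, y))) = L z + E (k *\<^sub>R y - U (L z))" for z y
  proof -
    have "L (fst (?T (z, y))) = L z - L (q ((1/k\<^sup>2) *\<^sub>R U (L z))) + L (q ((1/k) *\<^sub>R y))"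
      unfolding p_adj using k by (simp add: p_def linear_add[OF L] linear_diff[OF L] linear_cmul[OF q] power2_eq_square)
    also have "\<dots> = L z + E (k *\<^sub>R y - U (L z))"
      unfolding Lq using k
      by (simp add: linear_diff[OF E] linear_cmul[OF E] power2_eq_square)
    finally show ?thesis .
  qed
  have "\<mu> = distr (distr (distr ?S borel ?T) borel fst) borel L"
    unfolding distr_std_gaussian_orthogonal_transformation[OF T] fst_law \<mu>_def ..
  also have "\<dots> = distr ?S borel (\<lambda>x. L (fst (?T x)))"
    by (subst distr_distr) (auto simp: o_def distr_distr)
  also have "\<dots> = distr ?S borel (\<lambda>(z, y). L z + E (k *\<^sub>R y - U (L z)))"
    using TL by (intro distr_cong) auto
  \<comment> \<open>The second factor appears as a push-forward along the identity so that
    \<open>pair_measure_distr\<close> applies to both factors.\<close>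
  also have "\<dots> = distr (\<mu> \<Otimes>\<^sub>M distr std_gaussian borel (\<lambda>y. y)) borel (\<lambda>(x, y). x + E (k *\<^sub>R y - U x))"
    unfolding \<mu>_def
    by (subst pair_measure_distr)
      (auto simp: distr_distr o_def case_prod_unfold std_gaussian_pair distr_id2 std_gaussian.sigma_finite_measure_axioms)
  also have "distr std_gaussian borel (\<lambda>y::'w. y) = std_gaussian"
    by (simp add: distr_id2)
  finally show ?thesis by (rule sym)
qed

text \<open>The hypothesis on second moments says that the adjoint of \<open>U \<circ> L\<close>
  scales norms by \<open>k\<close>, so \<open>U \<circ> L\<close> is a scaled coisometry.
  Projections of the noise are treated this way.\<close>

lemma distr_gaussian_linear:
  fixes L :: "'v::euclidean_space \<Rightarrow> 'u::euclidean_space" and U :: "'u \<Rightarrow> 'w::euclidean_space"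
  defines "\<mu> \<equiv> distr std_gaussian borel L"
  assumes L: "linear L" and U: "linear U" and k: "k > 0"
    and cov: "\<And>y. (\<integral>x. (U x \<bullet> y)\<^sup>2 \<partial>\<mu>) = k\<^sup>2 * (norm y)\<^sup>2"
  shows "distr \<mu> borel U = distr std_gaussian borel (\<lambda>y. k *\<^sub>R y)"
proof -
  have UL: "linear (\<lambda>z. U (L z))" using linear_compose[OF L U] by (simp add: o_def)
  note [measurable] = linear_borel_measurable[OF L] linear_borel_measurable[OF U]
  have "norm (adjoint (\<lambda>z. U (L z)) y) = k * norm y" for y
  proof -
    have "(norm (adjoint (\<lambda>z. U (L z)) y))\<^sup>2 = (\<integral>z. (z \<bullet> adjoint (\<lambda>z. U (L z)) y)\<^sup>2 \<partial>std_gaussian)"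
      by (simp add: std_gaussian_inner_moments)
    also have "\<dots> = (\<integral>z. (U (L z) \<bullet> y)\<^sup>2 \<partial>std_gaussian)"
      by (simp add: adjoint_works[OF UL])
    also have "\<dots> = (k * norm y)\<^sup>2"
      unfolding power_mult_distrib cov[symmetric] \<mu>_def by (subst integral_distr) auto
    finally show ?thesis using k by (simp add: power2_eq_iff_nonneg)
  qed
  from distr_std_gaussian_scaled_coisometry[OF UL k this]
  show ?thesis unfolding \<mu>_def by (subst distr_distr) (auto simp: o_def)
qed

section \<open>Laplace transforms of squared coordinates\<close>

lemma nn_integral_std_gaussian_exp_square:
  assumes "c \<ge> 0"
  shows "(\<integral>\<^sup>+x. ennreal (exp (- c * (x::real)\<^sup>2)) \<partial>std_gaussian) = ennreal (1 / sqrt (1 + 2 * c))"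
proof -
  let ?s = "1 / sqrt (1 + 2 * c)"
  have s: "?s > 0" using assms by simp
  \<comment> \<open>Tilting the normal density by exp(-c x^2) gives a normal density of variance 1 /
    (1 + 2 c), times its deviation \<open>?s\<close>.\<close>
  have *: "std_normal_density x * exp (- c * x\<^sup>2) = ?s * normal_density 0 ?s x" for x
  proof -
    have "exp (- x\<^sup>2 / 2) * exp (- c * x\<^sup>2) = exp (- (x - 0)\<^sup>2 / (2 * ?s\<^sup>2))"
      using assms by (simp add: exp_add[symmetric] power_divide field_simps)
    moreover have "1 / sqrt (2 * pi) = ?s * (1 / sqrt (2 * pi * ?s\<^sup>2))"
      using assms by (simp add: real_sqrt_mult real_sqrt_divide power_divide)
    moreover have "std_normal_density x = 1 / sqrt (2 * pi) * exp (- x\<^sup>2 / 2)"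
      by (simp add: std_normal_density_def)
    ultimately show ?thesis unfolding normal_density_def
      by (metis (no_types, lifting) mult.assoc)
  qed
  have "(\<integral>\<^sup>+x. ennreal (exp (- c * (x::real)\<^sup>2)) \<partial>std_gaussian) =
    (\<integral>\<^sup>+x. ennreal ?s * ennreal (normal_density 0 ?s x) \<partial>lborel)"
    unfolding std_gaussian_real
    by (subst nn_integral_density) (use s in \<open>auto simp: ennreal_mult[symmetric] *[simplified] intro!: nn_integral_cong\<close>)
  also have "\<dots> = ennreal ?s * (\<integral>\<^sup>+x. ennreal (normal_density 0 ?s x) \<partial>lborel)"
    by (rule nn_integral_cmult) simp
  also have "(\<integral>\<^sup>+x. ennreal (normal_density 0 ?s x) \<partial>lborel) = 1"
    using prob_space.emeasure_space_1[OF prob_space_normal_density[OF s, of 0]]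
    by (simp add: emeasure_density)
  finally show ?thesis by simp
qed

text \<open>Coordinates along orthonormal vectors are independent. In the induction this is an
  instance of resampling: replacing the coordinate along \<open>b\<close> by a fresh real Gaussian
  leaves the coordinates along \<open>B\<close> alone, since \<open>b\<close> is orthogonal to
  \<open>B\<close>.\<close>

lemma nn_integral_std_gaussian_exp_orthonormal:
  fixes B :: "'v::euclidean_space set"
  assumes c: "c \<ge> 0" and fin: "finite B" and "pairwise orthogonal B" and "\<And>b. b \<in> B \<Longrightarrow> norm b = 1"
  shows "(\<integral>\<^sup>+x. ennreal (exp (- c * (\<Sum>b\<in>B. (x \<bullet> b)\<^sup>2))) \<partial>std_gaussian) =
    ennreal ((1 / sqrt (1 + 2 * c)) ^ card B)"
  using fin assms(3-)
proof (induction B rule: finite_induct)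
  case empty
  show ?case using std_gaussian.emeasure_space_1 by simp
next
  case (insert b B)
  have orth: "b' \<bullet> b = 0" if "b' \<in> B" for b'
    using insert.prems(1) insert.hyps(2) that by (auto simp: pairwise_insert orthogonal_def)
  have b1: "b \<bullet> b = 1" using insert.prems(2)[of b] by (simp add: norm_eq_1)
  let ?e = "\<lambda>x::'v. ennreal (exp (- c * (\<Sum>b\<in>B. (x \<bullet> b)\<^sup>2)))"
  let ?g = "\<lambda>x::real. ennreal (exp (- c * x\<^sup>2))"
  let ?r = "\<lambda>(x, y). x + (1 *\<^sub>R y - (x \<bullet> b)) *\<^sub>R b"
  \<comment> \<open>Resampling with \<open>L\<close> the identity, \<open>U\<close> the coordinate
    along \<open>b\<close>, \<open>E\<close> its embedding, and \<open>k = 1\<close>.\<close>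
  have r: "distr (std_gaussian \<Otimes>\<^sub>M std_gaussian) borel ?r = std_gaussian"
  proof -
    have id: "distr std_gaussian borel (\<lambda>x::'v. x) = std_gaussian" by (simp add: distr_id2)
    have "(\<integral>x. (x \<bullet> a) * ((x \<bullet> b) \<bullet> y) \<partial>std_gaussian) = 1\<^sup>2 * ((y *\<^sub>R b) \<bullet> a)" for a y
      using std_gaussian_inner_covariance(2)[of a "y *\<^sub>R b"] by (simp add: inner_commute mult.commute)
    then show ?thesis
      using gaussian_resample[of "\<lambda>x. x" "\<lambda>x. x \<bullet> b" "\<lambda>y. y *\<^sub>R b" 1] b1
      unfolding id by (simp add: linear_iff inner_add_left scaleR_add_left)
  qed
  have [measurable]: "?r \<in> borel_measurable (std_gaussian \<Otimes>\<^sub>M std_gaussian)"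
    by (simp add: case_prod_unfold)
  have rB: "?r (x, y) \<bullet> b' = x \<bullet> b'" if "b' \<in> B" for x y b'
    using orth[OF that] inner_commute[of b b'] by (simp add: inner_add_left)
  have rb: "?r (x, y) \<bullet> b = y" for x y
    using b1 by (simp add: inner_add_left)
  have "(\<integral>\<^sup>+x. ennreal (exp (- c * (\<Sum>b\<in>insert b B. (x \<bullet> b)\<^sup>2))) \<partial>std_gaussian) =
     (\<integral>\<^sup>+x. ?e x * ?g (x \<bullet> b) \<partial>distr (std_gaussian \<Otimes>\<^sub>M std_gaussian) borel ?r)"
    unfolding r
  proof (rule nn_integral_cong)
    fix x :: 'v
    have "exp (- c * (\<Sum>b\<in>insert b B. (x \<bullet> b)\<^sup>2)) = exp (- c * (\<Sum>b\<in>B. (x \<bullet> b)\<^sup>2)) * exp (- c * (x \<bullet> b)\<^sup>2)"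
      using insert.hyps unfolding mult_exp_exp by (simp add: distrib_left)
    then show "ennreal (exp (- c * (\<Sum>b\<in>insert b B. (x \<bullet> b)\<^sup>2))) = ?e x * ?g (x \<bullet> b)"
      by (simp add: ennreal_mult[symmetric])
  qed
  also have "\<dots> = (\<integral>\<^sup>+w. ?e (fst w) * ?g (snd w) \<partial>(std_gaussian \<Otimes>\<^sub>M std_gaussian))"
  proof -
    have "?e (?r w) * ?g (?r w \<bullet> b) = ?e (fst w) * ?g (snd w)" for w
    proof -
      obtain x y where w: "w = (x, y)" by (cases w)
      have "(\<Sum>b\<in>B. (?r w \<bullet> b)\<^sup>2) = (\<Sum>b\<in>B. (x \<bullet> b)\<^sup>2)"
        unfolding w by (intro sum.cong refl) (simp only: rB)
      then show ?thesis unfolding w rb by simp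
    qed
    then show ?thesis
      by (subst nn_integral_distr) auto
  qed
  also have "\<dots> = (\<integral>\<^sup>+x. \<integral>\<^sup>+y. ?e x * ?g y \<partial>std_gaussian \<partial>std_gaussian)"
    by (subst std_gaussian.nn_integral_fst[symmetric]) auto
  also have "\<dots> = (\<integral>\<^sup>+x. ?e x \<partial>std_gaussian) * (\<integral>\<^sup>+y. ?g y \<partial>std_gaussian)"
    by (simp add: nn_integral_cmult nn_integral_multc)
  also have "\<dots> = ennreal ((1 / sqrt (1 + 2 * c)) ^ card (insert b B))"
    unfolding nn_integral_std_gaussian_exp_square[OF c]
    using insert c by (subst insert.IH) (auto simp: pairwise_insert ennreal_mult[symmetric])
  finally show ?case .
qed

section \<open>Gaussian matrices with independent rows\<close>

lemma borel_measurable_vec_lambda: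
  "(vec_lambda :: ('r::finite \<Rightarrow> 'v::euclidean_space) \<Rightarrow> 'v ^ 'r) \<in> (\<Pi>\<^sub>M i\<in>UNIV. borel) \<rightarrow>\<^sub>M borel"
proof (subst borel_measurable_euclidean_space, safe)
  fix e :: "'v ^ 'r" assume "e \<in> Basis"
  then obtain i b where e: "e = axis i b" and b: "b \<in> Basis" by (auto simp: Basis_vec_def)
  have "(\<lambda>x. vec_lambda x \<bullet> e) = (\<lambda>x. x i \<bullet> b)" by (auto simp: e inner_axis)
  then show "(\<lambda>x. vec_lambda x \<bullet> e) \<in> borel_measurable (\<Pi>\<^sub>M i\<in>UNIV. borel)" by simp
qed

lemma borel_measurable_vec_nth [measurable]:
  "(\<lambda>x::'v::euclidean_space ^ 'r::finite. x $ i) \<in> borel_measurable borel"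
  by (intro borel_measurable_continuous_onI continuous_intros)

lemma prod_Basis_vec:
  "(\<Prod>e\<in>(Basis :: ('v::euclidean_space ^ 'r::finite) set). f e) = (\<Prod>i\<in>UNIV. \<Prod>b\<in>Basis. f (axis i b))"
proof -
  have A: "(Basis :: ('v ^ 'r) set) = (\<lambda>(i, b). axis i b) ` (UNIV \<times> Basis)"
    by (auto simp: Basis_vec_def)
  have B: "inj_on (\<lambda>(i::'r, b::'v). axis i b) (UNIV \<times> Basis)"
    by (auto simp: inj_on_def axis_eq_axis)
  show ?thesis
    by (subst A, subst prod.reindex[OF B]) (simp add: prod.cartesian_product case_prod_unfold)
qed

lemma lborel_vec:
  "distr (\<Pi>\<^sub>M i\<in>UNIV. lborel) borel vec_lambda = (lborel :: ('v::euclidean_space ^ 'r::finite) measure)"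
proof (rule lborel_eqI[symmetric])
  interpret product_sigma_finite "\<lambda>_::'r. lborel :: 'v measure" ..
  have [measurable]: "vec_lambda \<in> (\<Pi>\<^sub>M i\<in>UNIV. lborel) \<rightarrow>\<^sub>M (borel :: ('v ^ 'r) measure)"
    using borel_measurable_vec_lambda
    by (subst measurable_cong_sets[OF sets_PiM_cong[OF refl sets_lborel] refl])
  fix l u :: "'v ^ 'r" assume le: "\<And>e. e \<in> Basis \<Longrightarrow> l \<bullet> e \<le> u \<bullet> e"
  have le': "l $ i \<bullet> b \<le> u $ i \<bullet> b" if "b \<in> Basis" for i b
    using le[of "axis i b"] that by (auto simp: inner_axis Basis_vec_def)
  have "vec_lambda -` box l u = Pi\<^sub>E UNIV (\<lambda>i. box (l $ i) (u $ i))"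
    by (auto simp: mem_box Basis_vec_def inner_axis PiE_UNIV_domain Pi_iff)
  then have "emeasure (distr (\<Pi>\<^sub>M i\<in>UNIV. lborel) borel vec_lambda) (box l u) =
     (\<Prod>i\<in>UNIV. emeasure lborel (box (l $ i) (u $ i)))"
    by (subst emeasure_distr) (auto simp: space_PiM emeasure_PiM cong: measurable_cong_sets)
  also have "\<dots> = ennreal (\<Prod>b\<in>Basis. (u - l) \<bullet> b)"
    unfolding prod_Basis_vec
    using le' by (subst emeasure_lborel_box) (auto simp: prod_ennreal inner_axis inner_diff_left prod_nonneg)
  finally show "emeasure (distr (\<Pi>\<^sub>M i\<in>UNIV. lborel) borel vec_lambda) (box l u) = ennreal (\<Prod>b\<in>Basis. (u - l) \<bullet> b)" .
qed simp

lemma emeasure_std_gaussian_vec: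
  fixes A :: "'r::finite \<Rightarrow> 'v::euclidean_space set"
  assumes [measurable]: "\<And>i. A i \<in> sets borel"
  shows "emeasure std_gaussian {z. \<forall>i. z $ i \<in> A i} = (\<Prod>i\<in>UNIV. emeasure std_gaussian (A i))"
proof -
  interpret product_sigma_finite "\<lambda>_::'r. lborel :: 'v measure" ..
  have [measurable]: "vec_lambda \<in> (\<Pi>\<^sub>M i\<in>UNIV. lborel) \<rightarrow>\<^sub>M (borel :: ('v ^ 'r) measure)"
    using borel_measurable_vec_lambda
    by (subst measurable_cong_sets[OF sets_PiM_cong[OF refl sets_lborel] refl])
  let ?d = "\<lambda>x::'v. ennreal (\<Prod>b\<in>Basis. std_normal_density (x \<bullet> b))"
  have meas: "{z. \<forall>i. z $ i \<in> A i} \<in> sets (borel :: ('v ^ 'r) measure)"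
    by measurable
  have ind: "indicator {z. \<forall>i. z $ i \<in> A i} z = (\<Prod>i\<in>UNIV. indicator (A i) (z $ i) :: ennreal)" for z :: "'v ^ 'r"
    by (auto simp: indicator_def intro!: prod.neutral)
  have "emeasure std_gaussian {z. \<forall>i. z $ i \<in> A i} =
     (\<integral>\<^sup>+z. (\<Prod>i\<in>UNIV. ?d (z $ i) * indicator (A i) (z $ i)) \<partial>distr (\<Pi>\<^sub>M i\<in>UNIV. lborel) borel vec_lambda)"
    unfolding std_gaussian_def lborel_vec using meas
    by (subst emeasure_density) (auto simp: ind prod.distrib prod_Basis_vec inner_axis prod_ennreal prod_nonneg)
  also have "\<dots> = (\<integral>\<^sup>+x. (\<Prod>i\<in>UNIV. ?d (x i) * indicator (A i) (x i)) \<partial>(\<Pi>\<^sub>M i\<in>UNIV. lborel))"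
    by (subst nn_integral_distr) auto
  also have "\<dots> = (\<Prod>i\<in>UNIV. \<integral>\<^sup>+x. ?d x * indicator (A i) x \<partial>lborel)"
    by (rule product_nn_integral_prod) auto
  also have "\<dots> = (\<Prod>i\<in>UNIV. emeasure std_gaussian (A i))"
    unfolding std_gaussian_def by (subst emeasure_density) auto
  finally show ?thesis .
qed

text \<open>Assembles the row laws into one push-forward of a standard Gaussian matrix, the form in
  which \<open>gaussian_resample\<close> can act on the whole channel. The two laws are compared in
  the product sigma-algebra, where rectangles determine a measure, and \<open>vec_lambda\<close>
  carries the equality back to matrices.\<close>

lemma (in prob_space) distr_indep_gaussian_rows:
  fixes X :: "'a \<Rightarrow> 'v::euclidean_space ^ 'r::finite" and L :: "'r \<Rightarrow> 'v \<Rightarrow> 'v"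
  assumes ind: "indep_vars (\<lambda>_. borel) (\<lambda>i \<omega>. X \<omega> $ i) UNIV"
    and L: "\<And>i. linear (L i)"
    and law: "\<And>i. distr M borel (\<lambda>\<omega>. X \<omega> $ i) = distr std_gaussian borel (L i)"
  shows "X \<in> borel_measurable M" "distr M borel X = distr std_gaussian borel (\<lambda>z. \<chi> i. L i (z $ i))"
proof -
  have row [measurable]: "(\<lambda>\<omega>. X \<omega> $ i) \<in> borel_measurable M" for i
    using ind unfolding indep_vars_def by auto
  note [measurable] = linear_borel_measurable[OF L]
  have X_eq: "X = (\<lambda>\<omega>. vec_lambda (\<lambda>i\<in>UNIV. X \<omega> $ i))" by (auto simp: vec_eq_iff)
  have m: "(\<lambda>\<omega>. \<lambda>i\<in>UNIV. X \<omega> $ i) \<in> M \<rightarrow>\<^sub>M (\<Pi>\<^sub>M i\<in>UNIV. borel)" by measurable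
  show XM [measurable]: "X \<in> borel_measurable M"
    using measurable_compose[OF m borel_measurable_vec_lambda] X_eq by simp
  have m2: "(\<lambda>z::'v ^ 'r. \<lambda>i\<in>UNIV. L i (z $ i)) \<in> std_gaussian \<rightarrow>\<^sub>M (\<Pi>\<^sub>M i\<in>UNIV. borel)" by measurable
  interpret prod: product_prob_space "\<lambda>i::'r. distr std_gaussian borel (L i)"
    by (intro product_prob_spaceI std_gaussian.prob_space_distr) simp
  have "distr M (\<Pi>\<^sub>M i\<in>UNIV. borel) (\<lambda>\<omega>. \<lambda>i\<in>UNIV. X \<omega> $ i) = (\<Pi>\<^sub>M i\<in>UNIV. distr std_gaussian borel (L i))"
    using ind by (subst (asm) indep_vars_iff_distr_eq_PiM) (auto simp: law)
  also have "\<dots> = distr std_gaussian (\<Pi>\<^sub>M i\<in>UNIV. borel) (\<lambda>z. \<lambda>i\<in>UNIV. L i (z $ i))"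
  proof (rule prod.PiM_eqI[symmetric])
    fix A :: "'r \<Rightarrow> 'v set" assume "\<And>i. i \<in> UNIV \<Longrightarrow> A i \<in> sets (distr std_gaussian borel (L i))"
    then have [measurable]: "A i \<in> sets borel" for i by simp
    have P: "Pi\<^sub>E UNIV A \<in> sets (\<Pi>\<^sub>M i\<in>UNIV. borel)" by (intro sets_PiM_I_finite) auto
    have V: "L i -` A i \<in> sets borel" for i
      using measurable_sets[OF linear_borel_measurable[OF L[of i]], of "A i"] by simp
    have "emeasure (distr std_gaussian (\<Pi>\<^sub>M i\<in>UNIV. borel) (\<lambda>z. \<lambda>i\<in>UNIV. L i (z $ i))) (Pi\<^sub>E UNIV A) =
       emeasure std_gaussian {z. \<forall>i. z $ i \<in> L i -` A i}"
      using P by (subst emeasure_distr[OF m2]) (auto intro!: arg_cong2[where f=emeasure] simp: PiE_UNIV_domain)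
    also have "\<dots> = (\<Prod>i\<in>UNIV. emeasure std_gaussian (L i -` A i))"
      using V by (rule emeasure_std_gaussian_vec)
    also have "\<dots> = (\<Prod>i\<in>UNIV. emeasure (distr std_gaussian borel (L i)) (A i))"
      by (simp add: emeasure_distr)
    finally show "emeasure (distr std_gaussian (\<Pi>\<^sub>M i\<in>UNIV. borel) (\<lambda>z. \<lambda>i\<in>UNIV. L i (z $ i))) (Pi\<^sub>E UNIV A) =
       (\<Prod>i\<in>UNIV. emeasure (distr std_gaussian borel (L i)) (A i))" .
  qed (auto intro!: sets_PiM_cong)
  finally have eq: "distr M (\<Pi>\<^sub>M i\<in>UNIV. borel) (\<lambda>\<omega>. \<lambda>i\<in>UNIV. X \<omega> $ i) =
     distr std_gaussian (\<Pi>\<^sub>M i\<in>UNIV. borel) (\<lambda>z. \<lambda>i\<in>UNIV. L i (z $ i))" .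
  have "distr M borel X = distr (distr M (\<Pi>\<^sub>M i\<in>UNIV. borel) (\<lambda>\<omega>. \<lambda>i\<in>UNIV. X \<omega> $ i)) borel vec_lambda"
    by (subst distr_distr[OF borel_measurable_vec_lambda m]) (simp add: o_def restrict_def)
  also have "\<dots> = distr std_gaussian borel (\<lambda>z. \<chi> i. L i (z $ i))"
    unfolding eq by (subst distr_distr[OF borel_measurable_vec_lambda m2]) (simp add: o_def restrict_def)
  finally show "distr M borel X = distr std_gaussian borel (\<lambda>z. \<chi> i. L i (z $ i))" .
qed

section \<open>Circularly symmetric Gaussian vectors\<close>

lemma std_gaussian_mean:
  "integrable std_gaussian (\<lambda>z::'v::euclidean_space. z)" "(\<integral>z. (z::'v) \<partial>std_gaussian) = 0"
proof -
  have *: "(\<lambda>z::'v. z) = (\<lambda>z. \<Sum>b\<in>Basis. (z \<bullet> b) *\<^sub>R b)" by (simp add: euclidean_representation)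
  show "integrable std_gaussian (\<lambda>z::'v. z)"
    by (subst *) (intro Bochner_Integration.integrable_sum integrable_scaleR_left std_gaussian_inner_moments)
  show "(\<integral>z. (z::'v) \<partial>std_gaussian) = 0"
    by (subst *, subst Bochner_Integration.integral_sum)
      (auto simp: std_gaussian_inner_moments)
qed

lemma inner_complex_vec:
  "x \<bullet> a = Re (\<Sum>i\<in>UNIV. cnj (a $ i) * (x $ i))" for x a :: "complex ^ 'n::finite"
  by (simp add: inner_vec_def inner_complex_def algebra_simps)

lemma inner_cis_pi_half:
  "(cis (pi / 2) *s x) \<bullet> a = - Im (\<Sum>i\<in>UNIV. cnj (a $ i) * (x $ i))" for x a :: "complex ^ 'n::finite"
proof -
  have "cis (pi / 2) = \<i>" by (simp add: complex_eq_iff)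
  then have "(cis (pi / 2) *s x) \<bullet> a = Re (\<i> * (\<Sum>i\<in>UNIV. cnj (a $ i) * (x $ i)))"
    unfolding inner_complex_vec sum_distrib_left by (simp add: algebra_simps)
  then show ?thesis by simp
qed

text \<open>By circular symmetry \<open>Re A\<close> and \<open>Re B\<close> have the same cross moment as \<open>Im A\<close> and \<open>Im B\<close>
  for linear forms \<open>A\<close>, \<open>B\<close> of \<open>X\<close>, so that the real covariance is half of the complex one.\<close>

lemma circular_gaussian:
  fixes X :: "'a \<Rightarrow> complex ^ 'n::finite"
  assumes P: "prob_space P" and G: "gaussian_vector P X" and C: "circularly_symmetric P X"
  obtains L :: "complex ^ 'n \<Rightarrow> complex ^ 'n" where "linear L" "distr P borel X = distr std_gaussian borel L"
    "\<And>a b. (\<integral>\<omega>. (X \<omega> \<bullet> a) * (X \<omega> \<bullet> b) \<partial>P) =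
      Re (\<Sum>i\<in>UNIV. \<Sum>j\<in>UNIV. cnj (a $ i) * b $ j * (\<integral>\<omega>. X \<omega> $ i * cnj (X \<omega> $ j) \<partial>P)) / 2"
proof -
  interpret prob_space P by fact
  have X[measurable]: "X \<in> borel_measurable P" using G unfolding gaussian_vector_def by simp
  obtain L :: "complex ^ 'n \<Rightarrow> complex ^ 'n" and \<mu> where L: "linear L" and law: "distr P borel X = distr std_gaussian borel (\<lambda>z. \<mu> + L z)"
    using G unfolding gaussian_vector_def by blast
  note [measurable] = linear_borel_measurable[OF L]
  have bl: "bounded_linear L" using L by (simp add: linear_conv_bounded_linear)
  have circ: "distr P borel (\<lambda>\<omega>. cis \<phi> *s X \<omega>) = distr P borel X" for \<phi>
    using C unfolding circularly_symmetric_def by blast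
  have cis_meas [measurable]: "(\<lambda>x::complex ^ 'n. cis \<phi> *s x) \<in> borel_measurable borel" for \<phi>
    by (intro linear_borel_measurable) (auto simp: linear_iff vec_eq_iff algebra_simps)
  have cX: "(\<lambda>\<omega>. cis \<phi> *s X \<omega>) \<in> borel_measurable P" for \<phi>
    using measurable_compose[OF X cis_meas] .
  have "integrable std_gaussian (\<lambda>z. \<mu> + L z)"
    by (intro Bochner_Integration.integrable_add integrable_bounded_linear[OF bl] std_gaussian_mean) simp
  then have "integrable (distr P borel X) (\<lambda>x. x)"
    unfolding law by (subst integrable_distr_eq) auto
  then have intX: "integrable P X" by (subst (asm) integrable_distr_eq) auto
  have "integral\<^sup>L P X = (\<integral>x. x \<partial>distr P borel X)" by (subst integral_distr) auto
  also have "\<dots> = (\<integral>z. \<mu> + L z \<partial>std_gaussian)" unfolding law by (subst integral_distr) auto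
  also have "\<dots> = \<mu> + L (\<integral>z. z \<partial>std_gaussian)"
    by (subst Bochner_Integration.integral_add)
      (auto intro!: integrable_bounded_linear[OF bl] std_gaussian_mean simp: integral_bounded_linear[OF bl] std_gaussian_mean
        std_gaussian.prob_space[simplified])
  also have "\<dots> = \<mu>" by (simp add: std_gaussian_mean linear_0[OF L])
  finally have mean: "integral\<^sup>L P X = \<mu>" .
  \<comment> \<open>Rotation by \<pi> sends X to -X without changing its law, so the mean, which is
    \<mu>, vanishes and the shift disappears from the law.\<close>
  have "integral\<^sup>L P X = (\<integral>x. x \<partial>distr P borel (\<lambda>\<omega>. cis pi *s X \<omega>))"
    unfolding circ by (subst integral_distr) auto
  also have "\<dots> = (\<integral>\<omega>. - X \<omega> \<partial>P)" by (subst integral_distr) (auto simp: vec_eq_iff intro!: Bochner_Integration.integral_cong)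
  finally have "integral\<^sup>L P X = - integral\<^sup>L P X" by simp
  then have "2 *\<^sub>R integral\<^sup>L P X = 0" by (metis add.right_inverse scaleR_2)
  then have mean0: "integral\<^sup>L P X = 0" by simp
  have law: "distr P borel X = distr std_gaussian borel L" using law mean mean0 by simp
  have int: "integrable P (\<lambda>\<omega>. (X \<omega> \<bullet> a) * (X \<omega> \<bullet> b))" for a b
  proof -
    have "integrable (distr std_gaussian borel L) (\<lambda>x. (x \<bullet> a) * (x \<bullet> b))"
      using std_gaussian_inner_covariance(1)[of "adjoint L a" "adjoint L b"]
      by (subst integrable_distr_eq) (auto simp: adjoint_works[OF L])
    then show ?thesis unfolding law[symmetric] by (subst (asm) integrable_distr_eq) auto
  qed
  have intc: "integrable P (\<lambda>\<omega>. X \<omega> $ i * cnj (X \<omega> $ j))" for i j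
  proof -
    \<comment> \<open>Integrability of the complex product reduces to products of real coordinates,
      taken along the axes 1 and i.\<close>
    have "X \<omega> $ i * cnj (X \<omega> $ j) =
       of_real ((X \<omega> \<bullet> axis i 1) * (X \<omega> \<bullet> axis j 1)) + of_real ((X \<omega> \<bullet> axis i \<i>) * (X \<omega> \<bullet> axis j \<i>))
       + \<i> * (of_real ((X \<omega> \<bullet> axis i \<i>) * (X \<omega> \<bullet> axis j 1)) - of_real ((X \<omega> \<bullet> axis i 1) * (X \<omega> \<bullet> axis j \<i>)))" for \<omega>
      by (simp add: inner_axis inner_complex_def complex_eq_iff algebra_simps)
    then show ?thesis
      by (simp only:) (intro Bochner_Integration.integrable_add Bochner_Integration.integrable_diff
        integrable_mult_right integrable_of_real int)
  qed
  have cov: "(\<integral>\<omega>. (X \<omega> \<bullet> a) * (X \<omega> \<bullet> b) \<partial>P) =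
      Re (\<Sum>i\<in>UNIV. \<Sum>j\<in>UNIV. cnj (a $ i) * b $ j * (\<integral>\<omega>. X \<omega> $ i * cnj (X \<omega> $ j) \<partial>P)) / 2" for a b
  proof -
    define A where "A \<omega> = (\<Sum>i\<in>UNIV. cnj (a $ i) * (X \<omega> $ i))" for \<omega>
    define B where "B \<omega> = (\<Sum>i\<in>UNIV. cnj (b $ i) * (X \<omega> $ i))" for \<omega>
    have "(\<integral>\<omega>. (X \<omega> \<bullet> a) * (X \<omega> \<bullet> b) \<partial>P) = (\<integral>x. (x \<bullet> a) * (x \<bullet> b) \<partial>distr P borel (\<lambda>\<omega>. cis (pi / 2) *s X \<omega>))"
      unfolding circ by (subst integral_distr) auto
    also have "\<dots> = (\<integral>\<omega>. Im (A \<omega>) * Im (B \<omega>) \<partial>P)"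
      by (subst integral_distr[OF cX], measurable) (simp only: inner_cis_pi_half A_def B_def minus_mult_minus)
    finally have rot: "(\<integral>\<omega>. Re (A \<omega>) * Re (B \<omega>) \<partial>P) = (\<integral>\<omega>. Im (A \<omega>) * Im (B \<omega>) \<partial>P)"
      by (simp add: inner_complex_vec A_def B_def)
    have int1: "integrable P (\<lambda>\<omega>. Re (A \<omega>) * Re (B \<omega>))"
      using int[of a b] by (simp add: inner_complex_vec A_def B_def)
    have "integrable (distr P borel (\<lambda>\<omega>. cis (pi / 2) *s X \<omega>)) (\<lambda>x. (x \<bullet> a) * (x \<bullet> b))"
      unfolding circ by (subst integrable_distr_eq) (auto intro: int)
    then have int2: "integrable P (\<lambda>\<omega>. Im (A \<omega>) * Im (B \<omega>))"
      by (subst (asm) integrable_distr_eq[OF cX], measurable)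
        (simp only: inner_cis_pi_half A_def B_def minus_mult_minus)
    have AB: "A \<omega> * cnj (B \<omega>) = (\<Sum>i\<in>UNIV. \<Sum>j\<in>UNIV. cnj (a $ i) * b $ j * (X \<omega> $ i * cnj (X \<omega> $ j)))" for \<omega>
      unfolding A_def B_def cnj_sum sum_product by (simp add: mult_ac)
    \<comment> \<open>The real part of A conj(B) is Re A Re B + Im A Im B, and the two summands have
      equal means by \<open>rot\<close>.\<close>
    have "(\<integral>\<omega>. (X \<omega> \<bullet> a) * (X \<omega> \<bullet> b) \<partial>P) = (\<integral>\<omega>. Re (A \<omega>) * Re (B \<omega>) + Im (A \<omega>) * Im (B \<omega>) \<partial>P) / 2"
      using int1 int2 rot by (simp add: inner_complex_vec A_def[symmetric] B_def[symmetric])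
    also have "\<dots> = (\<integral>\<omega>. Re (A \<omega> * cnj (B \<omega>)) \<partial>P) / 2" by simp
    also have "\<dots> = Re (\<integral>\<omega>. A \<omega> * cnj (B \<omega>) \<partial>P) / 2"
      by (subst integral_Re) (auto simp: AB intro!: Bochner_Integration.integrable_sum integrable_mult_right intc)
    also have "(\<integral>\<omega>. A \<omega> * cnj (B \<omega>) \<partial>P) =
       (\<Sum>i\<in>UNIV. \<Sum>j\<in>UNIV. cnj (a $ i) * b $ j * (\<integral>\<omega>. X \<omega> $ i * cnj (X \<omega> $ j) \<partial>P))"
      unfolding AB by (simp add: Bochner_Integration.integral_sum integrable_mult_right intc)
    finally show ?thesis .
  qed
  show ?thesis by (rule that[OF L law cov])
qed

section \<open>The correlated channel and its zero-forcing rows\<close>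

lemma invertible_iff_ker:
  fixes A :: "complex ^ 'n ^ 'n"
  shows "invertible A \<longleftrightarrow> (\<forall>x. A *v x = 0 \<longrightarrow> x = 0)"
  by (simp add: invertible_left_inverse matrix_left_invertible_ker)

lemma matrix_inv_mult:
  fixes A :: "complex ^ 'n ^ 'n"
  assumes "invertible A"
  shows "A ** matrix_inv A = mat 1" "matrix_inv A ** A = mat 1"
  using someI_ex[OF assms[unfolded invertible_def]] unfolding matrix_inv_def by auto

lemma adj_mult_vec_form:
  fixes A :: "complex ^ 'n::finite ^ 'm::finite"
  shows "(\<Sum>i\<in>UNIV. cnj (v $ i) * (adj A *v w) $ i) = (\<Sum>m\<in>UNIV. cnj ((A *v v) $ m) * w $ m)"
proof -
  have "(\<Sum>i\<in>UNIV. cnj (v $ i) * (adj A *v w) $ i) = (\<Sum>i\<in>UNIV. \<Sum>m\<in>UNIV. cnj (v $ i) * cnj (A $ m $ i) * w $ m)"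
    by (simp add: adj_def matrix_vector_mult_def sum_distrib_left mult_ac)
  also have "\<dots> = (\<Sum>m\<in>UNIV. \<Sum>i\<in>UNIV. cnj (v $ i) * cnj (A $ m $ i) * w $ m)"
    by (rule sum.swap)
  also have "\<dots> = (\<Sum>m\<in>UNIV. cnj ((A *v v) $ m) * w $ m)"
    by (simp add: matrix_vector_mult_def sum_distrib_left mult_ac)
  finally show ?thesis .
qed

lemma matrix_vector_mult_axis:
  fixes A :: "complex ^ 'n::finite ^ 'm::finite"
  shows "A *v axis k 1 = (\<chi> m. A $ m $ k)"
  by (simp add: vec_eq_iff matrix_vector_mult_def axis_def if_distrib[of "\<lambda>x. _ * x"] cong: if_cong)

lemma linear_matrix_vector_mult_complex:
  fixes A :: "complex ^ 'n::finite ^ 'm::finite"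
  shows "linear (\<lambda>x. A *v x)"
  by (rule linearI) (simp_all add: vec_eq_iff matrix_vector_mult_def sum.distrib ring_distribs scaleR_sum_right)

text \<open>\<open>L\<close> produces the whole channel matrix. The condition \<open>cov\<close>
  encodes uncorrelated circular rows: no cross terms between different \<open>m\<close>, a factor
  1/2 from complex to real covariance, and the entry \<open>\<Sigma> $ j $ i\<close> because
  \<Sigma> has the entries E[conj(h_i) h_j] whereas the form contains E[h_i conj(h_j)].\<close>

locale correlated_channel =
  fixes L :: "(complex ^ 'n::finite) ^ 'r::finite \<Rightarrow> complex ^ 'n ^ 'r" and \<Sigma> F :: "complex ^ 'n ^ 'n"
  assumes L: "linear L"
    and Sigma: "hermitian_pos_def \<Sigma>" and F: "invertible F"
    and cov: "\<And>a b. (\<integral>x. (x \<bullet> a) * (x \<bullet> b) \<partial>distr std_gaussian borel L) =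
      Re (\<Sum>m\<in>UNIV. \<Sum>i\<in>UNIV. \<Sum>j\<in>UNIV. cnj (a $ m $ i) * b $ m $ j * \<Sigma> $ j $ i) / 2"
begin

definition "R = adj F ** \<Sigma> ** F"

text \<open>The argument of \<open>G\<close> for symbol \<open>k\<close>. The diagonal entry is
  real, by \<open>dual_nth\<close>, so taking the real part loses nothing.\<close>

definition "\<rho> k = Re (matrix_inv R $ k $ k)"

definition "dual k = matrix_inv R *v axis k 1"

abbreviation "law \<equiv> distr std_gaussian borel L"

lemma R_mult: "R *v v = adj F *v (\<Sigma> *v (F *v v))"
  by (simp add: R_def matrix_vector_mul_assoc matrix_mul_assoc)

lemma Sigma_pos: "v \<noteq> 0 \<Longrightarrow> 0 < Re (\<Sum>i\<in>UNIV. cnj (v $ i) * (\<Sigma> *v v) $ i)"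
  using Sigma unfolding hermitian_pos_def_def by blast

lemma Sigma_real: "Im (\<Sum>i\<in>UNIV. cnj (v $ i) * (\<Sigma> *v v) $ i) = 0"
proof -
  have "(\<Sum>i\<in>UNIV. cnj (v $ i) * (\<Sigma> *v v) $ i) = (\<Sum>i\<in>UNIV. cnj (v $ i) * (adj \<Sigma> *v v) $ i)"
    using Sigma unfolding hermitian_pos_def_def by simp
  also have "\<dots> = cnj (\<Sum>i\<in>UNIV. cnj (v $ i) * (\<Sigma> *v v) $ i)"
    by (simp add: adj_mult_vec_form mult.commute)
  finally show ?thesis by (metis Reals_cnj_iff complex_is_Real_iff)
qed

lemma F_ker: "F *v v = 0 \<Longrightarrow> v = 0"
  using F by (simp add: invertible_iff_ker)

lemma R_form: "(\<Sum>i\<in>UNIV. cnj (v $ i) * (R *v v) $ i) = (\<Sum>i\<in>UNIV. cnj ((F *v v) $ i) * (\<Sigma> *v (F *v v)) $ i)"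
  unfolding R_mult by (rule adj_mult_vec_form)

lemma R_invertible: "invertible R"
  unfolding invertible_iff_ker
proof safe
  fix v assume "R *v v = 0"
  then have "(\<Sum>i\<in>UNIV. cnj ((F *v v) $ i) * (\<Sigma> *v (F *v v)) $ i) = 0"
    by (simp flip: R_form)
  then have "F *v v = 0" using Sigma_pos[of "F *v v"] by fastforce
  then show "v = 0" by (rule F_ker)
qed

lemma R_dual: "R *v dual k = axis k 1"
  unfolding dual_def using matrix_inv_mult(1)[OF R_invertible] by (simp add: matrix_vector_mul_assoc)

text \<open>\<open>R\<close> maps \<open>dual k\<close> to the k-th unit vector, so the quadratic
  form of \<open>R\<close> at \<open>dual k\<close> is the conjugate of the k-th entry of
  \<open>dual k\<close>; through \<Sigma> this form is real and positive. It is also the complex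
  variance of every entry of \<open>x ** F *v dual k\<close>.\<close>

lemma dual_nth: "dual k $ k = of_real (\<rho> k)" and rho_pos: "\<rho> k > 0"
  and dual_form: "(\<Sum>i\<in>UNIV. cnj ((F *v dual k) $ i) * (\<Sigma> *v (F *v dual k)) $ i) = of_real (\<rho> k)"
proof -
  have Re: "Re (dual k $ k) = \<rho> k"
    by (simp add: dual_def \<rho>_def matrix_vector_mult_axis)
  have q: "cnj (dual k $ k) = (\<Sum>i\<in>UNIV. cnj ((F *v dual k) $ i) * (\<Sigma> *v (F *v dual k)) $ i)"
    unfolding R_form[symmetric] R_dual
    by (simp add: axis_def if_distrib[of "\<lambda>x. _ * x"] cong: if_cong)
  have "Im (dual k $ k) = 0" using Sigma_real[of "F *v dual k"] unfolding q[symmetric] by simp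
  then show d: "dual k $ k = of_real (\<rho> k)" using Re by (simp add: complex_eq_iff)
  show "(\<Sum>i\<in>UNIV. cnj ((F *v dual k) $ i) * (\<Sigma> *v (F *v dual k)) $ i) = of_real (\<rho> k)"
    using q d by simp
  have "dual k \<noteq> 0" using R_dual[of k] by (auto simp: axis_eq_0_iff)
  then have "F *v dual k \<noteq> 0" using F_ker by blast
  from Sigma_pos[OF this] show "\<rho> k > 0" unfolding q[symmetric] d by simp
qed

text \<open>\<open>A *v dual k\<close> is, up to the factor \<open>\<rho> k\<close>, the part of the \<open>k\<close>-th column of \<open>A = x ** F\<close> that is
  uncorrelated with the other columns.\<close>

lemma resample_column:
  obtains T :: "(complex ^ 'n ^ 'r) \<times> (complex ^ 'r) \<Rightarrow> complex ^ 'n ^ 'r" where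
    "T \<in> borel_measurable (law \<Otimes>\<^sub>M std_gaussian)" "distr (law \<Otimes>\<^sub>M std_gaussian) borel T = law"
    "\<And>x y c. (T (x, y) ** F) *v c =
       (x ** F) *v (c - (c $ k / of_real (\<rho> k)) *s dual k) + (c $ k / of_real (sqrt (2 * \<rho> k))) *s y"
proof -
  define r where "r = complex_of_real (\<rho> k)"
  have r: "r \<noteq> 0" using rho_pos[of k] by (simp add: r_def)
  define g where "g = F *v dual k"
  \<comment> \<open>The regression vector of a row on its entry of \<open>U x\<close>: their
    covariance divided by the variance \<rho> k.\<close>
  define e :: "complex ^ 'n" where "e = (\<chi> i. cnj ((\<Sigma> *v g) $ i) / r)"
  define U where "U x = x *v g" for x :: "complex ^ 'n ^ 'r"
  define E where "E y = (\<chi> m. y $ m *s e)" for y :: "complex ^ 'r"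
  \<comment> \<open>Each entry of \<open>U x\<close> has complex variance \<rho> k, hence variance
    \<rho> k / 2 in every real direction.\<close>
  define \<kappa> where "\<kappa> = sqrt (\<rho> k / 2)"
  have k0: "\<kappa> > 0" "\<kappa>\<^sup>2 = \<rho> k / 2" using rho_pos[of k] by (auto simp: \<kappa>_def)
  have linU: "linear U" unfolding U_def
    by (rule linearI) (simp_all add: vec_eq_iff matrix_vector_mult_def sum.distrib ring_distribs scaleR_sum_right)
  have linE: "linear E" unfolding E_def
    by (rule linearI) (simp_all add: vec_eq_iff ring_distribs)
  have cr: "cnj r = r" by (simp add: r_def)
  have eg: "(\<Sum>j\<in>UNIV. e $ j * g $ j) = 1"
  proof -
    have "(\<Sum>j\<in>UNIV. e $ j * g $ j) = cnj (\<Sum>j\<in>UNIV. cnj (g $ j) * (\<Sigma> *v g) $ j) / r"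
      by (simp add: e_def sum_divide_distrib mult.commute)
    also have "\<dots> = 1" unfolding dual_form[of k, folded g_def] using r by (simp add: r_def)
    finally show ?thesis .
  qed
  have UE: "U (E y) = y" for y
    using eg by (simp add: U_def E_def vec_eq_iff matrix_vector_mult_def mult.assoc flip: sum_distrib_left)
  have covUE: "(\<integral>x. (x \<bullet> a) * (U x \<bullet> y) \<partial>law) = \<kappa>\<^sup>2 * (E y \<bullet> a)" for a y
  proof -
    define b :: "complex ^ 'n ^ 'r" where "b = (\<chi> m j. cnj (g $ j) * y $ m)"
    have Ub: "U x \<bullet> y = x \<bullet> b" for x
    proof -
      have "U x $ m \<bullet> y $ m = x $ m \<bullet> b $ m" for m
      proof -
        have z: "z \<bullet> w = Re (cnj w * z)" for z w :: complex
          by (simp add: inner_complex_def algebra_simps)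
        have "cnj (y $ m) * U x $ m = (\<Sum>j\<in>UNIV. cnj (b $ m $ j) * x $ m $ j)"
          by (simp add: U_def b_def matrix_vector_mult_def sum_distrib_left mult_ac)
        then show ?thesis unfolding z inner_complex_vec by simp
      qed
      then show ?thesis unfolding inner_vec_def[of "U x" y] inner_vec_def[of x b] by simp
    qed
    have "(\<Sum>j\<in>UNIV. cnj (g $ j) * \<Sigma> $ j $ i) = r * e $ i" for i
    proof -
      have "\<Sigma> $ j $ i = cnj (\<Sigma> $ i $ j)" for j
      proof -
        have "adj \<Sigma> = \<Sigma>" using Sigma unfolding hermitian_pos_def_def by blast
        then have "adj \<Sigma> $ j $ i = \<Sigma> $ j $ i" by simp
        then show ?thesis by (simp add: adj_def)
      qed
      then show ?thesis using r by (simp add: e_def matrix_vector_mult_def mult.commute)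
    qed
    then have *: "(\<Sum>j\<in>UNIV. cnj (a $ m $ i) * b $ m $ j * \<Sigma> $ j $ i) = r * (cnj (a $ m $ i) * (y $ m * e $ i))" for m i
    proof -
      have "(\<Sum>j\<in>UNIV. cnj (a $ m $ i) * b $ m $ j * \<Sigma> $ j $ i) = cnj (a $ m $ i) * y $ m * (\<Sum>j\<in>UNIV. cnj (g $ j) * \<Sigma> $ j $ i)"
        by (simp add: b_def sum_distrib_left mult_ac)
      then show ?thesis by (simp add: \<open>\<And>i. (\<Sum>j\<in>UNIV. cnj (g $ j) * \<Sigma> $ j $ i) = r * e $ i\<close>)
    qed
    have "(\<integral>x. (x \<bullet> a) * (U x \<bullet> y) \<partial>law) = Re (r * (\<Sum>m\<in>UNIV. \<Sum>i\<in>UNIV. cnj (a $ m $ i) * (y $ m * e $ i))) / 2"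
      unfolding Ub cov * by (simp only: sum_distrib_left)
    also have "\<dots> = \<kappa>\<^sup>2 * Re (\<Sum>m\<in>UNIV. \<Sum>i\<in>UNIV. cnj (a $ m $ i) * (y $ m * e $ i))"
      by (simp add: r_def k0)
    also have "Re (\<Sum>m\<in>UNIV. \<Sum>i\<in>UNIV. cnj (a $ m $ i) * (y $ m * e $ i)) = E y \<bullet> a"
      unfolding inner_vec_def[of "E y"]
      by (simp only: inner_complex_vec E_def vec_lambda_beta vector_smult_component Re_sum)
    finally show ?thesis .
  qed
  define T where "T = (\<lambda>(x, y). x + E (\<kappa> *\<^sub>R y - U x))"
  have Tlaw: "distr (law \<Otimes>\<^sub>M std_gaussian) borel T = law"
    unfolding T_def by (rule gaussian_resample[OF L linU linE k0(1) UE covUE])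
  note [measurable] = linear_borel_measurable[OF linU] linear_borel_measurable[OF linE]
  have Tm: "T \<in> borel_measurable (law \<Otimes>\<^sub>M std_gaussian)"
    unfolding T_def by measurable
  \<comment> \<open>The vector \<open>adj F *v (\<Sigma> *v g)\<close> is
    \<open>R *v dual k\<close>, a unit vector. Therefore the correction \<open>E\<close> changes no
    column of \<open>x ** F\<close> but the k-th.\<close>
  have eF: "(\<Sum>i\<in>UNIV. e $ i * F $ i $ j) = (if j = k then 1 / r else 0)" for j
  proof -
    have "(\<Sum>i\<in>UNIV. e $ i * F $ i $ j) = cnj ((adj F *v (\<Sigma> *v g)) $ j) / r"
      unfolding matrix_vector_mult_def[of "adj F"]
      by (simp add: e_def adj_def sum_divide_distrib mult.commute)
    also have "adj F *v (\<Sigma> *v g) = axis k 1"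
      unfolding g_def R_mult[symmetric] by (rule R_dual)
    finally show ?thesis by (simp add: axis_def)
  qed
  have EFc: "(E y ** F) *v c = (c $ k / r) *s y" for y c
  proof -
    have "(E y ** F) $ m $ j = y $ m * (if j = k then 1 / r else 0)" for m j
      unfolding eF[symmetric] by (simp add: matrix_matrix_mult_def E_def sum_distrib_left mult.assoc)
    then show ?thesis
      by (simp add: vec_eq_iff matrix_vector_mult_def if_distrib[of "\<lambda>x. _ * x"] if_distrib[of "\<lambda>x. x * _"] cong: if_cong)
  qed
  have "(T (x, y) ** F) *v c = (x ** F) *v (c - (c $ k / r) *s dual k) + (c $ k / of_real (sqrt (2 * \<rho> k))) *s y" for x y c
  proof -
    have "(T (x, y) ** F) *v c = (x ** F) *v c + (E (\<kappa> *\<^sub>R y - U x) ** F) *v c"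
      by (simp add: T_def vec_eq_iff matrix_vector_mult_def matrix_matrix_mult_def ring_distribs sum.distrib)
    also have "\<dots> = (x ** F) *v c + (c $ k / r) *s (\<kappa> *\<^sub>R y - U x)"
      by (simp only: EFc)
    also have "U x = (x ** F) *v dual k"
      by (simp add: U_def g_def matrix_vector_mul_assoc)
    also have "(c $ k / r) *s (\<kappa> *\<^sub>R y - (x ** F) *v dual k) =
        (c $ k / of_real (sqrt (2 * \<rho> k))) *s y - (x ** F) *v ((c $ k / r) *s dual k)"
    proof -
      \<comment> \<open>The fresh vector enters scaled by \<kappa>, and \<open>E\<close> puts it
        into column \<open>k\<close> with weight 1 / \<rho> k; the product is the constant of the
        statement.\<close>
      have "\<kappa> / \<rho> k = 1 / sqrt (2 * \<rho> k)"
        using rho_pos[of k] by (simp add: \<kappa>_def real_sqrt_divide real_sqrt_mult field_simps)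
      then have "of_real \<kappa> / r = 1 / complex_of_real (sqrt (2 * \<rho> k))"
        unfolding r_def by (metis of_real_1 of_real_divide)
      then have "c $ k / r * (\<kappa> *\<^sub>R z) = c $ k / of_real (sqrt (2 * \<rho> k)) * z" for z
        by (simp add: scaleR_conv_of_real) (metis (no_types, lifting) divide_inverse mult.assoc mult.commute mult.left_neutral)
      then show ?thesis
        by (simp add: vec_eq_iff vec.scale right_diff_distrib)
    qed
    finally show ?thesis by (simp add: matrix_vector_mult_diff_distrib)
  qed
  then show ?thesis using that[OF Tm Tlaw] by (simp add: r_def)
qed

end

section \<open>Column spaces and measurability of the pseudo-inverse\<close>

lemma dim_coordinate_hyperplane:
  "dim {c :: complex ^ 'n::finite. c $ k = 0} + 2 = 2 * CARD('n)"
proof -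
  let ?A = "{axis k 1, axis k \<i> :: complex ^ 'n}"
  \<comment> \<open>Dimensions are real: the hyperplane is the orthogonal complement of the two real
    directions of coordinate \<open>k\<close>.\<close>
  have eq: "{y \<in> UNIV. \<forall>x \<in> span ?A. orthogonal x y} = {c :: complex ^ 'n. c $ k = 0}"
  proof (safe)
    fix y :: "complex ^ 'n" assume "\<forall>x\<in>span ?A. orthogonal x y"
    then have "orthogonal (axis k 1) y" "orthogonal (axis k \<i>) y"
      using span_base[of _ ?A] by auto
    then show "y $ k = 0" by (simp add: orthogonal_def inner_axis' inner_complex_def complex_eq_iff)
  next
    fix y x :: "complex ^ 'n" assume y: "y $ k = 0" and x: "x \<in> span ?A"
    have "orthogonal y x"
      using x by (rule orthogonal_to_span) (use y in \<open>auto simp: orthogonal_def inner_axis\<close>)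
    then show "orthogonal x y" by (simp add: orthogonal_commute)
  qed auto
  have "pairwise orthogonal ?A" by (auto simp: pairwise_insert orthogonal_def inner_axis inner_axis' axis_eq_axis inner_complex_def)
  then have "independent ?A"
    by (rule pairwise_orthogonal_independent) (auto simp: axis_eq_0_iff)
  moreover have "card ?A = 2" by (simp add: axis_eq_axis complex_eq_iff)
  ultimately have "dim (span ?A) = 2" by (simp add: dim_eq_card_independent)
  then show ?thesis
    using dim_subspace_orthogonal_to_vectors[of "span ?A" UNIV] unfolding eq by (simp add: mult.commute)
qed

lemma negligible_null_sets_std_gaussian:
  fixes S :: "'v::euclidean_space set"
  assumes S: "negligible S" "S \<in> sets borel"
  shows "S \<in> null_sets std_gaussian"
proof -
  have "S \<in> null_sets lborel"
    using S null_sets_completion_iff[of S lborel] by (simp add: negligible_iff_null_sets)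
  then have "AE x in lborel. x \<notin> S" by (rule AE_not_in)
  then have "AE x in lborel. ennreal (\<Prod>b\<in>Basis. std_normal_density (x \<bullet> b)) * indicator S x = 0"
    by eventually_elim simp
  then have "emeasure std_gaussian S = 0"
    unfolding std_gaussian_def using S(2)
    by (subst emeasure_density) (auto simp: nn_integral_0_iff_AE)
  then show ?thesis using S(2) by (auto simp: null_sets_def)
qed

lemma continuous_on_matrix_vector_mult [continuous_intros]:
  fixes A :: "'a::topological_space \<Rightarrow> complex ^ 'n::finite ^ 'm::finite"
  assumes "continuous_on S A" "continuous_on S v"
  shows "continuous_on S (\<lambda>x. A x *v v x)"
  unfolding matrix_vector_mult_def by (intro continuous_intros assms)

lemma borel_measurable_matrix_matrix_mult:
  fixes F :: "complex ^ 'n::finite ^ 'p::finite"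
  shows "(\<lambda>x::complex ^ 'p ^ 'm::finite. x ** F) \<in> borel_measurable borel"
  unfolding matrix_matrix_mult_def by (intro borel_measurable_continuous_onI continuous_intros)

text \<open>The quantifier over \<open>c\<close> is uncountable. Restricted to a ball it gives a
  closed set, being the projection of a closed set along a compact factor, and countably many balls
  exhaust all \<open>c\<close>.\<close>

lemma sets_borel_column_dependent:
  "{A :: complex ^ 'n::finite ^ 'm::finite. \<exists>c. c $ k = 1 \<and> A *v c = 0} \<in> sets borel"
proof -
  have "closed {A :: complex ^ 'n ^ 'm. \<exists>c. c \<in> cball 0 (real n) \<inter> {c. c $ k = 1} \<and> (c, A) \<in> {p. snd p *v fst p = 0}}" for n
    by (intro closed_compact_projection compact_Int_closed compact_cball closed_Collect_eq continuous_intros)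
  then have "(\<Union>n. {A :: complex ^ 'n ^ 'm. \<exists>c. c \<in> cball 0 (real n) \<inter> {c. c $ k = 1} \<and> (c, A) \<in> {p. snd p *v fst p = 0}}) \<in> sets borel"
    by (intro sets.countable_UN) auto
  also have "(\<Union>n. {A :: complex ^ 'n ^ 'm. \<exists>c. c \<in> cball 0 (real n) \<inter> {c. c $ k = 1} \<and> (c, A) \<in> {p. snd p *v fst p = 0}})
     = {A. \<exists>c. c $ k = 1 \<and> A *v c = 0}"
    by (auto) (metis real_arch_simple)
  finally show ?thesis .
qed

definition injective_matrix :: "complex ^ 'n ^ 'm \<Rightarrow> bool" where
  "injective_matrix A \<longleftrightarrow> (\<forall>c. A *v c = 0 \<longrightarrow> c = 0)"

lemma injective_matrix_iff:
  "injective_matrix A \<longleftrightarrow> (\<forall>k. A \<notin> {A. \<exists>c. c $ k = 1 \<and> A *v c = 0})"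
proof (rule iffI; clarsimp simp: injective_matrix_def)
  fix c assume *: "\<forall>k c. c $ k = 1 \<longrightarrow> A *v c \<noteq> 0" and c: "A *v c = 0"
  show "c = 0"
  proof (rule ccontr)
    assume "c \<noteq> 0"
    then obtain k where k: "c $ k \<noteq> 0" by (auto simp: vec_eq_iff)
    have "A *v ((1 / c $ k) *s c) = 0" using c by (simp add: vec.scale)
    moreover have "((1 / c $ k) *s c) $ k = 1" using k by simp
    ultimately show False using * by blast
  qed
qed (auto)

text \<open>The complex span of all columns but the k-th. As the image of a hyperplane it has a
  dimension bound for every matrix and the exact dimension for an injective one.\<close>

definition other_columns :: "'n \<Rightarrow> complex ^ 'n ^ 'm \<Rightarrow> (complex ^ 'm) set" where
  "other_columns k A = (\<lambda>c. A *v c) ` {c. c $ k = 0}"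

lemma subspace_other_columns: "subspace (other_columns k (A :: complex ^ 'n::finite ^ 'm::finite))"
  unfolding other_columns_def
  by (intro linear_subspace_image linear_matrix_vector_mult_complex) (auto simp: subspace_def)

lemma dim_other_columns_le: "dim (other_columns k (A :: complex ^ 'n::finite ^ 'm::finite)) + 2 \<le> 2 * CARD('n)"
  unfolding other_columns_def
  using dim_image_le[OF linear_matrix_vector_mult_complex[of A], of "{c. c $ k = 0}"]
    dim_coordinate_hyperplane[of k] by linarith

lemma dim_other_columns:
  assumes "injective_matrix (A :: complex ^ 'n::finite ^ 'm::finite)"
  shows "dim (other_columns k A) + 2 = 2 * CARD('n)"
proof -
  have "inj (\<lambda>c. A *v c)"
    using assms linear_injective_0[OF linear_matrix_vector_mult_complex[of A]] by (simp add: injective_matrix_def)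
  then show ?thesis
    unfolding other_columns_def using dim_coordinate_hyperplane[of k]
    by (subst dim_image_eq[OF linear_matrix_vector_mult_complex]) (auto intro: inj_on_subset)
qed

lemma borel_measurable_det: "(det :: complex ^ 'n::finite ^ 'n \<Rightarrow> complex) \<in> borel_measurable borel"
  unfolding det_def by (intro borel_measurable_continuous_onI continuous_intros)

text \<open>\<open>matrix_inv\<close> is defined by choice. On invertible matrices Cramer's rule
  turns its entries into quotients of determinants, and on singular ones it is constant.\<close>

lemma borel_measurable_matrix_inv:
  "(matrix_inv :: complex ^ 'n::finite ^ 'n \<Rightarrow> complex ^ 'n ^ 'n) \<in> borel_measurable borel"
proof -
  \<comment> \<open>A singular matrix leaves the choice without any candidate, so all singular
    matrices share this value.\<close>
  let ?C = "SOME A' :: complex ^ 'n ^ 'n. False"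
  let ?D = "\<lambda>A i j. (\<chi> a b. if b = i then axis j 1 $ a else A $ a $ b) :: complex ^ 'n ^ 'n"
  have eq: "matrix_inv A = (if det A \<noteq> 0 then (\<chi> i j. det (?D A i j) / det A) else ?C)" for A :: "complex ^ 'n ^ 'n"
  proof (cases "det A = 0")
    case True
    then have "\<not> (A ** A' = mat 1 \<and> A' ** A = mat 1)" for A'
      using invertible_det_nz[of A] unfolding invertible_def by blast
    then have no: "(\<lambda>A'. A ** A' = mat 1 \<and> A' ** A = mat 1) = (\<lambda>_. False)" by blast
    show ?thesis using True unfolding matrix_inv_def no by simp
  next
    case False
    then have inv: "invertible A" by (simp add: invertible_det_nz)
    have "A *v (matrix_inv A *v axis j 1) = axis j 1" for j
      using matrix_inv_mult(1)[OF inv] by (simp add: matrix_vector_mul_assoc)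
    then have "matrix_inv A *v axis j 1 = (\<chi> k. det (\<chi> a b. if b = k then axis j 1 $ a else A $ a $ b) / det A)" for j
      using cramer[OF False] by blast
    then have "matrix_inv A $ i $ j = det (?D A i j) / det A" for i j
      by (metis (no_types, lifting) matrix_vector_mult_axis vec_lambda_beta)
    then show ?thesis using False by (simp add: vec_eq_iff)
  qed
  have cD: "continuous_on UNIV (\<lambda>A::complex ^ 'n ^ 'n. ?D A i j)" for i j
  proof -
    have "continuous_on UNIV (\<lambda>A::complex ^ 'n ^ 'n. if b = i then axis j 1 $ a else A $ a $ b)" for a b
      by (cases "b = i") (auto intro!: continuous_intros)
    then show ?thesis by (intro continuous_on_vec_lambda)
  qed
  have "(\<lambda>A::complex ^ 'n ^ 'n. det (?D A i j) / det A) \<in> borel_measurable borel" for i j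
    by (intro borel_measurable_divide borel_measurable_det
      measurable_compose[OF borel_measurable_continuous_onI[OF cD] borel_measurable_det])
  then have "(\<lambda>A::complex ^ 'n ^ 'n. (\<chi> i j. det (?D A i j) / det A)) \<in> borel_measurable borel"
    by (subst borel_measurable_euclidean_space) (auto simp: Basis_vec_def inner_axis)
  moreover have "Measurable.pred borel (\<lambda>A::complex ^ 'n ^ 'n. det A \<noteq> 0)"
    using borel_measurable_det by measurable
  ultimately have "(\<lambda>A. if det A \<noteq> 0 then (\<chi> i j. det (?D A i j) / det A) else ?C) \<in> borel_measurable borel"
    by (intro measurable_If) auto
  then show ?thesis unfolding eq[symmetric, abs_def] by (simp add: eq[abs_def])
qed

lemma borel_measurable_pseudo_inv_nth:
  "(\<lambda>A::complex ^ 'n::finite ^ 'm::finite. pseudo_inv A $ k) \<in> borel_measurable borel"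
proof -
  have a: "(\<lambda>A::complex ^ 'n ^ 'm. adj A) \<in> borel_measurable borel"
    unfolding adj_def by (intro borel_measurable_continuous_onI continuous_intros)
  have "(\<lambda>A::complex ^ 'n ^ 'm. adj A ** A) \<in> borel_measurable borel"
    unfolding adj_def matrix_matrix_mult_def by (intro borel_measurable_continuous_onI continuous_intros)
  from measurable_compose[OF this borel_measurable_matrix_inv]
  have i: "(\<lambda>A::complex ^ 'n ^ 'm. matrix_inv (adj A ** A)) \<in> borel_measurable borel" .
  have "continuous_on UNIV (\<lambda>p::(complex ^ 'n ^ 'n) \<times> (complex ^ 'm ^ 'n). fst p ** snd p)"
    unfolding matrix_matrix_mult_def by (intro continuous_intros)
  from measurable_compose[OF borel_measurable_Pair[OF i a] borel_measurable_continuous_onI[OF this]]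
  have "(\<lambda>A::complex ^ 'n ^ 'm. pseudo_inv A) \<in> borel_measurable borel"
    unfolding pseudo_inv_def by simp
  from measurable_compose[OF this borel_measurable_vec_nth[of k]] show ?thesis .
qed

text \<open>The form of the Gram matrix \<open>adj A ** A\<close> at \<open>v\<close> is the squared
  norm of \<open>A *v v\<close>, so injectivity of \<open>A\<close> makes the Gram matrix
  invertible.\<close>

lemma pseudo_inv_left:
  fixes A :: "complex ^ 'n::finite ^ 'm::finite"
  assumes "injective_matrix A"
  shows "pseudo_inv A *v (A *v c) = c"
proof -
  have "invertible (adj A ** A)"
    unfolding invertible_iff_ker
  proof safe
    fix v assume "(adj A ** A) *v v = 0"
    then have "(\<Sum>i\<in>UNIV. cnj (v $ i) * (adj A *v (A *v v)) $ i) = 0"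
      by (simp add: matrix_vector_mul_assoc)
    then have "(\<Sum>m\<in>UNIV. cnj ((A *v v) $ m) * (A *v v) $ m) = 0"
      by (simp only: adj_mult_vec_form)
    then have "(A *v v) \<bullet> (A *v v) = 0" by (simp only: inner_complex_vec zero_complex.sel)
    then show "v = 0" using assms by (simp add: injective_matrix_def)
  qed
  from matrix_inv_mult(2)[OF this] show ?thesis
    by (simp add: pseudo_inv_def matrix_vector_mul_assoc flip: matrix_mul_assoc)
qed

lemma sum_inner_orthonormal:
  fixes B :: "'v::euclidean_space set"
  assumes "pairwise orthogonal B" "\<And>b. b \<in> B \<Longrightarrow> norm b = 1" "finite B" "x \<in> span B"
  shows "(\<Sum>b\<in>B. (x \<bullet> b)\<^sup>2) = (norm x)\<^sup>2"
proof -
  have "(\<Sum>b\<in>B. (x \<bullet> b) *\<^sub>R b) \<bullet> x = (\<Sum>b\<in>B. (x \<bullet> b)\<^sup>2)"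
    unfolding inner_sum_left inner_scaleR_left by (simp add: power2_eq_square inner_commute)
  moreover have "(\<Sum>b\<in>B. (x \<bullet> b) *\<^sub>R b) = x"
    by (rule orthonormal_basis_expand) (use assms in auto)
  ultimately show ?thesis by (simp add: power2_norm_eq_inner)
qed

text \<open>The conjugate of row \<open>w\<close> lies in the column space of \<open>A\<close>, is
  orthogonal to all columns but the k-th, and has inner product 1 with that one. It is therefore the
  component of column \<open>k\<close> orthogonal to the other columns, divided by its squared
  length, so that component has squared length 1 / |w|^2. The sum over \<open>B\<close> is this
  squared length.\<close>

lemma pseudo_inv_row_norm:
  fixes A :: "complex ^ 'n::finite ^ 'm::finite"
  assumes A: "injective_matrix A"
    and B: "pairwise orthogonal B" "\<And>b. b \<in> B \<Longrightarrow> norm b = 1" "finite B"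
      "span B = {y. \<forall>x \<in> other_columns k A. orthogonal x y}"
  shows "pseudo_inv A $ k \<noteq> 0"
    and "(\<Sum>b\<in>B. ((A *v axis k 1) \<bullet> b)\<^sup>2) = 1 / (norm (pseudo_inv A $ k))\<^sup>2"
proof -
  define w where "w = pseudo_inv A $ k"
  have row: "(pseudo_inv A *v z) $ k = (\<Sum>m\<in>UNIV. w $ m * z $ m)" for z
    by (simp add: w_def matrix_vector_mult_def)
  define cw :: "complex ^ 'm" where "cw = (\<chi> m. cnj (w $ m))"
  define d :: "complex ^ 'n" where "d = (\<chi> j. cnj (matrix_inv (adj A ** A) $ k $ j))"
  have cw_d: "cw = A *v d"
    by (simp add: cw_def d_def w_def vec_eq_iff pseudo_inv_def matrix_matrix_mult_def[of "matrix_inv _"]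
      matrix_vector_mult_def adj_def mult.commute)
  have inner_cw: "z \<bullet> cw = Re ((pseudo_inv A *v z) $ k)" for z
    unfolding row inner_complex_vec by (simp add: cw_def)
  have norm_cw: "norm cw = norm w" by (simp add: norm_vec_def cw_def)
  have col: "(pseudo_inv A *v (A *v axis k 1)) $ k = 1" by (simp add: pseudo_inv_left[OF A])
  show w0: "pseudo_inv A $ k \<noteq> 0"
  proof
    assume "pseudo_inv A $ k = 0"
    then have "w = 0" by (simp add: w_def)
    then show False using col unfolding row by simp
  qed
  have dk: "d $ k = of_real ((norm w)\<^sup>2)"
  proof -
    have "d $ k = (pseudo_inv A *v cw) $ k" unfolding cw_d pseudo_inv_left[OF A] ..
    also have "\<dots> = of_real ((norm w)\<^sup>2)"
      unfolding row by (simp add: cw_def complex_norm_square[symmetric] norm_vec_def L2_set_def sum_nonneg)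
    finally show ?thesis .
  qed
  have n0: "norm w > 0" using w0 by (simp add: w_def)
  have cw_B: "cw \<in> span B"
    unfolding B(4) other_columns_def by (auto simp: orthogonal_def inner_cw pseudo_inv_left[OF A])
  have "(A *v axis k 1) \<bullet> b = (cw \<bullet> b) / (norm w)\<^sup>2" if b: "b \<in> B" for b
  proof -
    \<comment> \<open>By \<open>dk\<close> the k-th entry of \<open>?c\<close> is 0, so column
      \<open>k\<close> differs from \<open>cw\<close> / |w|^2 only by an element of the span of the
      other columns, which \<open>b\<close> does not see.\<close>
    let ?c = "axis k 1 - (1 / (norm w)\<^sup>2) *\<^sub>R d"
    have "((1 / (norm w)\<^sup>2) *\<^sub>R d) $ k = (1 / (norm w)\<^sup>2) *\<^sub>R (d $ k)"
      by (rule vector_scaleR_component)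
    also have "\<dots> = 1"
      unfolding dk scaleR_conv_of_real of_real_mult[symmetric] using n0 by simp
    finally have "((1 / (norm w)\<^sup>2) *\<^sub>R d) $ k = 1" .
    then have "?c $ k = 0" by (simp del: vector_scaleR_component)
    then have "A *v ?c \<in> other_columns k A" unfolding other_columns_def by blast
    moreover have "b \<in> span B" using b by (rule span_base)
    ultimately have "(A *v ?c) \<bullet> b = 0" unfolding B(4) by (auto simp: orthogonal_def)
    then show ?thesis
      by (simp add: linear_diff[OF linear_matrix_vector_mult_complex] linear_cmul[OF linear_matrix_vector_mult_complex]
        inner_diff_left cw_d)
  qed
  then have "(\<Sum>b\<in>B. ((A *v axis k 1) \<bullet> b)\<^sup>2) = (\<Sum>b\<in>B. (cw \<bullet> b)\<^sup>2) / (norm w)^4"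
    by (simp add: power_divide sum_divide_distrib flip: power_mult)
  also have "(\<Sum>b\<in>B. (cw \<bullet> b)\<^sup>2) = (norm w)\<^sup>2"
    by (simp add: sum_inner_orthonormal[OF B(1-3) cw_B] norm_cw)
  also have "(norm w)\<^sup>2 / (norm w)^4 = 1 / (norm w)\<^sup>2"
    using n0 by (simp add: field_simps eval_nat_numeral)
  finally show "(\<Sum>b\<in>B. ((A *v axis k 1) \<bullet> b)\<^sup>2) = 1 / (norm (pseudo_inv A $ k))\<^sup>2"
    by (simp add: w_def)
qed

section \<open>Almost sure full rank and the Laplace transform of the zero-forcing gain\<close>

context correlated_channel
begin

lemma prob_space_law: "prob_space law"
  using linear_borel_measurable[OF L] by (intro std_gaussian.prob_space_distr) simp

text \<open>After resampling column \<open>k\<close>, the fresh vectors that make it depend on the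
  other columns lie, for fixed \<open>x\<close>, in a subspace of real dimension at most 2 Nt - 2,
  which is less than 2 Nr and so null. Only the upper bound on the dimension is available here, as
  injectivity is what is being shown.\<close>

lemma AE_injective:
  assumes card: "CARD('n) \<le> CARD('r)"
  shows "AE x in law. injective_matrix (x ** F)"
proof -
  have "AE x in law. x ** F \<notin> {A. \<exists>c. c $ k = 1 \<and> A *v c = 0}" for k
  proof -
    interpret law: prob_space law by (rule prob_space_law)
    define N where "N = {x :: complex ^ 'n ^ 'r. x ** F \<in> {A. \<exists>c. c $ k = 1 \<and> A *v c = 0}}"
    have N [measurable]: "N \<in> sets borel"
      using measurable_sets[OF borel_measurable_matrix_matrix_mult[of F] sets_borel_column_dependent[of k]]
      by (simp add: N_def vimage_def)
    obtain T :: "(complex ^ 'n ^ 'r) \<times> (complex ^ 'r) \<Rightarrow> complex ^ 'n ^ 'r" where T [measurable]: "T \<in> borel_measurable (law \<Otimes>\<^sub>M std_gaussian)"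
      and T_law: "distr (law \<Otimes>\<^sub>M std_gaussian) borel T = law"
      and T_col: "\<And>x y c. (T (x, y) ** F) *v c =
       (x ** F) *v (c - (c $ k / of_real (\<rho> k)) *s dual k) + (c $ k / of_real (sqrt (2 * \<rho> k))) *s y"
      by (rule resample_column[of k]) (rule that)
    have s: "complex_of_real (sqrt (2 * \<rho> k)) \<noteq> 0" using rho_pos[of k] by simp
    \<comment> \<open>Normalising the dependence by c_k = 1 allows solving it for the fresh vector
      \<open>y\<close>.\<close>
    have sec: "Pair x -` (T -` N \<inter> space (law \<Otimes>\<^sub>M std_gaussian)) \<subseteq> other_columns k (x ** F)" for x
    proof safe
      fix y assume "T (x, y) \<in> N"
      then obtain c where c: "c $ k = 1" and 0: "(T (x, y) ** F) *v c = 0" by (auto simp: N_def)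
      let ?s = "complex_of_real (sqrt (2 * \<rho> k))"
      let ?d = "c - (1 / of_real (\<rho> k)) *s dual k"
      have "(x ** F) *v ?d + (1 / ?s) *s y = 0" using 0 unfolding T_col c .
      then have y: "(1 / ?s) *s y = - ((x ** F) *v ?d)" by (simp add: eq_neg_iff_add_eq_0 add.commute)
      have "y = ?s *s ((1 / ?s) *s y)" using s by (simp add: vec_eq_iff)
      also have "\<dots> = (- ?s) *s ((x ** F) *v ?d)" unfolding y by (simp only: vec_eq_iff vector_smult_component vector_uminus_component) simp
      also have "\<dots> = (x ** F) *v (- ?s *s ?d)" by (rule vec.scale[symmetric])
      finally have "y = (x ** F) *v (- ?s *s ?d)" .
      moreover have "(- ?s *s ?d) $ k = 0" using c rho_pos[of k] by (simp add: dual_nth)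
      ultimately show "y \<in> other_columns k (x ** F)" unfolding other_columns_def by blast
    qed
    have null: "other_columns k A \<in> null_sets std_gaussian" for A :: "complex ^ 'n ^ 'r"
    proof (rule negligible_null_sets_std_gaussian)
      show "negligible (other_columns k A)"
        using dim_other_columns_le[of k A] card by (intro negligible_lowdim) simp
      show "other_columns k A \<in> sets borel"
        by (intro borel_closed closed_subspace subspace_other_columns)
    qed
    have "emeasure law N = emeasure (law \<Otimes>\<^sub>M std_gaussian) (T -` N \<inter> space (law \<Otimes>\<^sub>M std_gaussian))"
      by (subst T_law[symmetric], subst emeasure_distr) auto
    also have "\<dots> = (\<integral>\<^sup>+x. emeasure std_gaussian (Pair x -` (T -` N \<inter> space (law \<Otimes>\<^sub>M std_gaussian))) \<partial>law)"
      by (rule std_gaussian.emeasure_pair_measure_alt) measurable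
    also have "\<dots> = (\<integral>\<^sup>+x. 0 \<partial>law)"
      using emeasure_mono[OF sec] null by (intro nn_integral_cong) (metis le_zero_eq null_setsD1 null_setsD2)
    finally have "N \<in> null_sets law" by (auto simp: null_sets_def)
    then have "AE x in law. x \<notin> N" by (rule AE_not_in)
    then show ?thesis by (simp add: N_def)
  qed
  then have "AE x in law. \<forall>k\<in>UNIV. x ** F \<notin> {A. \<exists>c. c $ k = 1 \<and> A *v c = 0}"
    by (intro AE_finite_allI finite_class.finite_UNIV)
  then show ?thesis unfolding injective_matrix_iff by (simp only: ball_UNIV)
qed

text \<open>For fixed \<open>x\<close>, resampling leaves the span V of the other columns in place,
  while column \<open>k\<close> becomes y / sqrt(2 \<rho> k) plus an element of V. So 1 / |w|^2 is
  the squared norm of the projection of y to the complement of V, divided by 2 \<rho> k. The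
  transform depends on \<open>x\<close> only through the dimension of that complement, which is
  almost surely the same, so the outer integral is that of a constant.\<close>

lemma nn_integral_exp_pseudo_inv:
  assumes card: "CARD('n) \<le> CARD('r)" and c: "c \<ge> 0"
  shows "(\<integral>\<^sup>+x. ennreal (exp (- c / (norm (pseudo_inv (x ** F) $ k))\<^sup>2)) \<partial>law) =
    ennreal ((1 / (1 + c / \<rho> k)) ^ (CARD('r) - CARD('n) + 1))"
proof -
  interpret law: prob_space law by (rule prob_space_law)
  obtain T :: "(complex ^ 'n ^ 'r) \<times> (complex ^ 'r) \<Rightarrow> complex ^ 'n ^ 'r" where T [measurable]: "T \<in> borel_measurable (law \<Otimes>\<^sub>M std_gaussian)"
    and T_law: "distr (law \<Otimes>\<^sub>M std_gaussian) borel T = law"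
    and T_col: "\<And>x y c. (T (x, y) ** F) *v c =
     (x ** F) *v (c - (c $ k / of_real (\<rho> k)) *s dual k) + (c $ k / of_real (sqrt (2 * \<rho> k))) *s y"
    by (rule resample_column[of k]) (rule that)
  note [measurable] = measurable_compose[OF borel_measurable_matrix_matrix_mult[of F] borel_measurable_pseudo_inv_nth[of k]]
  interpret pair: pair_sigma_finite law "std_gaussian :: (complex ^ 'r) measure" ..
  let ?f = "\<lambda>x. ennreal (exp (- c / (norm (pseudo_inv (x ** F) $ k))\<^sup>2))"
  let ?N = "CARD('r) - CARD('n) + 1"
  note inj = AE_injective[OF card]
  then have "AE x in distr (law \<Otimes>\<^sub>M std_gaussian) borel T. injective_matrix (x ** F)"
    unfolding T_law .
  then have "AE p in law \<Otimes>\<^sub>M std_gaussian. injective_matrix (T p ** F)"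
    by (rule AE_distrD[OF T])
  then have inj2: "AE x in law. AE y in std_gaussian. injective_matrix (T (x, y) ** F)"
    by (rule pair.AE_pair)
  have "(\<integral>\<^sup>+x. ?f x \<partial>law) = (\<integral>\<^sup>+p. ?f (T p) \<partial>(law \<Otimes>\<^sub>M std_gaussian))"
    by (subst T_law[symmetric], subst nn_integral_distr) auto
  also have "\<dots> = (\<integral>\<^sup>+x. \<integral>\<^sup>+y. ?f (T (x, y)) \<partial>std_gaussian \<partial>law)"
    by (subst std_gaussian.nn_integral_fst[symmetric]) auto
  also have "\<dots> = (\<integral>\<^sup>+x. ennreal ((1 / (1 + c / \<rho> k)) ^ ?N) \<partial>law)"
  proof (rule nn_integral_cong_AE)
    show "AE x in law. (\<integral>\<^sup>+y. ?f (T (x, y)) \<partial>std_gaussian) = ennreal ((1 / (1 + c / \<rho> k)) ^ ?N)"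
      using inj inj2
    proof eventually_elim
      fix x assume x: "injective_matrix (x ** F)" and y: "AE y in std_gaussian. injective_matrix (T (x, y) ** F)"
      let ?V = "other_columns k (x ** F)"
      have sub: "subspace {y. \<forall>v \<in> ?V. orthogonal v y}"
        by (auto simp: subspace_def orthogonal_clauses orthogonal_commute)
      obtain B where B: "pairwise orthogonal B" "\<And>b. b \<in> B \<Longrightarrow> norm b = 1" "independent B"
          "card B = dim {y. \<forall>v \<in> ?V. orthogonal v y}" "span B = {y. \<forall>v \<in> ?V. orthogonal v y}"
        by (rule orthonormal_basis_subspace[OF sub]) (rule that)
      have fin: "finite B" using B(3) by (rule independent_imp_finite)
      have "card B + dim ?V = DIM(complex ^ 'r)"
        using dim_subspace_orthogonal_to_vectors[OF subspace_other_columns subspace_UNIV, of k "x ** F"] B(4)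
        by simp
      \<comment> \<open>Real dimension 2 Nr of the whole space minus 2 Nt - 2. Being even, it later
        removes the square roots.\<close>
      then have cardB: "card B = 2 * ?N"
        using dim_other_columns[OF x, of k] card by simp
      have eq: "(norm (pseudo_inv (T (x, y) ** F) $ k))\<^sup>2 = 2 * \<rho> k / (\<Sum>b\<in>B. (y \<bullet> b)\<^sup>2) \<and>
         pseudo_inv (T (x, y) ** F) $ k \<noteq> 0"
        if inj: "injective_matrix (T (x, y) ** F)" for y
      proof -
        have V: "other_columns k (T (x, y) ** F) = ?V"
          unfolding other_columns_def by (intro image_cong refl) (simp add: T_col)
        have "(T (x, y) ** F *v axis k 1) \<bullet> b = (y \<bullet> b) / sqrt (2 * \<rho> k)" if b: "b \<in> B" for b
        proof -
          have "(axis k 1 - (axis k 1 $ k / of_real (\<rho> k)) *s dual k) $ k = 0"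
            using rho_pos[of k] by (simp add: dual_nth)
          then have "(x ** F) *v (axis k 1 - (axis k 1 $ k / of_real (\<rho> k)) *s dual k) \<in> ?V"
            unfolding other_columns_def by blast
          moreover have "b \<in> span B" using b by (rule span_base)
          ultimately have "((x ** F) *v (axis k 1 - (axis k 1 $ k / of_real (\<rho> k)) *s dual k)) \<bullet> b = 0"
            unfolding B(5) by (auto simp: orthogonal_def)
          moreover have "((axis k 1 :: complex ^ 'n) $ k / of_real (sqrt (2 * \<rho> k))) *s y = (1 / sqrt (2 * \<rho> k)) *\<^sub>R y"
            by (simp add: vec_eq_iff scaleR_conv_of_real[where 'a=complex])
          ultimately show ?thesis unfolding T_col by (simp add: inner_add_left)
        qed
        then have "(\<Sum>b\<in>B. ((T (x, y) ** F *v axis k 1) \<bullet> b)\<^sup>2) = (\<Sum>b\<in>B. (y \<bullet> b)\<^sup>2) / (2 * \<rho> k)"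
          using rho_pos[of k] by (simp add: power_divide sum_divide_distrib)
        then have "(\<Sum>b\<in>B. (y \<bullet> b)\<^sup>2) / (2 * \<rho> k) = 1 / (norm (pseudo_inv (T (x, y) ** F) $ k))\<^sup>2"
          using pseudo_inv_row_norm(2)[OF inj B(1,2) fin, of k] B(5) V by simp
        moreover have "pseudo_inv (T (x, y) ** F) $ k \<noteq> 0"
          using pseudo_inv_row_norm(1)[OF inj B(1,2) fin, of k] B(5) V by simp
        moreover have "a = 2 * \<rho> k / s" if "s / (2 * \<rho> k) = 1 / a" "a \<noteq> 0" for a s :: real
          using that rho_pos[of k] by (auto simp: field_simps)
        ultimately show ?thesis by simp
      qed
      have "(\<integral>\<^sup>+y. ?f (T (x, y)) \<partial>std_gaussian) =
         (\<integral>\<^sup>+y. ennreal (exp (- (c / (2 * \<rho> k)) * (\<Sum>b\<in>B. (y \<bullet> b)\<^sup>2))) \<partial>std_gaussian)"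
        using y by (intro nn_integral_cong_AE) (auto elim!: eventually_mono simp: eq)
      also have "\<dots> = ennreal ((1 / sqrt (1 + 2 * (c / (2 * \<rho> k)))) ^ card B)"
        using c rho_pos[of k] by (intro nn_integral_std_gaussian_exp_orthonormal fin B) auto
      also have "(1 / sqrt (1 + 2 * (c / (2 * \<rho> k)))) ^ card B = (1 / (1 + c / \<rho> k)) ^ ?N"
        using c rho_pos[of k] unfolding cardB power_mult by (simp add: power_divide)
      finally show "(\<integral>\<^sup>+y. ?f (T (x, y)) \<partial>std_gaussian) = ennreal ((1 / (1 + c / \<rho> k)) ^ ?N)" .
    qed
  qed
  also have "\<dots> = ennreal ((1 / (1 + c / \<rho> k)) ^ ?N)"
    using law.emeasure_space_1 by simp
  finally show ?thesis .
qed

end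

section \<open>Craig's formula\<close>

text \<open>The projected noise has complex variance s^2 |w|^2, shared equally by its real and
  imaginary parts. In a standard Gaussian on the complex plane each part already has variance 1,
  hence the division by sqrt 2.\<close>

lemma distr_noise_projection:
  fixes L :: "complex ^ 'r::finite \<Rightarrow> complex ^ 'r"
  assumes L: "linear L" and s: "s > 0" and w: "w \<noteq> 0"
    and cov: "\<And>a b. (\<integral>x. (x \<bullet> a) * (x \<bullet> b) \<partial>distr std_gaussian borel L) =
      Re (\<Sum>i\<in>UNIV. \<Sum>j\<in>UNIV. cnj (a $ i) * b $ j * (if i = j then complex_of_real (s\<^sup>2) else 0)) / 2"
  shows "distr (distr std_gaussian borel L) borel (\<lambda>z. \<Sum>m\<in>UNIV. w $ m * z $ m) =
    distr std_gaussian borel (\<lambda>y::complex. (s * norm w / sqrt 2) *\<^sub>R y)"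
proof (rule distr_gaussian_linear[OF L])
  show "linear (\<lambda>z. \<Sum>m\<in>UNIV. w $ m * z $ m)"
    by (rule linearI) (simp_all add: sum.distrib ring_distribs scaleR_sum_right)
  show "s * norm w / sqrt 2 > 0" using s w by simp
  fix y :: complex
  define a :: "complex ^ 'r" where "a = (\<chi> m. cnj (w $ m) * y)"
  have Ua: "(\<Sum>m\<in>UNIV. w $ m * z $ m) \<bullet> y = z \<bullet> a" for z
  proof -
    have z: "u \<bullet> v = Re (cnj v * u)" for u v :: complex
      by (simp add: inner_complex_def algebra_simps)
    show ?thesis unfolding z inner_complex_vec a_def by (simp add: sum_distrib_left mult_ac)
  qed
  have "(\<integral>x. ((\<Sum>m\<in>UNIV. w $ m * x $ m) \<bullet> y)\<^sup>2 \<partial>distr std_gaussian borel L) =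
     Re (\<Sum>i\<in>UNIV. \<Sum>j\<in>UNIV. cnj (a $ i) * a $ j * (if i = j then complex_of_real (s\<^sup>2) else 0)) / 2"
    unfolding Ua power2_eq_square[of "_ \<bullet> _"] by (rule cov)
  also have "(\<Sum>i\<in>UNIV. \<Sum>j\<in>UNIV. cnj (a $ i) * a $ j * (if i = j then complex_of_real (s\<^sup>2) else 0))
     = (\<Sum>i\<in>UNIV. of_real ((norm (a $ i))\<^sup>2 * s\<^sup>2))"
  proof (intro sum.cong refl)
    fix i
    have "(\<Sum>j\<in>UNIV. cnj (a $ i) * a $ j * (if i = j then complex_of_real (s\<^sup>2) else 0)) =
      (a $ i * cnj (a $ i)) * complex_of_real (s\<^sup>2)"
      by (simp add: if_distrib[of "\<lambda>x. _ * x"] mult.commute cong: if_cong)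
    then show "(\<Sum>j\<in>UNIV. cnj (a $ i) * a $ j * (if i = j then complex_of_real (s\<^sup>2) else 0)) =
      of_real ((norm (a $ i))\<^sup>2 * s\<^sup>2)"
      by (simp only: complex_norm_square[symmetric] of_real_mult)
  qed
  also have "Re \<dots> = s\<^sup>2 * (norm a)\<^sup>2"
    by (simp add: norm_vec_def L2_set_def sum_nonneg sum_distrib_left mult.commute)
  also have "(norm a)\<^sup>2 = (norm w)\<^sup>2 * (norm y)\<^sup>2"
    by (simp add: a_def norm_vec_def L2_set_def sum_nonneg norm_mult power_mult_distrib sum_distrib_right)
  finally show "(\<integral>x. ((\<Sum>m\<in>UNIV. w $ m * x $ m) \<bullet> y)\<^sup>2 \<partial>distr std_gaussian borel L) =
     (s * norm w / sqrt 2)\<^sup>2 * (norm y)\<^sup>2"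
    by (simp add: power_mult_distrib power_divide)
qed

section \<open>Polar integration in the complex plane\<close>

lemma std_gaussian_complex:
  "(std_gaussian :: complex measure) = distr (std_gaussian \<Otimes>\<^sub>M std_gaussian) borel (\<lambda>(x, y). Complex x y)"
proof -
  have "linear (\<lambda>(x, y). Complex x y)"
    by (rule linearI) (auto simp: complex_eq_iff)
  moreover have "adjoint (\<lambda>(x, y). Complex x y) = (\<lambda>z. (Re z, Im z))"
    by (rule adjoint_unique) (auto simp: inner_complex_def)
  ultimately show ?thesis
    using distr_std_gaussian_coisometry[of "\<lambda>(x, y). Complex x y"]
    by (simp add: std_gaussian_pair norm_Pair cmod_def)
qed

lemma measurable_Complex_pair:
  "(\<lambda>(x, y). Complex x y) \<in> borel_measurable (std_gaussian \<Otimes>\<^sub>M std_gaussian)"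
proof -
  have "linear (\<lambda>(x, y). Complex x y)"
    by (rule linearI) (auto simp: complex_eq_iff)
  from linear_borel_measurable[OF this]
  show ?thesis unfolding std_gaussian_pair[symmetric] by simp
qed

text \<open>The passage between the Lebesgue integral, used for Fubini, and the gauge integral in
  which \<open>G\<close> is stated. Boundedness and measurability replace continuity, which fails at
  the zeros of the sine.\<close>

lemma integrable_on_bounded_borel:
  fixes f :: "real \<Rightarrow> real"
  assumes [measurable]: "f \<in> borel_measurable borel" and "\<And>x. \<bar>f x\<bar> \<le> B"
  shows "set_integrable lborel {a..b} f" "f integrable_on {a..b}"
    "(\<integral>x. f x * indicator {a..b} x \<partial>lborel) = integral {a..b} f"
proof -
  have "integrable lborel (\<lambda>x. indicator {a..b} x *\<^sub>R f x)"
    by (rule integrableI_bounded_set_indicator[where B=B]) (use assms(2) in \<open>auto simp: emeasure_lborel_Icc_eq\<close>)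
  then show si: "set_integrable lborel {a..b} f" by (simp add: set_integrable_def)
  show "f integrable_on {a..b}" by (rule set_borel_integral_eq_integral(1)[OF si])
  show "(\<integral>x. f x * indicator {a..b} x \<partial>lborel) = integral {a..b} f"
    using set_borel_integral_eq_integral(2)[OF si]
    by (simp add: set_lebesgue_integral_def mult.commute)
qed

text \<open>Where the sine vanishes, the quotient is 0 by convention and the integrand takes the
  value 1 instead of its limit 0 for positive \<tau>. Both claims hold with this value.\<close>

lemma craig_integrand:
  fixes \<tau> :: real
  assumes "\<tau> \<ge> 0"
  shows "(\<lambda>\<theta>. exp (- \<tau> / (sin \<theta>)\<^sup>2)) \<in> borel_measurable borel" "\<And>\<theta>. \<bar>exp (- \<tau> / (sin \<theta>)\<^sup>2)\<bar> \<le> 1"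
proof -
  have [measurable]: "(sin :: real \<Rightarrow> real) \<in> borel_measurable borel"
    by (intro borel_measurable_continuous_onI continuous_intros)
  show "(\<lambda>\<theta>. exp (- \<tau> / (sin \<theta>)\<^sup>2)) \<in> borel_measurable borel" by measurable
  show "\<bar>exp (- \<tau> / (sin \<theta>)\<^sup>2)\<bar> \<le> 1" for \<theta> using assms by simp
qed

lemma craig_integral_deriv:
  fixes \<tau> u :: real
  assumes tau: "\<tau> \<ge> 0" and u: "0 < u" "u < pi"
  shows "((\<lambda>u. integral {0..u} (\<lambda>\<theta>. exp (- \<tau> / (sin \<theta>)\<^sup>2))) has_real_derivative exp (- \<tau> / (sin u)\<^sup>2)) (at u)"
proof -
  let ?e = "\<lambda>\<theta>. exp (- \<tau> / (sin \<theta>)\<^sup>2)"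
  note int = integrable_on_bounded_borel(2)[OF craig_integrand[OF tau]]
  \<comment> \<open>The integrand is continuous away from 0 and \<pi>, so the fundamental theorem is
    applied between the midpoints towards these ends; the integral over [0, a] is a
    constant.\<close>
  define a b where "a = u / 2" and "b = (u + pi) / 2"
  have ab: "0 < a" "a < u" "u < b" "b < pi" using u by (auto simp: a_def b_def)
  have "sin x \<noteq> 0" if "x \<in> {a..b}" for x
    using sin_gt_zero[of x] that ab by auto
  then have "continuous_on {a..b} ?e"
    by (intro continuous_intros) auto
  from integral_has_real_derivative[OF this, of u]
  have "((\<lambda>x. integral {a..x} ?e) has_real_derivative ?e u) (at u within {a..b})"
    using ab by simp
  then have "((\<lambda>x. integral {a..x} ?e) has_real_derivative ?e u) (at u)"
    using at_within_interior[of u "{a..b}"] ab by simp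
  then have deriv: "((\<lambda>x. integral {0..a} ?e + integral {a..x} ?e) has_real_derivative ?e u) (at u)"
    by (auto intro!: derivative_eq_intros)
  have "integral {0..a} ?e + integral {a..x} ?e = integral {0..x} ?e" if "x \<in> {a<..<b}" for x
    by (rule Henstock_Kurzweil_Integration.integral_combine) (use that ab int in auto)
  then show ?thesis
    by (intro has_field_derivative_transform_within_open[OF deriv open_greaterThanLessThan[of a b]]) (use ab in auto)
qed

lemma nn_integral_gaussian_tail:
  fixes c d :: real
  assumes d: "d > 0" and c: "c > 0"
  shows "(\<integral>\<^sup>+x. ennreal (x * exp (- x\<^sup>2 * c / 2)) * indicator {d..} x \<partial>lborel) = ennreal (exp (- d\<^sup>2 * c / 2) / c)"
proof -
  let ?F = "\<lambda>x. - exp (- x\<^sup>2 * c / 2) / c"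
  have "(?F \<longlongrightarrow> 0) at_top"
  proof -
    have "filterlim (\<lambda>x::real. x\<^sup>2) at_top at_top"
      by (rule filterlim_pow_at_top) (simp_all add: filterlim_ident)
    then have "filterlim (\<lambda>x::real. x\<^sup>2 * (c / 2)) at_top at_top"
      using c by (intro filterlim_at_top_mult_tendsto_pos[of _ "c/2"]) auto
    then have "filterlim (\<lambda>x::real. - (x\<^sup>2 * (c / 2))) at_bot at_top"
      by (simp add: filterlim_uminus_at_top)
    then have "((\<lambda>x::real. exp (- (x\<^sup>2 * (c / 2)))) \<longlongrightarrow> 0) at_top"
      by (rule filterlim_compose[OF exp_at_bot])
    then have "((\<lambda>x::real. - exp (- (x\<^sup>2 * (c / 2))) / c) \<longlongrightarrow> - 0 / c) at_top"
      using c by (intro tendsto_intros) auto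
    then show ?thesis by simp
  qed
  moreover have "DERIV ?F x :> x * exp (- x\<^sup>2 * c / 2)" for x
    using c by (auto intro!: derivative_eq_intros simp: field_simps)
  ultimately have "(\<integral>\<^sup>+x. ennreal (x * exp (- x\<^sup>2 * c / 2)) * indicator {d..} x \<partial>lborel) = 0 - ?F d"
    using d by (intro nn_integral_FTC_atLeast) auto
  then show ?thesis by simp
qed

lemma nn_integral_std_gaussian_real:
  "f \<in> borel_measurable borel \<Longrightarrow>
    (\<integral>\<^sup>+x. f x \<partial>(std_gaussian :: real measure)) = (\<integral>\<^sup>+x. ennreal (std_normal_density x) * f x \<partial>lborel)"
  unfolding std_gaussian_real by (subst nn_integral_density) auto

text \<open>Craig's polar-coordinate formula: along the ray of slope \<open>t\<close> the Gaussian mass beyond \<open>Re z = d\<close>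
  is explicit, and \<open>\<theta> = \<pi>/2 - arctan t\<close> turns the integral over the slopes into an integral over angles.\<close>

lemma prob_sector:
  assumes d: "d > 0"
  shows "measure std_gaussian {z. Re z > d \<and> Im z > T * Re z} =
    1 / (2 * pi) * integral {0..pi / 2 - arctan T} (\<lambda>\<theta>. exp (- (d\<^sup>2 / 2) / (sin \<theta>)\<^sup>2))"
proof -
  let ?e = "\<lambda>\<theta>. exp (- (d\<^sup>2 / 2) / (sin \<theta>)\<^sup>2)"
  let ?S = "{z. Re z > d \<and> Im z > T * Re z}"
  have tau: "d\<^sup>2 / 2 \<ge> 0" by simp
  note int = integrable_on_bounded_borel(2)[OF craig_integrand[OF tau]]
  define c where "c = 1 / (2 * pi)"
  have c: "c > 0" by (simp add: c_def)
  have S [measurable]: "?S \<in> sets borel"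
    by (intro borel_open open_Collect_conj open_Collect_less continuous_intros)
  have normal: "std_normal_density x * std_normal_density y = c * exp (- (x\<^sup>2 + y\<^sup>2) / 2)" for x y
  proof -
    have "1 / sqrt (2 * pi) * (1 / sqrt (2 * pi)) = c" by (simp add: c_def)
    moreover have "exp (- x\<^sup>2 / 2) * exp (- y\<^sup>2 / 2) = exp (- (x\<^sup>2 + y\<^sup>2) / 2)"
      by (simp add: mult_exp_exp add_divide_distrib)
    ultimately show ?thesis by (simp add: std_normal_density_def mult_exp_exp field_simps)
  qed
  have "emeasure std_gaussian ?S = (\<integral>\<^sup>+z. indicator ?S z \<partial>std_gaussian)"
    by (simp add: nn_integral_indicator)
  also have "\<dots> = (\<integral>\<^sup>+p. indicator ?S (case p of (x, y) \<Rightarrow> Complex x y) \<partial>(std_gaussian \<Otimes>\<^sub>M std_gaussian))"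
    using measurable_Complex_pair by (subst std_gaussian_complex, subst nn_integral_distr) auto
  also have "\<dots> = (\<integral>\<^sup>+x. \<integral>\<^sup>+y. indicator ?S (Complex x y) \<partial>std_gaussian \<partial>std_gaussian)"
    using measurable_compose[OF measurable_Complex_pair, of "indicator ?S" borel]
    by (subst std_gaussian.nn_integral_fst[symmetric]) (auto simp: case_prod_unfold)
  also have "\<dots> = (\<integral>\<^sup>+x. \<integral>\<^sup>+y. ennreal (std_normal_density x) * (ennreal (std_normal_density y) *
       (indicator {d<..} x * (if T * x < y then 1 else 0))) \<partial>lborel \<partial>lborel)"
  proof -
    have "indicator ?S (Complex x y) = (indicator {d<..} x * (if T * x < y then 1 else 0) :: ennreal)" for x y
      by (auto simp: indicator_def)
    then have "(\<integral>\<^sup>+x. \<integral>\<^sup>+y. indicator ?S (Complex x y) \<partial>std_gaussian \<partial>std_gaussian) =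
      (\<integral>\<^sup>+x. \<integral>\<^sup>+y. indicator {d<..} x * (if T * x < y then 1 else 0) \<partial>std_gaussian \<partial>std_gaussian)" by simp
    also have "\<dots> = (\<integral>\<^sup>+x. ennreal (std_normal_density x) *
      (\<integral>\<^sup>+y. indicator {d<..} x * (if T * x < y then 1 else 0) \<partial>std_gaussian) \<partial>lborel)"
      by (rule nn_integral_std_gaussian_real) measurable
    also have "\<dots> = (\<integral>\<^sup>+x. ennreal (std_normal_density x) *
      (\<integral>\<^sup>+y. ennreal (std_normal_density y) * (indicator {d<..} x * (if T * x < y then 1 else 0)) \<partial>lborel) \<partial>lborel)"
      by (subst nn_integral_std_gaussian_real) auto
    also have "\<dots> = (\<integral>\<^sup>+x. \<integral>\<^sup>+y. ennreal (std_normal_density x) * (ennreal (std_normal_density y) *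
       (indicator {d<..} x * (if T * x < y then 1 else 0))) \<partial>lborel \<partial>lborel)"
      by (subst nn_integral_cmult) auto
    finally show ?thesis .
  qed
  \<comment> \<open>Substitution y = x t for fixed x > 0: t is the slope of the ray, the Jacobian x
    makes the radial integral elementary, and the condition y > T x becomes t > T.\<close>
  also have "\<dots> = (\<integral>\<^sup>+x. \<integral>\<^sup>+t. ennreal (c * x * exp (- x\<^sup>2 * (1 + t\<^sup>2) / 2)) * indicator {T<..} t * indicator {d<..} x \<partial>lborel \<partial>lborel)"
  proof (rule nn_integral_cong)
    fix x :: real
    show "(\<integral>\<^sup>+y. ennreal (std_normal_density x) * (ennreal (std_normal_density y) *
       (indicator {d<..} x * (if T * x < y then 1 else 0))) \<partial>lborel) =
       (\<integral>\<^sup>+t. ennreal (c * x * exp (- x\<^sup>2 * (1 + t\<^sup>2) / 2)) * indicator {T<..} t * indicator {d<..} x \<partial>lborel)"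
    proof (cases "x > d")
      case True
      then have x: "x > 0" using d by simp
      have "(\<integral>\<^sup>+y. ennreal (std_normal_density x) * (ennreal (std_normal_density y) *
         (indicator {d<..} x * (if T * x < y then 1 else 0))) \<partial>lborel) =
        ennreal x * (\<integral>\<^sup>+t. ennreal (std_normal_density x) * (ennreal (std_normal_density (x * t)) *
         (indicator {d<..} x * (if T * x < x * t then 1 else 0))) \<partial>lborel)"
        using x by (subst nn_integral_real_affine[where c=x and t=0]) auto
      also have "\<dots> = (\<integral>\<^sup>+t. ennreal (c * x * exp (- x\<^sup>2 * (1 + t\<^sup>2) / 2)) * indicator {T<..} t * indicator {d<..} x \<partial>lborel)"
      proof (subst nn_integral_cmult[symmetric], simp, rule nn_integral_cong)
        fix t :: real
        have "x * (std_normal_density x * std_normal_density (x * t)) = c * x * exp (- x\<^sup>2 * (1 + t\<^sup>2) / 2)"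
          unfolding normal by (simp add: power_mult_distrib distrib_left)
        moreover have "T * x < x * t \<longleftrightarrow> T < t" using x by (simp add: mult.commute)
        ultimately show "ennreal x * (ennreal (std_normal_density x) * (ennreal (std_normal_density (x * t)) *
           (indicator {d<..} x * (if T * x < x * t then 1 else 0)))) =
           ennreal (c * x * exp (- x\<^sup>2 * (1 + t\<^sup>2) / 2)) * indicator {T<..} t * indicator {d<..} x"
          using x True c by (auto simp: indicator_def ennreal_mult[symmetric] mult_ac)
      qed
      finally show ?thesis .
    qed simp
  qed
  also have "\<dots> = (\<integral>\<^sup>+t. \<integral>\<^sup>+x. ennreal (c * x * exp (- x\<^sup>2 * (1 + t\<^sup>2) / 2)) * indicator {T<..} t * indicator {d<..} x \<partial>lborel \<partial>lborel)"
    by (rule lborel_pair.Fubini') measurable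
  \<comment> \<open>The open rays of integration are replaced by closed ones, as the fundamental
    theorem on a half-line is stated for them; the points t = T and x = d are null.\<close>
  also have "\<dots> = (\<integral>\<^sup>+t. ennreal (c * exp (- d\<^sup>2 * (1 + t\<^sup>2) / 2) / (1 + t\<^sup>2)) * indicator {T..} t \<partial>lborel)"
  proof (rule nn_integral_cong_AE)
    have "AE t in lborel. t \<noteq> T" by (rule AE_lborel_singleton)
    then show "AE t in lborel. (\<integral>\<^sup>+x. ennreal (c * x * exp (- x\<^sup>2 * (1 + t\<^sup>2) / 2)) * indicator {T<..} t * indicator {d<..} x \<partial>lborel) =
      ennreal (c * exp (- d\<^sup>2 * (1 + t\<^sup>2) / 2) / (1 + t\<^sup>2)) * indicator {T..} t"
    proof eventually_elim
      fix t :: real assume t: "t \<noteq> T"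
      have pos: "1 + t\<^sup>2 > 0" by (simp add: add_pos_nonneg)
      have "(\<integral>\<^sup>+x. ennreal (c * x * exp (- x\<^sup>2 * (1 + t\<^sup>2) / 2)) * indicator {T<..} t * indicator {d<..} x \<partial>lborel) =
         (\<integral>\<^sup>+x. ennreal c * indicator {T<..} t * (ennreal (x * exp (- x\<^sup>2 * (1 + t\<^sup>2) / 2)) * indicator {d..} x) \<partial>lborel)"
      proof (rule nn_integral_cong_AE)
        have "AE x in lborel. x \<noteq> d" by (rule AE_lborel_singleton)
        then show "AE x in lborel. ennreal (c * x * exp (- x\<^sup>2 * (1 + t\<^sup>2) / 2)) * indicator {T<..} t * indicator {d<..} x =
          ennreal c * indicator {T<..} t * (ennreal (x * exp (- x\<^sup>2 * (1 + t\<^sup>2) / 2)) * indicator {d..} x)"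
          by eventually_elim (use c d in \<open>auto simp: indicator_def ennreal_mult[symmetric] mult.assoc\<close>)
      qed
      also have "\<dots> = ennreal c * indicator {T<..} t * ennreal (exp (- d\<^sup>2 * (1 + t\<^sup>2) / 2) / (1 + t\<^sup>2))"
        by (subst nn_integral_cmult) (simp_all add: nn_integral_gaussian_tail[OF d pos, simplified])
      also have "\<dots> = ennreal (c * exp (- d\<^sup>2 * (1 + t\<^sup>2) / 2) / (1 + t\<^sup>2)) * indicator {T..} t"
        using c pos t by (auto simp: indicator_def ennreal_mult[symmetric])
      finally show "(\<integral>\<^sup>+x. ennreal (c * x * exp (- x\<^sup>2 * (1 + t\<^sup>2) / 2)) * indicator {T<..} t * indicator {d<..} x \<partial>lborel) =
         ennreal (c * exp (- d\<^sup>2 * (1 + t\<^sup>2) / 2) / (1 + t\<^sup>2)) * indicator {T..} t" .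
    qed
  qed
  also have "\<dots> = 0 - (- c * integral {0..pi / 2 - arctan T} ?e)"
  \<comment> \<open>The change of variables is made inside the antiderivative: sin^2(\<pi>/2 -
    arctan t) = 1 / (1 + t^2) matches the exponentials, the derivative of arctan supplies the
    remaining factor, and the upper limit tends to 0 as t grows.\<close>
  proof (rule nn_integral_FTC_atLeast[where F="\<lambda>t. - c * integral {0..pi / 2 - arctan t} ?e"])
    show "(\<lambda>t. c * exp (- d\<^sup>2 * (1 + t\<^sup>2) / 2) / (1 + t\<^sup>2)) \<in> borel_measurable borel" by measurable
    fix t :: real
    have pos: "1 + t\<^sup>2 > 0" by (simp add: add_pos_nonneg)
    show "0 \<le> c * exp (- d\<^sup>2 * (1 + t\<^sup>2) / 2) / (1 + t\<^sup>2)" using c pos by simp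
    have "(sin (pi / 2 - arctan t))\<^sup>2 = 1 / (1 + t\<^sup>2)"
      using pos by (simp add: sin_diff cos_arctan power_divide)
    then have e: "?e (pi / 2 - arctan t) = exp (- d\<^sup>2 * (1 + t\<^sup>2) / 2)" by simp
    have "0 < pi / 2 - arctan t" "pi / 2 - arctan t < pi"
      using arctan_lbound[of t] arctan_ubound[of t] by auto
    from craig_integral_deriv[OF tau this]
    have 1: "((\<lambda>u. integral {0..u} ?e) has_real_derivative exp (- d\<^sup>2 * (1 + t\<^sup>2) / 2)) (at (pi / 2 - arctan t))"
      unfolding e .
    have 2: "((\<lambda>t. pi / 2 - arctan t) has_real_derivative - inverse (1 + t\<^sup>2)) (at t)"
      by (auto intro!: derivative_eq_intros)
    from DERIV_chain2[OF 1 2]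
    have "((\<lambda>t. integral {0..pi / 2 - arctan t} ?e) has_real_derivative exp (- d\<^sup>2 * (1 + t\<^sup>2) / 2) * - inverse (1 + t\<^sup>2)) (at t)" .
    from DERIV_cmult[OF this, of "- c"] show "((\<lambda>t. - c * integral {0..pi / 2 - arctan t} ?e) has_real_derivative c * exp (- d\<^sup>2 * (1 + t\<^sup>2) / 2) / (1 + t\<^sup>2)) (at t)"
      by (rule DERIV_cong) (simp add: inverse_eq_divide)
  next
    have cont: "continuous_on {0..pi} (\<lambda>u. integral {0..u} ?e)"
      by (rule indefinite_integral_continuous_1[OF int])
    have "((\<lambda>t. pi / 2 - arctan t) \<longlongrightarrow> pi / 2 - pi / 2) at_top"
      by (intro tendsto_intros tendsto_arctan_at_top)
    then have "((\<lambda>t. integral {0..pi / 2 - arctan t} ?e) \<longlongrightarrow> integral {0..0} ?e) at_top"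
    proof (intro continuous_on_tendsto_compose[OF cont])
      have "pi / 2 - arctan t \<in> {0..pi}" for t
        using arctan_lbound[of t] arctan_ubound[of t] by simp
      then show "\<forall>\<^sub>F t in at_top. pi / 2 - arctan t \<in> {0..pi}" by simp
    qed auto
    from tendsto_mult_left[OF this, of "- c"]
    show "((\<lambda>t. - c * integral {0..pi / 2 - arctan t} ?e) \<longlongrightarrow> 0) at_top" by simp
  qed
  finally have "emeasure std_gaussian ?S = ennreal (c * integral {0..pi / 2 - arctan T} ?e)" by simp
  moreover have "integral {0..pi / 2 - arctan T} ?e \<ge> 0" by (rule integral_nonneg[OF int]) simp
  ultimately show ?thesis using c by (simp add: measure_def c_def)
qed

section \<open>Symbol errors of the constellations\<close>

lemma measure_std_gaussian_orthogonal:
  fixes T :: "'v::euclidean_space \<Rightarrow> 'v"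
  assumes T: "orthogonal_transformation T" and [measurable]: "{z. Q z} \<in> sets borel"
  shows "measure std_gaussian {z. Q (T z)} = measure std_gaussian {z. Q z}"
proof -
  note [measurable] = linear_borel_measurable[OF orthogonal_transformation_linear[OF T]]
  have "measure std_gaussian {z. Q z} = measure (distr std_gaussian borel T) {z. Q z}"
    by (simp add: distr_std_gaussian_orthogonal_transformation[OF T])
  also have "\<dots> = measure std_gaussian {z. Q (T z)}"
    by (subst measure_distr) (auto simp: vimage_def)
  finally show ?thesis by simp
qed

lemma orthogonal_transformation_cmult:
  "cmod u = 1 \<Longrightarrow> orthogonal_transformation (\<lambda>z. u * z)"
  unfolding orthogonal_transformation
  by (auto simp: linear_iff norm_mult algebra_simps)

lemma orthogonal_transformation_cnj: "orthogonal_transformation cnj"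
  unfolding orthogonal_transformation by (auto simp: linear_iff)

lemma AE_std_gaussian_hyperplane:
  fixes a :: "'v::euclidean_space"
  assumes "a \<noteq> 0"
  shows "AE z in std_gaussian. z \<bullet> a \<noteq> b"
proof -
  have "{z. a \<bullet> z = b} \<in> null_sets std_gaussian"
    using assms by (intro negligible_null_sets_std_gaussian negligible_hyperplane borel_closed closed_hyperplane) auto
  from AE_not_in[OF this] show ?thesis by (simp add: inner_commute)
qed

lemma measure_std_gaussian_cong_AE:
  assumes "AE z in std_gaussian. Q z \<longleftrightarrow> R z" "{z. Q z} \<in> sets borel" "{z. R z} \<in> sets borel"
  shows "measure (std_gaussian :: 'v::euclidean_space measure) {z. Q z} = measure std_gaussian {z. R z}"
  using assms by (intro std_gaussian.finite_measure_eq_AE) auto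

lemma measure_std_gaussian_complex_Times:
  assumes [measurable]: "A \<in> sets borel" "B \<in> sets borel"
  shows "measure std_gaussian {z. Re z \<in> A \<and> Im z \<in> B} = measure std_gaussian A * measure std_gaussian B"
proof -
  have S: "{z. Re z \<in> A \<and> Im z \<in> B} \<in> sets borel"
    by measurable
  have "emeasure std_gaussian {z. Re z \<in> A \<and> Im z \<in> B} =
    emeasure (std_gaussian \<Otimes>\<^sub>M std_gaussian) ((\<lambda>(x, y). Complex x y) -` {z. Re z \<in> A \<and> Im z \<in> B} \<inter> space (std_gaussian \<Otimes>\<^sub>M std_gaussian))"
    using S measurable_Complex_pair by (subst std_gaussian_complex, subst emeasure_distr) auto
  also have "(\<lambda>(x, y). Complex x y) -` {z. Re z \<in> A \<and> Im z \<in> B} \<inter> space (std_gaussian \<Otimes>\<^sub>M std_gaussian) = A \<times> B"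
    by (auto simp: space_pair_measure)
  also have "emeasure (std_gaussian \<Otimes>\<^sub>M std_gaussian) (A \<times> B) = emeasure std_gaussian A * emeasure std_gaussian B"
    by (rule std_gaussian.emeasure_pair_measure_Times) auto
  finally show ?thesis by (simp add: measure_def enn2real_mult)
qed

text \<open>For \<tau> = d^2 / 2 with d > 0, \<open>craig 0 (pi / 2) \<tau>\<close> divided by \<pi>
  is the Gaussian tail probability beyond d.\<close>

definition craig :: "real \<Rightarrow> real \<Rightarrow> real \<Rightarrow> real" where
  "craig a b \<tau> = integral {a..b} (\<lambda>\<theta>. exp (- \<tau> / (sin \<theta>)\<^sup>2))"

text \<open>The half plane consists, up to a null line, of the sector of slope above 0 and its
  mirror image under conjugation.\<close>

lemma prob_Re_greater:
  assumes d: "d > 0"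
  shows "measure std_gaussian {z. Re z > d} = 1 / pi * craig 0 (pi / 2) (d\<^sup>2 / 2)"
    "measure (std_gaussian :: real measure) {d<..} = 1 / pi * craig 0 (pi / 2) (d\<^sup>2 / 2)"
proof -
  have sets: "{z. Re z > d \<and> Im z > 0} \<in> sets borel" "{z. Re z > d \<and> Im z < 0} \<in> sets borel" "{z. Re z > d} \<in> sets borel"
    by (intro borel_open open_Collect_conj open_Collect_less continuous_intros)+
  have "AE z in std_gaussian. z \<bullet> \<i> \<noteq> 0" by (rule AE_std_gaussian_hyperplane) simp
  then have "AE z in std_gaussian. Re z > d \<longleftrightarrow> (Re z > d \<and> Im z > 0) \<or> (Re z > d \<and> Im z < 0)"
    by eventually_elim (auto simp: inner_complex_def)
  then have "measure std_gaussian {z. Re z > d} = measure std_gaussian {z. (Re z > d \<and> Im z > 0) \<or> (Re z > d \<and> Im z < 0)}"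
    by (rule measure_std_gaussian_cong_AE) (use sets in \<open>auto simp: Collect_disj_eq\<close>)
  also have "\<dots> = measure std_gaussian {z. Re z > d \<and> Im z > 0} + measure std_gaussian {z. Re z > d \<and> Im z < 0}"
    unfolding Collect_disj_eq using sets by (intro std_gaussian.finite_measure_Union) auto
  also have "measure std_gaussian {z. Re z > d \<and> Im z < 0} = measure std_gaussian {z. Re z > d \<and> Im z > 0}"
    using measure_std_gaussian_orthogonal[OF orthogonal_transformation_cnj sets(1)] by simp
  also have "measure std_gaussian {z. Re z > d \<and> Im z > 0} = 1 / (2 * pi) * craig 0 (pi / 2) (d\<^sup>2 / 2)"
    using prob_sector[OF d, of 0] by (simp add: craig_def)
  finally show 1: "measure std_gaussian {z. Re z > d} = 1 / pi * craig 0 (pi / 2) (d\<^sup>2 / 2)" by simp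
  have "measure std_gaussian {z. Re z > d} = measure (std_gaussian :: real measure) {d<..} * measure (std_gaussian :: real measure) UNIV"
    using measure_std_gaussian_complex_Times[of "{d<..}" UNIV] by simp
  then show "measure (std_gaussian :: real measure) {d<..} = 1 / pi * craig 0 (pi / 2) (d\<^sup>2 / 2)"
    using 1 std_gaussian.prob_space[where 'a=real] by simp
qed

text \<open>The square is the mass of a shifted quadrant. Its diagonal cuts it into two sectors that
  z \<mapsto> i conj(z) exchanges; slope 1 is what ends the integral at \<pi>/4.\<close>

lemma prob_real_greater_square:
  assumes d: "d > 0"
  shows "(measure (std_gaussian :: real measure) {d<..})\<^sup>2 = 1 / pi * craig 0 (pi / 4) (d\<^sup>2 / 2)"
proof -
  have sets: "{z. Re z > d \<and> Im z > 1 * Re z} \<in> sets borel" "{z. Im z > d \<and> Re z > 1 * Im z} \<in> sets borel"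
    "{z. Re z \<in> {d<..} \<and> Im z \<in> {d<..}} \<in> sets borel"
    by (auto intro!: borel_open open_Collect_conj open_Collect_less continuous_intros)
  have "AE z in std_gaussian. z \<bullet> Complex 1 (-1) \<noteq> 0"
    by (rule AE_std_gaussian_hyperplane) (simp add: complex_eq_iff)
  then have "AE z in std_gaussian. (Re z \<in> {d<..} \<and> Im z \<in> {d<..}) \<longleftrightarrow>
     (Re z > d \<and> Im z > 1 * Re z) \<or> (Im z > d \<and> Re z > 1 * Im z)"
    by eventually_elim (auto simp: inner_complex_def)
  then have "measure std_gaussian {z. Re z \<in> {d<..} \<and> Im z \<in> {d<..}} =
     measure std_gaussian {z. (Re z > d \<and> Im z > 1 * Re z) \<or> (Im z > d \<and> Re z > 1 * Im z)}"
    by (rule measure_std_gaussian_cong_AE) (use sets in \<open>auto simp: Collect_disj_eq\<close>)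
  also have "\<dots> = measure std_gaussian {z. Re z > d \<and> Im z > 1 * Re z} + measure std_gaussian {z. Im z > d \<and> Re z > 1 * Im z}"
    unfolding Collect_disj_eq using sets by (intro std_gaussian.finite_measure_Union) auto
  also have "measure std_gaussian {z. Im z > d \<and> Re z > 1 * Im z} = measure std_gaussian {z. Re z > d \<and> Im z > 1 * Re z}"
  proof -
    have T: "orthogonal_transformation (\<lambda>z. \<i> * cnj z)"
      unfolding orthogonal_transformation by (auto simp: linear_iff norm_mult algebra_simps)
    show ?thesis using measure_std_gaussian_orthogonal[OF T sets(1)] by simp
  qed
  also have "measure std_gaussian {z. Re z > d \<and> Im z > 1 * Re z} = 1 / (2 * pi) * craig 0 (pi / 4) (d\<^sup>2 / 2)"
  proof -
    have "pi / 2 - arctan 1 = pi / 4" by (simp add: arctan_one)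
    then show ?thesis using prob_sector[OF d, of 1] by (simp add: craig_def)
  qed
  finally show ?thesis
    by (subst (asm) measure_std_gaussian_complex_Times) (auto simp: power2_eq_square)
qed

section \<open>Nearest-symbol decisions\<close>

lemma measurable_nearest_symbol:
  assumes fin: "finite S"
  shows "nearest_symbol S \<in> borel_measurable borel"
proof -
  define Q where "Q a z \<longleftrightarrow> (\<forall>b\<in>S. (cmod (z - a))\<^sup>2 \<le> (cmod (z - b))\<^sup>2)" for a z
  define m where "m z = {a \<in> S. Q a z}" for z
  have "(\<lambda>x. is_arg_min (\<lambda>a. (cmod (z - a))\<^sup>2) (\<lambda>x. x \<in> S) x) = (\<lambda>a. a \<in> m z)" for z
    by (simp add: is_arg_min_def m_def Q_def not_less fun_eq_iff Ball_def)
  then have eq: "nearest_symbol S = (\<lambda>z. SOME a. a \<in> m z)"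
    unfolding nearest_symbol_def arg_min_on_def arg_min_def by simp
  have Q: "{z \<in> space borel. Q a z} \<in> sets borel" for a
    unfolding Q_def
    by (rule sets.sets_Collect_finite_All[OF _ fin])
      (auto intro!: borel_closed closed_Collect_le continuous_intros)
  have "m \<in> borel \<rightarrow>\<^sub>M count_space (Pow S)"
  proof (subst measurable_count_space_eq2)
    show "finite (Pow S)" using fin by simp
    have "m -` {A} \<inter> space borel \<in> sets borel" if A: "A \<in> Pow S" for A
    proof -
      have "m z = A \<longleftrightarrow> (\<forall>a\<in>A. Q a z) \<and> (\<forall>a\<in>S - A. \<not> Q a z)" for z
        using A unfolding m_def by blast
      then have "m -` {A} \<inter> space borel = {z \<in> space borel. (\<forall>a\<in>A. Q a z) \<and> (\<forall>a\<in>S - A. \<not> Q a z)}"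
        by (simp add: vimage_def)
      also have "\<dots> \<in> sets borel"
        using A fin finite_subset[of A S]
        by (intro sets.sets_Collect_conj sets.sets_Collect_finite_All sets.sets_Collect_neg Q) auto
      finally show ?thesis .
    qed
    then show "m \<in> space borel \<rightarrow> Pow S \<and> (\<forall>a\<in>Pow S. m -` {a} \<inter> space borel \<in> sets borel)"
      by (auto simp: m_def)
  qed
  then show ?thesis unfolding eq by (rule measurable_compose) simp
qed

text \<open>Almost surely there is no tie, and a symbol error means that some other symbol is strictly closer.\<close>

lemma prob_nearest_symbol_neq:
  assumes fin: "finite S" and a: "a \<in> S" and k: "\<kappa> > 0"
  shows "measure std_gaussian {z. nearest_symbol S (a + \<kappa> *\<^sub>R z) \<noteq> a} =
    measure std_gaussian {z. \<exists>b\<in>S. (cmod (b - a))\<^sup>2 < 2 * \<kappa> * (z \<bullet> (b - a))}"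
proof (rule measure_std_gaussian_cong_AE)
  have closer: "(cmod (a + \<kappa> *\<^sub>R z - b))\<^sup>2 < (cmod (a + \<kappa> *\<^sub>R z - a))\<^sup>2 \<longleftrightarrow> (cmod (b - a))\<^sup>2 < 2 * \<kappa> * (z \<bullet> (b - a))"
    "(cmod (a + \<kappa> *\<^sub>R z - a))\<^sup>2 < (cmod (a + \<kappa> *\<^sub>R z - b))\<^sup>2 \<longleftrightarrow> 2 * \<kappa> * (z \<bullet> (b - a)) < (cmod (b - a))\<^sup>2" for z b
  proof -
    have "a + \<kappa> *\<^sub>R z - b = \<kappa> *\<^sub>R z - (b - a)" by simp
    then have "(cmod (a + \<kappa> *\<^sub>R z - b))\<^sup>2 = (cmod (a + \<kappa> *\<^sub>R z - a))\<^sup>2 - 2 * \<kappa> * (z \<bullet> (b - a)) + (cmod (b - a))\<^sup>2"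
      by (simp only: power2_norm_eq_inner)
        (simp add: inner_diff_left inner_diff_right inner_commute algebra_simps)
    then show "(cmod (a + \<kappa> *\<^sub>R z - b))\<^sup>2 < (cmod (a + \<kappa> *\<^sub>R z - a))\<^sup>2 \<longleftrightarrow> (cmod (b - a))\<^sup>2 < 2 * \<kappa> * (z \<bullet> (b - a))"
      "(cmod (a + \<kappa> *\<^sub>R z - a))\<^sup>2 < (cmod (a + \<kappa> *\<^sub>R z - b))\<^sup>2 \<longleftrightarrow> 2 * \<kappa> * (z \<bullet> (b - a)) < (cmod (b - a))\<^sup>2"
      by auto
  qed
  \<comment> \<open>A tie between \<open>a\<close> and \<open>b\<close> confines z to a hyperplane
    with normal \<open>b - a\<close>.\<close>
  have "AE z in std_gaussian. \<forall>b\<in>S - {a}. z \<bullet> (b - a) \<noteq> (cmod (b - a))\<^sup>2 / (2 * \<kappa>)"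
    using fin by (intro AE_finite_allI AE_std_gaussian_hyperplane) auto
  then show "AE z in std_gaussian. nearest_symbol S (a + \<kappa> *\<^sub>R z) \<noteq> a \<longleftrightarrow> (\<exists>b\<in>S. (cmod (b - a))\<^sup>2 < 2 * \<kappa> * (z \<bullet> (b - a)))"
  proof eventually_elim
    fix z assume z: "\<forall>b\<in>S - {a}. z \<bullet> (b - a) \<noteq> (cmod (b - a))\<^sup>2 / (2 * \<kappa>)"
    let ?y = "a + \<kappa> *\<^sub>R z"
    let ?n = "nearest_symbol S ?y"
    have n: "?n \<in> S" "\<not> (\<exists>x\<in>S. (cmod (?y - x))\<^sup>2 < (cmod (?y - ?n))\<^sup>2)"
      using arg_min_if_finite[OF fin, of "\<lambda>a. (cmod (?y - a))\<^sup>2"] a unfolding nearest_symbol_def by auto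
    show "?n \<noteq> a \<longleftrightarrow> (\<exists>b\<in>S. (cmod (b - a))\<^sup>2 < 2 * \<kappa> * (z \<bullet> (b - a)))"
    proof
      assume "?n \<noteq> a"
      then have "z \<bullet> (?n - a) \<noteq> (cmod (?n - a))\<^sup>2 / (2 * \<kappa>)" using z n(1) by blast
      then have "2 * \<kappa> * (z \<bullet> (?n - a)) \<noteq> (cmod (?n - a))\<^sup>2" using k by (auto simp: field_simps)
      moreover have "\<not> 2 * \<kappa> * (z \<bullet> (?n - a)) < (cmod (?n - a))\<^sup>2"
        using n(2) a closer(2)[of z ?n] by blast
      ultimately show "\<exists>b\<in>S. (cmod (b - a))\<^sup>2 < 2 * \<kappa> * (z \<bullet> (b - a))" using n(1) by force
    next
      assume "\<exists>b\<in>S. (cmod (b - a))\<^sup>2 < 2 * \<kappa> * (z \<bullet> (b - a))"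
      then show "?n \<noteq> a" using n(2) closer(1) by metis
    qed
  qed
  have "(\<lambda>z. nearest_symbol S (a + \<kappa> *\<^sub>R z)) \<in> borel_measurable borel"
    using measurable_nearest_symbol[OF fin] by measurable
  from measurable_sets[OF this, of "- {a}"]
  show "{z. nearest_symbol S (a + \<kappa> *\<^sub>R z) \<noteq> a} \<in> sets borel"
    by (simp add: vimage_def)
  have "(\<Union>b\<in>S. {z. (cmod (b - a))\<^sup>2 < 2 * \<kappa> * (z \<bullet> (b - a))}) \<in> sets borel"
    by (intro borel_open open_UN ballI open_Collect_less continuous_intros)
  moreover have "(\<Union>b\<in>S. {z. (cmod (b - a))\<^sup>2 < 2 * \<kappa> * (z \<bullet> (b - a))}) = {z. \<exists>b\<in>S. (cmod (b - a))\<^sup>2 < 2 * \<kappa> * (z \<bullet> (b - a))}"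
    by auto
  ultimately show "{z. \<exists>b\<in>S. (cmod (b - a))\<^sup>2 < 2 * \<kappa> * (z \<bullet> (b - a))} \<in> sets borel"
    by simp
qed

text \<open>All symbols are equally likely, and \<kappa> is the noise deviation per real
  dimension.\<close>

definition symbol_error :: "complex set \<Rightarrow> real \<Rightarrow> real" where
  "symbol_error S \<kappa> = (\<Sum>a\<in>S. measure std_gaussian {z. nearest_symbol S (a + \<kappa> *\<^sub>R z) \<noteq> a}) / real (card S)"

text \<open>The noise values that carry level \<open>i\<close> of \<open>q\<close> across a decision
  threshold, with \<open>d\<close> half the spacing in units of the noise deviation. An end level
  has one neighbour, so one side drops out.\<close>

definition outer_set :: "nat \<Rightarrow> real \<Rightarrow> nat \<Rightarrow> real set" where
  "outer_set q d i = {x. (i < q \<and> d < x) \<or> (1 < i \<and> x < - d)}"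

lemma amplitude_levels_eq:
  "amplitude_levels \<delta> (real q) = (\<lambda>i. \<delta> * (2 * real i - 1 - real q)) ` {1..q}"
  unfolding amplitude_levels_def by auto

lemma inj_on_levels: "\<delta> > 0 \<Longrightarrow> inj_on (\<lambda>i. \<delta> * (2 * real i - 1 - real q)) {1..q}"
  by (auto simp: inj_on_def)

text \<open>Dividing by the difference of the levels, level j is closer exactly if the noise passes
  half the way towards it. On either side the adjacent level asks for the least, so it decides
  whether any level is closer.\<close>

lemma closer_level_iff:
  fixes \<delta> \<kappa> x :: real and q :: nat
  defines "lev \<equiv> \<lambda>i. \<delta> * (2 * real i - 1 - real q)"
  assumes \<delta>: "\<delta> > 0" and \<kappa>: "\<kappa> > 0" and i: "i \<in> {1..q}"
  shows "(\<exists>j\<in>{1..q}. (lev j - lev i)\<^sup>2 < 2 * \<kappa> * (x * (lev j - lev i))) \<longleftrightarrow> x \<in> outer_set q (\<delta> / \<kappa>) i"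
proof
  have diff: "lev j - lev i = 2 * \<delta> * (real j - real i)" for j i
    by (simp add: lev_def algebra_simps)
  {
    assume "\<exists>j\<in>{1..q}. (lev j - lev i)\<^sup>2 < 2 * \<kappa> * (x * (lev j - lev i))"
    then obtain j where j: "j \<in> {1..q}" and less: "(lev j - lev i)\<^sup>2 < 2 * \<kappa> * (x * (lev j - lev i))" by blast
    define r where "r = lev j - lev i"
    have less: "r * r < (2 * \<kappa> * x) * r" using less by (simp add: r_def power2_eq_square mult_ac)
    consider "j > i" | "j < i" | "j = i" by linarith
    then show "x \<in> outer_set q (\<delta> / \<kappa>) i"
    proof cases
      case 1
      then have "r \<ge> 2 * \<delta>" using \<delta> by (simp add: r_def diff)
      moreover have "r < 2 * \<kappa> * x" using less \<open>r \<ge> 2 * \<delta>\<close> \<delta> by (simp add: mult_less_cancel_right)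
      ultimately have "\<delta> / \<kappa> < x" using \<kappa> by (simp add: field_simps)
      then show ?thesis using 1 j by (auto simp: outer_set_def)
    next
      case 2
      then have "2 * \<delta> * (real j - real i) \<le> 2 * \<delta> * (-1)" using \<delta> by (intro mult_left_mono) auto
      then have r: "r \<le> - (2 * \<delta>)" by (simp add: r_def diff)
      moreover have "r > 2 * \<kappa> * x" using less r \<delta> by (simp add: mult_less_cancel_right)
      ultimately have "x < - (\<delta> / \<kappa>)" using \<kappa> by (simp add: field_simps)
      then show ?thesis using 2 j i by (auto simp: outer_set_def)
    next
      case 3
      then show ?thesis using less by (simp add: r_def)
    qed
  }
  assume "x \<in> outer_set q (\<delta> / \<kappa>) i"
  then consider "i < q" "\<delta> / \<kappa> < x" | "1 < i" "x < - (\<delta> / \<kappa>)" unfolding outer_set_def by auto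
  then show "\<exists>j\<in>{1..q}. (lev j - lev i)\<^sup>2 < 2 * \<kappa> * (x * (lev j - lev i))"
  proof cases
    case 1
    have "lev (Suc i) - lev i = 2 * \<delta>" by (simp add: diff)
    moreover have "\<delta> < \<kappa> * x" using 1 \<kappa> by (simp add: field_simps)
    then have "(2 * \<delta>)\<^sup>2 < 2 * \<kappa> * (x * (2 * \<delta>))" using \<delta> by (simp add: power2_eq_square)
    ultimately show ?thesis using 1 i by (intro bexI[of _ "Suc i"]) auto
  next
    case 2
    have "lev (i - 1) - lev i = - (2 * \<delta>)" using 2 by (simp add: diff of_nat_diff)
    moreover have "\<delta> < - (\<kappa> * x)" using 2 \<kappa> by (simp add: field_simps)
    then have "\<delta> * \<delta> < \<delta> * - (\<kappa> * x)" using \<delta> by (rule mult_strict_left_mono)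
    then have "(- (2 * \<delta>))\<^sup>2 < 2 * \<kappa> * (x * (- (2 * \<delta>)))" by (simp add: power2_eq_square mult_ac)
    ultimately show ?thesis using 2 i by (intro bexI[of _ "i - 1"]) auto
  qed
qed

lemma sets_outer_set [measurable]: "outer_set q d i \<in> sets borel"
  unfolding outer_set_def by measurable

lemma measure_outer_set:
  assumes d: "d > 0"
  shows "measure std_gaussian (outer_set q d i) =
    measure (std_gaussian :: real measure) {d<..} * (of_bool (i < q) + of_bool (1 < i))"
proof -
  have T: "orthogonal_transformation (\<lambda>x::real. - x)"
    unfolding orthogonal_transformation by (simp add: linear_iff)
  have neg: "measure std_gaussian {x. x < - d} = measure (std_gaussian :: real measure) {d<..}"
    using measure_std_gaussian_orthogonal[OF T, of "\<lambda>x. d < x"] by (simp add: greaterThan_def less_minus_iff)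
  have "outer_set q d i = (if i < q then {d<..} else {}) \<union> (if 1 < i then {x. x < - d} else {})"
    by (auto simp: outer_set_def)
  also have "measure std_gaussian \<dots> = measure std_gaussian (if i < q then {d<..} else {} :: real set) +
     measure std_gaussian (if 1 < i then {x::real. x < - d} else {})"
    using d by (intro std_gaussian.finite_measure_Union) auto
  finally show ?thesis by (simp add: neg)
qed

text \<open>Counts ordered pairs of adjacent levels, q - 1 in each direction; the origin of the
  factor 2 (M - 1) for PAM.\<close>

lemma sum_outer: "(\<Sum>i\<in>{1..q}. (of_bool (i < q) + of_bool (1 < i) :: real)) = 2 * real (q - 1)"
proof -
  have "(\<Sum>i\<in>{1..q}. (of_bool (i < q) :: real)) = real (card ({1..q} \<inter> {i. i < q}))"
    by simp
  also have "{1..q} \<inter> {i. i < q} = {1..<q}" by auto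
  finally have 1: "(\<Sum>i\<in>{1..q}. (of_bool (i < q) :: real)) = real (q - 1)" by simp
  have "(\<Sum>i\<in>{1..q}. (of_bool (1 < i) :: real)) = real (card ({1..q} \<inter> {i. 1 < i}))"
    by simp
  also have "{1..q} \<inter> {i. 1 < i} = {2..q}" by auto
  finally have 2: "(\<Sum>i\<in>{1..q}. (of_bool (1 < i) :: real)) = real (q - 1)" by simp
  show ?thesis unfolding sum.distrib 1 2 by simp
qed

lemma finite_PAM: "finite (PAM M)"
  unfolding PAM_def amplitude_levels_eq by simp

text \<open>The symbols are real, so the comparison of distances sees only the real part of the
  noise, and each adjacent level costs one tail probability \<open>p\<close>.\<close>

lemma symbol_error_PAM:
  assumes M: "M \<ge> 2" and \<kappa>: "\<kappa> > 0"
  shows "symbol_error (PAM M) \<kappa> =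
    2 * (real M - 1) / (real M * pi) * craig 0 (pi / 2) (3 / ((real M)\<^sup>2 - 1) / (2 * \<kappa>\<^sup>2))"
proof -
  define \<delta> where "\<delta> = sqrt (3 / ((real M)\<^sup>2 - 1))"
  have M2: "(real M)\<^sup>2 > 1" using M by (simp add: one_less_power)
  have \<delta>: "\<delta> > 0" "\<delta>\<^sup>2 = 3 / ((real M)\<^sup>2 - 1)" using M2 by (auto simp: \<delta>_def)
  define lev where "lev = (\<lambda>i. \<delta> * (2 * real i - 1 - real M))"
  define p where "p = measure (std_gaussian :: real measure) {\<delta> / \<kappa><..}"
  have d: "\<delta> / \<kappa> > 0" using \<delta> \<kappa> by simp
  have S: "PAM M = (\<lambda>i. complex_of_real (lev i)) ` {1..M}"
    unfolding PAM_def amplitude_levels_eq \<delta>_def[symmetric] lev_def image_image ..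
  have inj: "inj_on (\<lambda>i. complex_of_real (lev i)) {1..M}"
    using inj_on_levels[OF \<delta>(1), of M] unfolding inj_on_def lev_def of_real_eq_iff .
  have closer: "(\<exists>k\<in>{1..M}. (lev k - lev i)\<^sup>2 < 2 * \<kappa> * (x * (lev k - lev i))) \<longleftrightarrow> x \<in> outer_set M (\<delta> / \<kappa>) i"
    if "i \<in> {1..M}" for i x
    unfolding lev_def by (rule closer_level_iff[OF \<delta>(1) \<kappa> that])
  have err: "measure std_gaussian {z. nearest_symbol (PAM M) (complex_of_real (lev i) + \<kappa> *\<^sub>R z) \<noteq> complex_of_real (lev i)} =
     p * (of_bool (i < M) + of_bool (1 < i))" if i: "i \<in> {1..M}" for i
  proof -
    have "measure std_gaussian {z. nearest_symbol (PAM M) (complex_of_real (lev i) + \<kappa> *\<^sub>R z) \<noteq> complex_of_real (lev i)} =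
      measure std_gaussian {z. \<exists>b\<in>PAM M. (cmod (b - complex_of_real (lev i)))\<^sup>2 < 2 * \<kappa> * (z \<bullet> (b - complex_of_real (lev i)))}"
      using i by (intro prob_nearest_symbol_neq finite_PAM \<kappa>) (auto simp: S)
    also have "{z. \<exists>b\<in>PAM M. (cmod (b - complex_of_real (lev i)))\<^sup>2 < 2 * \<kappa> * (z \<bullet> (b - complex_of_real (lev i)))} =
      {z. \<exists>k\<in>{1..M}. (lev k - lev i)\<^sup>2 < 2 * \<kappa> * (Re z * (lev k - lev i))}"
      unfolding S by (simp add: cmod_power2 inner_complex_def)
    also have "\<dots> = {z. Re z \<in> outer_set M (\<delta> / \<kappa>) i \<and> Im z \<in> UNIV}"
      unfolding closer[OF i] by simp
    also have "measure std_gaussian \<dots> =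
      measure std_gaussian (outer_set M (\<delta> / \<kappa>) i) * measure (std_gaussian :: real measure) UNIV"
      by (rule measure_std_gaussian_complex_Times) (simp_all add: sets_outer_set)
    also have "measure (std_gaussian :: real measure) UNIV = 1"
      using std_gaussian.prob_space[where 'a=real] by simp
    finally show ?thesis
      by (simp add: measure_outer_set[OF d] p_def)
  qed
  have card: "card (PAM M) = M" unfolding S by (subst card_image[OF inj]) simp
  have sum: "(\<Sum>a\<in>PAM M. g a) = (\<Sum>i\<in>{1..M}. g (complex_of_real (lev i)))" for g :: "complex \<Rightarrow> real"
    unfolding S by (subst sum.reindex[OF inj]) simp
  have "symbol_error (PAM M) \<kappa> = (\<Sum>i\<in>{1..M}. p * (of_bool (i < M) + of_bool (1 < i))) / real M"
    unfolding symbol_error_def sum card using sum.cong[OF refl err, of "{1..M}"] by simp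
  also have "\<dots> = p * (2 * (real M - 1)) / real M"
    unfolding sum_distrib_left[symmetric] sum_outer using M by (simp add: of_nat_diff)
  also have "p = 1 / pi * craig 0 (pi / 2) (3 / ((real M)\<^sup>2 - 1) / (2 * \<kappa>\<^sup>2))"
    unfolding p_def prob_Re_greater(2)[OF d] power_divide \<delta>(2) by (simp add: mult_ac)
  finally show ?thesis by (simp add: mult_ac)
qed

lemma craig_split:
  assumes "\<tau> \<ge> 0" "a \<le> b" "b \<le> c"
  shows "craig a b \<tau> + craig b c \<tau> = craig a c \<tau>"
  unfolding craig_def
  by (rule Henstock_Kurzweil_Integration.integral_combine[OF assms(2,3)])
    (rule integrable_on_bounded_borel(2)[OF craig_integrand[OF assms(1)]])

lemma QAM_eq:
  fixes q :: nat
  assumes M: "M = q\<^sup>2" and \<delta>: "\<delta> = sqrt (3 / (2 * (real M - 1)))"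
  defines "lev \<equiv> \<lambda>i. \<delta> * (2 * real i - 1 - real q)"
  shows "QAM M = (\<lambda>(i, j). Complex (lev i) (lev j)) ` ({1..q} \<times> {1..q})"
proof -
  have "sqrt (real M) = real q" by (simp add: M)
  then show ?thesis
    unfolding QAM_def Let_def \<delta>[symmetric] by (auto simp: amplitude_levels_eq lev_def)
qed

lemma finite_QAM: "M = q\<^sup>2 \<Longrightarrow> finite (QAM M)"
  by (subst QAM_eq) auto

text \<open>A decision is correct exactly if it is correct on both axes, and the axes carry
  independent noise. The average of 1 - c_i c_j is therefore 1 minus the square of the average of c,
  a quadratic in the tail probability \<open>p\<close>; its square term is the reason for the second
  angular range.\<close>

lemma symbol_error_QAM:
  assumes q: "q \<ge> 2" and M: "M = q\<^sup>2" and \<kappa>: "\<kappa> > 0"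
  shows "symbol_error (QAM M) \<kappa> =
    4 * (sqrt (real M) - 1) / (sqrt (real M) * pi) * craig (pi / 4) (pi / 2) (3 / (2 * (real M - 1)) / (2 * \<kappa>\<^sup>2)) +
    4 * (sqrt (real M) - 1) / (real M * pi) * craig 0 (pi / 4) (3 / (2 * (real M - 1)) / (2 * \<kappa>\<^sup>2))"
proof -
  define \<delta> where "\<delta> = sqrt (3 / (2 * (real M - 1)))"
  have q2: "(real q)\<^sup>2 > 1" using q by (simp add: one_less_power)
  have \<delta>: "\<delta> > 0" "\<delta>\<^sup>2 = 3 / (2 * (real M - 1))" using q2 by (auto simp: \<delta>_def M)
  define lev where "lev = (\<lambda>i. \<delta> * (2 * real i - 1 - real q))"
  define p where "p = measure (std_gaussian :: real measure) {\<delta> / \<kappa><..}"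
  have d: "\<delta> / \<kappa> > 0" using \<delta> \<kappa> by simp
  \<comment> \<open>The probability that level \<open>i\<close> is decided correctly on one
    axis.\<close>
  define c where "c = (\<lambda>i. 1 - p * (of_bool (i < q) + of_bool (1 < i)))"
  let ?s = "\<lambda>(i, j). Complex (lev i) (lev j)"
  have S: "QAM M = ?s ` ({1..q} \<times> {1..q})"
    unfolding lev_def by (rule QAM_eq[OF M \<delta>_def])
  have inj: "inj_on ?s ({1..q} \<times> {1..q})"
    using inj_on_levels[OF \<delta>(1), of q] by (auto simp: inj_on_def lev_def)
  have closer: "(\<exists>k\<in>{1..q}. (lev k - lev i)\<^sup>2 < 2 * \<kappa> * (x * (lev k - lev i))) \<longleftrightarrow> x \<in> outer_set q (\<delta> / \<kappa>) i"
    if "i \<in> {1..q}" for i x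
    unfolding lev_def by (rule closer_level_iff[OF \<delta>(1) \<kappa> that])
  have err: "measure std_gaussian {z. nearest_symbol (QAM M) (Complex (lev i) (lev j) + \<kappa> *\<^sub>R z) \<noteq> Complex (lev i) (lev j)} =
     1 - c i * c j" if i: "i \<in> {1..q}" and j: "j \<in> {1..q}" for i j
  proof -
    let ?a = "Complex (lev i) (lev j)"
    let ?A = "- outer_set q (\<delta> / \<kappa>) i" and ?B = "- outer_set q (\<delta> / \<kappa>) j"
    have "measure std_gaussian {z. nearest_symbol (QAM M) (?a + \<kappa> *\<^sub>R z) \<noteq> ?a} =
      measure std_gaussian {z. \<exists>b\<in>QAM M. (cmod (b - ?a))\<^sup>2 < 2 * \<kappa> * (z \<bullet> (b - ?a))}"
      using i j by (intro prob_nearest_symbol_neq finite_QAM[OF M] \<kappa>) (auto simp: S)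
    also have "{z. \<exists>b\<in>QAM M. (cmod (b - ?a))\<^sup>2 < 2 * \<kappa> * (z \<bullet> (b - ?a))} =
      {z. \<exists>k\<in>{1..q}. \<exists>l\<in>{1..q}. (lev k - lev i)\<^sup>2 + (lev l - lev j)\<^sup>2 <
         2 * \<kappa> * (Re z * (lev k - lev i)) + 2 * \<kappa> * (Im z * (lev l - lev j))}"
      unfolding S by (simp add: cmod_power2 inner_complex_def distrib_left)
    \<comment> \<open>Squared distances add over the axes. If the sum favours (k, l), one of its
      summands favours k or l; conversely, changing a single coordinate keeps the other summand at
      0.\<close>
    also have "\<dots> = {z. (\<exists>k\<in>{1..q}. (lev k - lev i)\<^sup>2 < 2 * \<kappa> * (Re z * (lev k - lev i))) \<or>
       (\<exists>l\<in>{1..q}. (lev l - lev j)\<^sup>2 < 2 * \<kappa> * (Im z * (lev l - lev j)))}"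
      (is "{z. ?L z} = {z. ?R z}")
    proof (rule Collect_cong, rule iffI)
      fix z assume "?L z"
      then obtain k l where kl: "k \<in> {1..q}" "l \<in> {1..q}" "(lev k - lev i)\<^sup>2 + (lev l - lev j)\<^sup>2 <
         2 * \<kappa> * (Re z * (lev k - lev i)) + 2 * \<kappa> * (Im z * (lev l - lev j))" by blast
      then have "(lev k - lev i)\<^sup>2 < 2 * \<kappa> * (Re z * (lev k - lev i)) \<or>
        (lev l - lev j)\<^sup>2 < 2 * \<kappa> * (Im z * (lev l - lev j))" by linarith
      then show "?R z" using kl(1,2) by blast
    next
      fix z assume "?R z"
      then show "?L z"
      proof
        assume "\<exists>k\<in>{1..q}. (lev k - lev i)\<^sup>2 < 2 * \<kappa> * (Re z * (lev k - lev i))"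
        then obtain k where "k \<in> {1..q}" "(lev k - lev i)\<^sup>2 < 2 * \<kappa> * (Re z * (lev k - lev i))" by blast
        then show ?thesis using j by (intro bexI[of _ k] bexI[of _ j]) auto
      next
        assume "\<exists>l\<in>{1..q}. (lev l - lev j)\<^sup>2 < 2 * \<kappa> * (Im z * (lev l - lev j))"
        then obtain l where "l \<in> {1..q}" "(lev l - lev j)\<^sup>2 < 2 * \<kappa> * (Im z * (lev l - lev j))" by blast
        then show ?thesis using i by (intro bexI[of _ i] bexI[of _ l]) auto
      qed
    qed
    also have "\<dots> = - {z. Re z \<in> ?A \<and> Im z \<in> ?B}"
      unfolding closer[OF i] closer[OF j] by auto
    also have "measure std_gaussian \<dots> = 1 - measure std_gaussian {z. Re z \<in> ?A \<and> Im z \<in> ?B}"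
      using std_gaussian.prob_compl[of "{z. Re z \<in> ?A \<and> Im z \<in> ?B}"] by (simp add: Compl_eq_Diff_UNIV)
    also have "measure std_gaussian {z. Re z \<in> ?A \<and> Im z \<in> ?B} = measure std_gaussian ?A * measure std_gaussian ?B"
      by (rule measure_std_gaussian_complex_Times) (simp_all add: Compl_in_sets_lebesgue sets_outer_set borel_comp)
    also have "measure std_gaussian ?A = c i"
      using std_gaussian.prob_compl[of "outer_set q (\<delta> / \<kappa>) i"]
      by (simp add: Compl_eq_Diff_UNIV c_def p_def measure_outer_set[OF d])
    also have "measure std_gaussian ?B = c j"
      using std_gaussian.prob_compl[of "outer_set q (\<delta> / \<kappa>) j"]
      by (simp add: Compl_eq_Diff_UNIV c_def p_def measure_outer_set[OF d])
    finally show ?thesis .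
  qed
  have sum_c: "(\<Sum>i\<in>{1..q}. c i) = real q - 2 * (real q - 1) * p"
    unfolding c_def sum_subtractf sum_distrib_left[symmetric] sum_outer using q by (simp add: of_nat_diff)
  have "symbol_error (QAM M) \<kappa> = (\<Sum>(i, j)\<in>{1..q} \<times> {1..q}. 1 - c i * c j) / real (q * q)"
  proof -
    have card: "card (QAM M) = q * q" unfolding S by (subst card_image[OF inj]) simp
    have sum: "(\<Sum>a\<in>QAM M. g a) = (\<Sum>(i, j)\<in>{1..q} \<times> {1..q}. g (Complex (lev i) (lev j)))" for g :: "complex \<Rightarrow> real"
      unfolding S by (subst sum.reindex[OF inj]) (simp add: case_prod_unfold)
    have "(\<Sum>(i, j)\<in>{1..q} \<times> {1..q}. measure std_gaussian
        {z. nearest_symbol (QAM M) (Complex (lev i) (lev j) + \<kappa> *\<^sub>R z) \<noteq> Complex (lev i) (lev j)}) =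
      (\<Sum>(i, j)\<in>{1..q} \<times> {1..q}. 1 - c i * c j)"
      by (rule sum.cong) (auto simp only: err mem_Sigma_iff split: prod.splits)
    then show ?thesis unfolding symbol_error_def sum card by simp
  qed
  also have "(\<Sum>(i, j)\<in>{1..q} \<times> {1..q}. 1 - c i * c j) = (\<Sum>i\<in>{1..q}. \<Sum>j\<in>{1..q}. 1 - c i * c j)"
    by (rule sum.cartesian_product[symmetric])
  also have "\<dots> = (real q)\<^sup>2 - (\<Sum>i\<in>{1..q}. c i)\<^sup>2"
    by (simp add: sum_subtractf sum_distrib_left[symmetric] sum_distrib_right[symmetric] power2_eq_square)
  \<comment> \<open>Grouped by p - p^2 and p^2, whose Craig integrals run over [\<pi>/4, \<pi>/2]
    and [0, \<pi>/4].\<close>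
  also have "(real q)\<^sup>2 - (\<Sum>i\<in>{1..q}. c i)\<^sup>2 = 4 * (real q - 1) * (real q * (p - p\<^sup>2) + p\<^sup>2)"
    unfolding sum_c by (simp add: power2_eq_square algebra_simps)
  finally have e: "symbol_error (QAM M) \<kappa> = 4 * (real q - 1) * (real q * (p - p\<^sup>2) + p\<^sup>2) / (real q * real q)" by simp
  define \<tau> where "\<tau> = 3 / (2 * (real M - 1)) / (2 * \<kappa>\<^sup>2)"
  have \<tau>: "(\<delta> / \<kappa>)\<^sup>2 / 2 = \<tau>" "\<tau> \<ge> 0" unfolding power_divide \<delta>(2) using q2 by (auto simp: \<tau>_def M)
  have p1: "p = 1 / pi * craig 0 (pi / 2) \<tau>"
    unfolding p_def prob_Re_greater(2)[OF d] \<tau> ..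
  have p2: "p\<^sup>2 = 1 / pi * craig 0 (pi / 4) \<tau>"
    unfolding p_def prob_real_greater_square[OF d] \<tau> ..
  have p3: "p - p\<^sup>2 = 1 / pi * craig (pi / 4) (pi / 2) \<tau>"
    unfolding p2 unfolding p1 using craig_split[OF \<tau>(2), of 0 "pi / 4" "pi / 2"] by (simp add: field_simps)
  have "sqrt (real M) = real q" "real M = real q * real q" by (simp_all add: M power2_eq_square)
  then show ?thesis
    unfolding e p3 unfolding p2 \<tau>_def[symmetric] using q by (simp add: field_simps)
qed

section \<open>Phase shift keying\<close>

lemma finite_PSK: "finite (PSK M)"
  by (simp add: PSK_def)

text \<open>Rotations permute the constellation and preserve the noise, so the sent symbol may be
  taken to be 1. Its error region is a union of two half planes, one per neighbour, and the real
  axis divides it into two congruent sectors of the kind treated by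
  \<open>prob_sector\<close>.\<close>

lemma symbol_error_PSK:
  assumes M: "M \<ge> 2" and \<kappa>: "\<kappa> > 0"
  shows "symbol_error (PSK M) \<kappa> =
    1 / pi * craig 0 ((real M - 1) * pi / real M) ((sin (pi / real M))\<^sup>2 / (2 * \<kappa>\<^sup>2))"
proof -
  define \<alpha> where "\<alpha> = pi / real M"
  have \<alpha>: "0 < \<alpha>" "\<alpha> \<le> pi / 2" using M by (auto simp: \<alpha>_def field_simps)
  have s\<alpha>: "sin \<alpha> > 0" using \<alpha> by (intro sin_gt_zero) auto
  have c\<alpha>: "cos \<alpha> \<ge> 0" using \<alpha> by (intro cos_ge_zero) auto
  define pt where "pt = (\<lambda>i::nat. cis (2 * pi * real i / real M))"
  have S: "PSK M = pt ` {0..<M}" by (simp add: PSK_def pt_def)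
  have pt_eq: "pt i = cis (2 * (real i * \<alpha>))" for i by (simp add: pt_def \<alpha>_def mult_ac)
  have pt_M: "pt (i + M) = pt i" for i
  proof -
    have "2 * (real (i + M) * \<alpha>) = 2 * (real i * \<alpha>) + 2 * pi" using M by (simp add: \<alpha>_def field_simps)
    then show ?thesis unfolding pt_eq by (simp add: cis_mult[symmetric])
  qed
  have pt_mod: "pt (i mod M) = pt i" for i
  proof -
    have "pt (j + k * M) = pt j" for j k
    proof (induction k)
      case (Suc k)
      then show ?case using pt_M[of "j + k * M"] by (simp add: algebra_simps)
    qed simp
    from this[of "i mod M" "i div M"] show ?thesis by (simp add: mult.commute)
  qed
  have pt_in: "pt i \<in> PSK M" for i
    unfolding S using M by (subst pt_mod[symmetric]) auto
  have pt_add: "pt (i + j) = pt i * pt j" for i j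
    by (simp add: pt_eq cis_mult distrib_left distrib_right)
  have pt_norm: "cmod (pt i) = 1" for i by (simp add: pt_def)
  \<comment> \<open>The symbol at angle 2 a is closer than 1 exactly if v a z > 0: both sides of the
    distance comparison contain the positive factor 4 sin a, which is divided out.\<close>
  define v where "v a z = \<kappa> * (Im z * cos a - Re z * sin a) - sin a" for a z
  define Err where "Err = {z. v \<alpha> z > 0 \<or> v (pi - \<alpha>) z > 0}"
  have closer_one: "(\<exists>b\<in>PSK M. (cmod (b - 1))\<^sup>2 < 2 * \<kappa> * (z \<bullet> (b - 1))) \<longleftrightarrow> z \<in> Err" for z
  proof -
    have iff: "(cmod (cis (2 * a) - 1))\<^sup>2 < 2 * \<kappa> * (z \<bullet> (cis (2 * a) - 1)) \<longleftrightarrow> v a z > 0"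
      if "0 < a" "a < pi" for a
    proof -
      have sa: "sin a > 0" using that by (rule sin_gt_zero)
      have re: "Re (cis (2 * a) - 1) = - 2 * sin a * sin a" "Im (cis (2 * a) - 1) = 2 * sin a * cos a"
        by (simp_all add: cos_double_sin sin_double power2_eq_square)
      have "(cmod (cis (2 * a) - 1))\<^sup>2 = 4 * sin a * sin a * ((sin a)\<^sup>2 + (cos a)\<^sup>2)"
        unfolding cmod_power2 re by algebra
      then have n: "(cmod (cis (2 * a) - 1))\<^sup>2 = (4 * sin a) * sin a" by simp
      have m: "2 * \<kappa> * (z \<bullet> (cis (2 * a) - 1)) = (4 * sin a) * (\<kappa> * (Im z * cos a - Re z * sin a))"
        unfolding inner_complex_def re by (simp add: algebra_simps)
      have "(4 * sin a) * sin a < (4 * sin a) * y \<longleftrightarrow> sin a < y" for y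
        by (rule mult_less_cancel_left_pos) (use sa in simp)
      then show ?thesis unfolding n m v_def by simp
    qed
    show ?thesis
    proof
      assume "\<exists>b\<in>PSK M. (cmod (b - 1))\<^sup>2 < 2 * \<kappa> * (z \<bullet> (b - 1))"
      then obtain i where i: "i < M" and less: "(cmod (pt i - 1))\<^sup>2 < 2 * \<kappa> * (z \<bullet> (pt i - 1))"
        unfolding S by auto
      have i0: "i \<noteq> 0" using less by (auto simp: pt_eq intro: ccontr)
      define a where "a = real i * \<alpha>"
      have a: "\<alpha> \<le> a" "a \<le> pi - \<alpha>"
      proof -
        show "\<alpha> \<le> a" using i0 \<alpha> by (simp add: a_def)
        have "real i * \<alpha> \<le> (real M - 1) * \<alpha>" using i \<alpha> by (intro mult_right_mono) auto
        also have "\<dots> = pi - \<alpha>" using M by (simp add: \<alpha>_def field_simps)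
        finally show "a \<le> pi - \<alpha>" by (simp add: a_def)
      qed
      have va: "v a z > 0" using less iff[of a] a \<alpha> unfolding pt_eq a_def[symmetric] by auto
      show "z \<in> Err"
      proof (rule ccontr)
        assume "z \<notin> Err"
        then have le: "v \<alpha> z \<le> 0" "v (pi - \<alpha>) z \<le> 0" by (auto simp: Err_def)
        \<comment> \<open>As a function of the angle, v is a combination of cosine and sine, so its
          value at \<open>a\<close> interpolates those at \<alpha> and \<pi> - \<alpha>. The weights
          are nonnegative for \<alpha> \<le> a \<le> \<pi> - \<alpha>; if any symbol is closer, then
          so is one of the two neighbours.\<close>
        have id: "v a z * sin (pi - 2 * \<alpha>) = v \<alpha> z * sin (pi - \<alpha> - a) + v (pi - \<alpha>) z * sin (a - \<alpha>)"
        proof -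
          have vb: "v b z = \<kappa> * Im z * cos b - (\<kappa> * Re z + 1) * sin b" for b by (simp add: v_def algebra_simps)
          have c: "cos a * sin (pi - 2 * \<alpha>) = cos \<alpha> * sin (pi - \<alpha> - a) + cos (pi - \<alpha>) * sin (a - \<alpha>)"
            "sin a * sin (pi - 2 * \<alpha>) = sin \<alpha> * sin (pi - \<alpha> - a) + sin (pi - \<alpha>) * sin (a - \<alpha>)"
          proof -
            have s1: "sin (pi - \<alpha> - a) = sin \<alpha> * cos a + cos \<alpha> * sin a"
              using sin_pi_minus[of "\<alpha> + a"] by (simp add: sin_add diff_diff_eq)
            have s2: "sin (a - \<alpha>) = sin a * cos \<alpha> - cos a * sin \<alpha>" by (rule sin_diff)
            have s3: "sin (pi - 2 * \<alpha>) = 2 * sin \<alpha> * cos \<alpha>"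
              by (simp add: sin_double)
            show "cos a * sin (pi - 2 * \<alpha>) = cos \<alpha> * sin (pi - \<alpha> - a) + cos (pi - \<alpha>) * sin (a - \<alpha>)"
              "sin a * sin (pi - 2 * \<alpha>) = sin \<alpha> * sin (pi - \<alpha> - a) + sin (pi - \<alpha>) * sin (a - \<alpha>)"
              unfolding s1 s2 s3 by (simp_all add: algebra_simps)
          qed
          show ?thesis unfolding vb using c by algebra
        qed
        show False
        \<comment> \<open>For M = 2 both neighbours coincide and the factor sin(\<pi> - 2 \<alpha>)
          of the interpolation vanishes.\<close>
        proof (cases "\<alpha> = pi / 2")
          case True
          then have "a = \<alpha>" using a by simp
          then show False using va le by simp
        next
          case False
          then have "sin (pi - 2 * \<alpha>) > 0" using \<alpha> by (intro sin_gt_zero) auto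
          moreover have "sin (pi - \<alpha> - a) \<ge> 0" "sin (a - \<alpha>) \<ge> 0" using a \<alpha> by (auto intro!: sin_ge_zero)
          then have "v \<alpha> z * sin (pi - \<alpha> - a) \<le> 0" "v (pi - \<alpha>) z * sin (a - \<alpha>) \<le> 0"
            using le by (auto intro: mult_nonpos_nonneg)
          moreover have "v a z * sin (pi - 2 * \<alpha>) > 0"
            using va \<open>sin (pi - 2 * \<alpha>) > 0\<close> by (rule mult_pos_pos)
          ultimately show False using id by linarith
        qed
      qed
    next
      assume "z \<in> Err"
      then consider "v \<alpha> z > 0" | "v (pi - \<alpha>) z > 0" by (auto simp: Err_def)
      then show "\<exists>b\<in>PSK M. (cmod (b - 1))\<^sup>2 < 2 * \<kappa> * (z \<bullet> (b - 1))"
      proof cases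
        case 1
        then have "(cmod (pt 1 - 1))\<^sup>2 < 2 * \<kappa> * (z \<bullet> (pt 1 - 1))"
          using iff[of \<alpha>] \<alpha> unfolding pt_eq by simp
        then show ?thesis using pt_in[of 1] by blast
      next
        case 2
        have "real (M - 1) * \<alpha> = pi - \<alpha>" using M by (simp add: \<alpha>_def field_simps of_nat_diff)
        then have "pt (M - 1) = cis (2 * (pi - \<alpha>))" unfolding pt_eq by (simp only:)
        then have "(cmod (pt (M - 1) - 1))\<^sup>2 < 2 * \<kappa> * (z \<bullet> (pt (M - 1) - 1))"
          using iff[of "pi - \<alpha>"] 2 \<alpha> by (simp only:)
        then show ?thesis using pt_in[of "M - 1"] by blast
      qed
    qed
  qed
  have Err_sets: "{z. z \<in> Err} \<in> sets borel"
    unfolding Err_def v_def mem_Collect_eq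
    by (intro borel_open open_Collect_disj open_Collect_less continuous_intros)
  have "measure std_gaussian {z. nearest_symbol (PSK M) (pt i + \<kappa> *\<^sub>R z) \<noteq> pt i} = measure std_gaussian Err"
    if i: "i < M" for i
  proof -
    let ?T = "\<lambda>z. cnj (pt i) * z"
    have T: "orthogonal_transformation ?T"
      by (rule orthogonal_transformation_cmult) (simp add: pt_norm)
    have inner: "z \<bullet> (pt i * w) = ?T z \<bullet> w" for z w
      by (simp add: inner_complex_def algebra_simps)
    have "(\<exists>b\<in>PSK M. (cmod (b - pt i))\<^sup>2 < 2 * \<kappa> * (z \<bullet> (b - pt i))) \<longleftrightarrow> ?T z \<in> Err" for z
    proof -
      have img: "(\<lambda>b. pt i * b) ` PSK M = PSK M"
      proof
        show "(\<lambda>b. pt i * b) ` PSK M \<subseteq> PSK M" using pt_in by (auto simp: S pt_add[symmetric])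
        show "PSK M \<subseteq> (\<lambda>b. pt i * b) ` PSK M"
        proof
          fix b assume "b \<in> PSK M"
          then obtain j where j: "b = pt j" by (auto simp: S)
          have "b = pt i * pt (j + (M - i))"
            using i pt_M[of j] by (simp add: j pt_add[symmetric])
          then show "b \<in> (\<lambda>b. pt i * b) ` PSK M" using pt_in by blast
        qed
      qed
      have rot: "(\<exists>b\<in>PSK M. Q b) \<longleftrightarrow> (\<exists>b\<in>PSK M. Q (pt i * b))" for Q :: "complex \<Rightarrow> bool"
      proof -
        have "(\<exists>b\<in>(\<lambda>b. pt i * b) ` PSK M. Q b) \<longleftrightarrow> (\<exists>b\<in>PSK M. Q (pt i * b))" by blast
        then show ?thesis unfolding img .
      qed
      have "(\<exists>b\<in>PSK M. (cmod (b - pt i))\<^sup>2 < 2 * \<kappa> * (z \<bullet> (b - pt i))) \<longleftrightarrow>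
        (\<exists>b\<in>PSK M. (cmod (pt i * b - pt i))\<^sup>2 < 2 * \<kappa> * (z \<bullet> (pt i * b - pt i)))"
        by (rule rot)
      also have "\<dots> \<longleftrightarrow> (\<exists>b\<in>PSK M. (cmod (b - 1))\<^sup>2 < 2 * \<kappa> * (?T z \<bullet> (b - 1)))"
      proof -
        have "pt i * b - pt i = pt i * (b - 1)" for b by (simp add: algebra_simps)
        then show ?thesis by (simp only: inner norm_mult pt_norm mult_1)
      qed
      finally show ?thesis by (simp only: closer_one)
    qed
    then have "measure std_gaussian {z. nearest_symbol (PSK M) (pt i + \<kappa> *\<^sub>R z) \<noteq> pt i} =
      measure std_gaussian {z. ?T z \<in> Err}"
      by (subst prob_nearest_symbol_neq[OF finite_PSK pt_in \<kappa>]) simp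
    also have "\<dots> = measure std_gaussian {z. z \<in> Err}"
      by (rule measure_std_gaussian_orthogonal[OF T Err_sets])
    finally show ?thesis by simp
  qed
  then have "symbol_error (PSK M) \<kappa> = (\<Sum>a\<in>PSK M. measure std_gaussian Err) / real (card (PSK M))"
    unfolding symbol_error_def by (intro arg_cong2[where f="(/)"] sum.cong refl) (auto simp: S)
  also have "\<dots> = measure std_gaussian Err"
    using finite_PSK[of M] pt_in[of 0] by (auto simp: card_eq_0_iff)
  also have "measure std_gaussian Err = 2 * measure std_gaussian {z. Im z > 0 \<and> v \<alpha> z > 0}"
  proof -
    have sets: "{z. Im z > 0 \<and> v \<alpha> z > 0} \<in> sets borel" "{z. Im z < 0 \<and> v (pi - \<alpha>) z > 0} \<in> sets borel"
      unfolding v_def by (intro borel_open open_Collect_conj open_Collect_less continuous_intros)+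
    have "AE z in std_gaussian. z \<bullet> \<i> \<noteq> 0" by (rule AE_std_gaussian_hyperplane) simp
    \<comment> \<open>Since cos \<alpha> \<ge> 0, the condition at \<alpha> is the weaker of the two
      above the real axis, and the one at \<pi> - \<alpha> below it.\<close>
    then have "AE z in std_gaussian. z \<in> Err \<longleftrightarrow> (Im z > 0 \<and> v \<alpha> z > 0) \<or> (Im z < 0 \<and> v (pi - \<alpha>) z > 0)"
    proof eventually_elim
      fix z assume "z \<bullet> \<i> \<noteq> 0"
      then have "Im z \<noteq> 0" by (simp add: inner_complex_def)
      moreover have "v \<alpha> z > 0" if "v (pi - \<alpha>) z > 0" "Im z > 0"
      proof -
        have "\<kappa> * (Im z * cos \<alpha>) \<ge> 0" using that c\<alpha> \<kappa> by simp
        then show ?thesis using that by (simp add: v_def algebra_simps)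
      qed
      moreover have "v (pi - \<alpha>) z > 0" if "v \<alpha> z > 0" "Im z < 0"
      proof -
        have "\<kappa> * (Im z * cos \<alpha>) \<le> 0" using that c\<alpha> \<kappa> by (intro mult_nonneg_nonpos mult_nonpos_nonneg) auto
        then show ?thesis using that by (simp add: v_def algebra_simps)
      qed
      ultimately show "z \<in> Err \<longleftrightarrow> (Im z > 0 \<and> v \<alpha> z > 0) \<or> (Im z < 0 \<and> v (pi - \<alpha>) z > 0)"
        unfolding Err_def by (auto simp: neq_iff)
    qed
    then have "measure std_gaussian {z. z \<in> Err} =
       measure std_gaussian {z. (Im z > 0 \<and> v \<alpha> z > 0) \<or> (Im z < 0 \<and> v (pi - \<alpha>) z > 0)}"
      by (rule measure_std_gaussian_cong_AE) (use sets Err_sets in \<open>auto simp: Collect_disj_eq\<close>)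
    also have "\<dots> = measure std_gaussian {z. Im z > 0 \<and> v \<alpha> z > 0} + measure std_gaussian {z. Im z < 0 \<and> v (pi - \<alpha>) z > 0}"
      unfolding Collect_disj_eq using sets by (intro std_gaussian.finite_measure_Union) auto
    also have "measure std_gaussian {z. Im z < 0 \<and> v (pi - \<alpha>) z > 0} = measure std_gaussian {z. Im z > 0 \<and> v \<alpha> z > 0}"
      using measure_std_gaussian_orthogonal[OF orthogonal_transformation_cnj sets(1)] by (simp add: v_def algebra_simps)
    finally show ?thesis by simp
  qed
  also have "measure std_gaussian {z. Im z > 0 \<and> v \<alpha> z > 0} =
     measure std_gaussian {w. Re w > sin \<alpha> / \<kappa> \<and> Im w > - (cos \<alpha> / sin \<alpha>) * Re w}"
  proof -
    let ?R = "\<lambda>w. Re w > sin \<alpha> / \<kappa> \<and> Im w > - (cos \<alpha> / sin \<alpha>) * Re w"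
    \<comment> \<open>This motion takes the bisector towards the neighbour to the vertical line at
      sin \<alpha> / \<kappa>, and the real axis to the line of slope -cot \<alpha> through
      0.\<close>
    have T: "orthogonal_transformation (\<lambda>z. cnj (- \<i> * cis (- \<alpha>) * z))"
      unfolding orthogonal_transformation by (auto simp: linear_iff norm_mult algebra_simps)
    have R: "{w. ?R w} \<in> sets borel"
      by (intro borel_open open_Collect_conj open_Collect_less continuous_intros)
    have "?R (cnj (- \<i> * cis (- \<alpha>) * z)) \<longleftrightarrow> Im z > 0 \<and> v \<alpha> z > 0" for z
    proof -
      define w where "w = cnj (- \<i> * cis (- \<alpha>) * z)"
      have Re: "Re w = Im z * cos \<alpha> - Re z * sin \<alpha>" and Im: "Im w = Re z * cos \<alpha> + Im z * sin \<alpha>"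
        by (simp_all add: w_def algebra_simps)
      have "Re w > sin \<alpha> / \<kappa> \<longleftrightarrow> v \<alpha> z > 0"
        unfolding Re v_def using \<kappa> by (simp add: field_simps)
      moreover have "Im w > - (cos \<alpha> / sin \<alpha>) * Re w \<longleftrightarrow> Im z > 0"
      proof -
        have "Im w * sin \<alpha> + cos \<alpha> * Re w = Im z * ((sin \<alpha>)\<^sup>2 + (cos \<alpha>)\<^sup>2)"
          unfolding Re Im by algebra
        then have "Im w * sin \<alpha> + cos \<alpha> * Re w = Im z" by simp
        then show ?thesis using s\<alpha> by (auto simp: field_simps)
      qed
      ultimately have "?R w \<longleftrightarrow> Im z > 0 \<and> v \<alpha> z > 0" by blast
      then show ?thesis unfolding w_def .
    qed
    then show ?thesis using measure_std_gaussian_orthogonal[OF T R] by simp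
  qed
  also have "\<dots> = 1 / (2 * pi) * craig 0 (pi / 2 - arctan (- (cos \<alpha> / sin \<alpha>))) ((sin \<alpha> / \<kappa>)\<^sup>2 / 2)"
    unfolding craig_def using s\<alpha> \<kappa> by (intro prob_sector) simp
  \<comment> \<open>The cotangent is the tangent of \<pi>/2 - \<alpha>, so the upper limit becomes
    \<pi> - \<alpha>, that is (M - 1) \<pi> / M.\<close>
  also have "arctan (- (cos \<alpha> / sin \<alpha>)) = - (pi / 2 - \<alpha>)"
  proof -
    have "cos \<alpha> / sin \<alpha> = tan (pi / 2 - \<alpha>)" by (simp add: tan_def sin_diff cos_diff)
    then show ?thesis using \<alpha> by (simp add: arctan_minus arctan_tan)
  qed
  also have "pi / 2 - - (pi / 2 - \<alpha>) = (real M - 1) * pi / real M"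
    using M by (simp add: \<alpha>_def field_simps)
  also have "(sin \<alpha> / \<kappa>)\<^sup>2 / 2 = (sin (pi / real M))\<^sup>2 / (2 * \<kappa>\<^sup>2)"
    by (simp add: \<alpha>_def power_divide)
  finally show ?thesis by simp
qed

section \<open>Averaging over the channel and convexity\<close>

text \<open>\<open>B\<close> is no rectangle, so independence does not apply to it directly.
  Conditioning on the event for \<open>Y\<close> leaves the laws of \<open>X\<close> and
  \<open>Z\<close> and their independence unchanged; their joint law is then a product measure,
  which may be evaluated on \<open>B\<close>.\<close>

lemma indep_triple_cond:
  assumes P: "prob_space P" and ind: "indep_triple P X Y Z"
    and A: "A \<in> sets borel" and pos: "measure P (Y -` A \<inter> space P) > 0"
    and B: "B \<in> sets (borel \<Otimes>\<^sub>M borel)"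
  shows "measure P {\<omega> \<in> space P. Y \<omega> \<in> A \<and> (X \<omega>, Z \<omega>) \<in> B} =
    measure P (Y -` A \<inter> space P) * measure (distr P borel X \<Otimes>\<^sub>M distr P borel Z) B"
proof -
  interpret prob_space P by fact
  have X[measurable]: "X \<in> borel_measurable P" and Y[measurable]: "Y \<in> borel_measurable P" and Z[measurable]: "Z \<in> borel_measurable P"
    using ind unfolding indep_triple_def by auto
  let ?E = "[{X -` A \<inter> space P | A. A \<in> sets borel}, {Y -` A \<inter> space P | A. A \<in> sets borel}, {Z -` A \<inter> space P | A. A \<in> sets borel}]"
  have iset: "indep_sets (\<lambda>i::nat. ?E ! i) {0, 1, 2}"
    using ind unfolding indep_triple_def by blast
  let ?e = "Y -` A \<inter> space P"
  have e[measurable]: "?e \<in> events" using measurable_sets[OF Y A] .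
  have prod: "prob (X -` C \<inter> space P \<inter> ?e \<inter> (Z -` D \<inter> space P)) = prob (X -` C \<inter> space P) * prob ?e * prob (Z -` D \<inter> space P)"
    if "C \<in> sets borel" "D \<in> sets borel" for C D
  proof -
    define W where "W i = (if i = (0::nat) then X -` C \<inter> space P else if i = 1 then ?e else Z -` D \<inter> space P)" for i
    have "prob (\<Inter>i\<in>{0,1,2}. W i) = (\<Prod>i\<in>{0,1,2}. prob (W i))"
      by (rule indep_setsD[OF iset]) (use that A in \<open>auto simp: W_def\<close>)
    moreover have "(\<Inter>i\<in>{0,1,2}. W i) = X -` C \<inter> space P \<inter> ?e \<inter> (Z -` D \<inter> space P)"
      by (auto simp: W_def)
    moreover have "(\<Prod>i\<in>{0,1,2}. prob (W i)) = prob (X -` C \<inter> space P) * prob ?e * prob (Z -` D \<inter> space P)"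
      by (simp add: W_def)
    ultimately show ?thesis by simp
  qed
  define Q where "Q = uniform_measure P ?e"
  have e0: "emeasure P ?e \<noteq> 0" "emeasure P ?e \<noteq> \<infinity>" using pos by (auto simp: measure_def)
  interpret Q: prob_space Q unfolding Q_def by (rule prob_space_uniform_measure[OF e0])
  have sQ[measurable_cong]: "sets Q = sets P" by (simp add: Q_def)
  have mQ: "measure Q C = prob (?e \<inter> C) / prob ?e" if "C \<in> events" for C
    unfolding Q_def by (rule measure_uniform_measure[OF e0 that])
  have spQ: "space Q = space P" by (rule sets_eq_imp_space_eq[OF sQ])
  have lX: "distr Q borel X = distr P borel X"
  proof (rule measure_eqI)
    fix C assume "C \<in> sets (distr Q borel X)"
    then have C[measurable]: "C \<in> sets borel" by simp
    have "measure Q (X -` C \<inter> space P) = prob (X -` C \<inter> space P)"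
      using prod[OF C, of UNIV] pos by (subst mQ) (auto simp: Int_commute Int_assoc prob_space)
    then show "emeasure (distr Q borel X) C = emeasure (distr P borel X) C"
      by (simp add: emeasure_distr spQ Q.emeasure_eq_measure emeasure_eq_measure)
  qed simp
  have lZ: "distr Q borel Z = distr P borel Z"
  proof (rule measure_eqI)
    fix D assume "D \<in> sets (distr Q borel Z)"
    then have D[measurable]: "D \<in> sets borel" by simp
    have "measure Q (Z -` D \<inter> space P) = prob (Z -` D \<inter> space P)"
      using prod[OF _ D, of UNIV] pos by (subst mQ) (auto simp: Int_commute Int_assoc prob_space)
    then show "emeasure (distr Q borel Z) D = emeasure (distr P borel Z) D"
      by (simp add: emeasure_distr spQ Q.emeasure_eq_measure emeasure_eq_measure)
  qed simp
  interpret DX: prob_space "distr P borel X" by (rule prob_space_distr) simp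
  interpret DZ: prob_space "distr P borel Z" by (rule prob_space_distr) simp
  have joint: "distr P borel X \<Otimes>\<^sub>M distr P borel Z = distr Q (borel \<Otimes>\<^sub>M borel) (\<lambda>\<omega>. (X \<omega>, Z \<omega>))"
  proof (rule pair_measure_eqI)
    show "sigma_finite_measure (distr P borel X)" "sigma_finite_measure (distr P borel Z)" ..
    show "sets (distr P borel X \<Otimes>\<^sub>M distr P borel Z) = sets (distr Q (borel \<Otimes>\<^sub>M borel) (\<lambda>\<omega>. (X \<omega>, Z \<omega>)))"
      by (simp cong: sets_pair_measure_cong)
    fix C D assume "C \<in> sets (distr P borel X)" "D \<in> sets (distr P borel Z)"
    then have [measurable]: "C \<in> sets borel" "D \<in> sets borel" by auto
    have "measure Q ((X -` C \<inter> space P) \<inter> (Z -` D \<inter> space P)) = prob (X -` C \<inter> space P) * prob (Z -` D \<inter> space P)"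
      using prod[of C D] pos by (subst mQ) (auto simp: Int_commute Int_left_commute Int_assoc)
    moreover have "(\<lambda>\<omega>. (X \<omega>, Z \<omega>)) -` (C \<times> D) \<inter> space Q = (X -` C \<inter> space P) \<inter> (Z -` D \<inter> space P)"
      by (auto simp: spQ)
    ultimately show "emeasure (distr P borel X) C * emeasure (distr P borel Z) D =
      emeasure (distr Q (borel \<Otimes>\<^sub>M borel) (\<lambda>\<omega>. (X \<omega>, Z \<omega>))) (C \<times> D)"
      by (simp add: emeasure_distr emeasure_eq_measure Q.emeasure_eq_measure ennreal_mult)
  qed
  have XZ: "(\<lambda>\<omega>. (X \<omega>, Z \<omega>)) \<in> P \<rightarrow>\<^sub>M (borel \<Otimes>\<^sub>M borel)" by measurable
  have S: "{\<omega> \<in> space P. (X \<omega>, Z \<omega>) \<in> B} \<in> events"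
    using measurable_sets[OF XZ B] by (simp add: vimage_def Int_def conj_commute)
  have "measure (distr P borel X \<Otimes>\<^sub>M distr P borel Z) B = measure Q {\<omega> \<in> space P. (X \<omega>, Z \<omega>) \<in> B}"
    unfolding joint using B XZ by (subst measure_distr) (auto simp: spQ vimage_def Int_def conj_commute cong: measurable_cong_sets)
  also have "\<dots> = prob (?e \<inter> {\<omega> \<in> space P. (X \<omega>, Z \<omega>) \<in> B}) / prob ?e" by (rule mQ[OF S])
  also have "?e \<inter> {\<omega> \<in> space P. (X \<omega>, Z \<omega>) \<in> B} = {\<omega> \<in> space P. Y \<omega> \<in> A \<and> (X \<omega>, Z \<omega>) \<in> B}" by auto
  finally show ?thesis using pos by simp
qed

lemma measure_pair_integral:
  assumes "prob_space M" "prob_space N" and B: "B \<in> sets (M \<Otimes>\<^sub>M N)"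
  shows "measure (M \<Otimes>\<^sub>M N) B = (\<integral>x. measure N (Pair x -` B) \<partial>M)"
    "(\<lambda>x. measure N (Pair x -` B)) \<in> borel_measurable M"
proof -
  interpret M: prob_space M by fact
  interpret N: prob_space N by fact
  have [measurable]: "(\<lambda>x. emeasure N (Pair x -` B)) \<in> borel_measurable M"
    using B by (rule N.measurable_emeasure_Pair)
  then show m[measurable]: "(\<lambda>x. measure N (Pair x -` B)) \<in> borel_measurable M"
    unfolding measure_def by measurable
  have "emeasure (M \<Otimes>\<^sub>M N) B = (\<integral>\<^sup>+x. emeasure N (Pair x -` B) \<partial>M)"
    using B by (rule N.emeasure_pair_measure_alt)
  also have "\<dots> = (\<integral>\<^sup>+x. ennreal (measure N (Pair x -` B)) \<partial>M)"
    by (simp add: N.emeasure_eq_measure)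
  finally have "measure (M \<Otimes>\<^sub>M N) B = enn2real (\<integral>\<^sup>+x. ennreal (measure N (Pair x -` B)) \<partial>M)"
    by (simp add: measure_def)
  also have "\<dots> = (\<integral>x. measure N (Pair x -` B) \<partial>M)"
    by (rule integral_eq_nn_integral[symmetric]) auto
  finally show "measure (M \<Otimes>\<^sub>M N) B = (\<integral>x. measure N (Pair x -` B) \<partial>M)" .
qed

lemma abs_power_le_one:
  fixes t :: real
  assumes "0 \<le> t" "t \<le> 1"
  shows "\<bar>t ^ n\<bar> \<le> 1"
  using assms by (simp add: power_le_one)

context correlated_channel
begin

lemma expectation_exp_pseudo_inv:
  assumes card: "CARD('n) \<le> CARD('r)" and c: "c \<ge> 0"
  shows "(\<integral>x. exp (- c / (norm (pseudo_inv (x ** F) $ k))\<^sup>2) \<partial>law) =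
    (1 / (1 + c / \<rho> k)) ^ (CARD('r) - CARD('n) + 1)"
proof -
  note [measurable] = measurable_compose[OF borel_measurable_matrix_matrix_mult[of F] borel_measurable_pseudo_inv_nth[of k]]
  have "(\<integral>x. exp (- c / (norm (pseudo_inv (x ** F) $ k))\<^sup>2) \<partial>law) =
     enn2real (\<integral>\<^sup>+x. ennreal (exp (- c / (norm (pseudo_inv (x ** F) $ k))\<^sup>2)) \<partial>law)"
    by (rule integral_eq_nn_integral) auto
  then show ?thesis
    unfolding nn_integral_exp_pseudo_inv[OF card c] using c rho_pos[of k] by simp
qed

text \<open>Fubini on channel times angle, the integrand being bounded by 1 on a set of finite
  measure. At a fixed angle sin^2 \<theta> only rescales the constant \<open>c\<close> of the
  Laplace transform; where the sine vanishes both sides are 1 by the convention for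
  division.\<close>

lemma expectation_craig:
  assumes card: "CARD('n) \<le> CARD('r)" and c: "c \<ge> 0"
  shows "integrable law (\<lambda>x. craig a b (c / (norm (pseudo_inv (x ** F) $ k))\<^sup>2))"
    and "(\<integral>x. craig a b (c / (norm (pseudo_inv (x ** F) $ k))\<^sup>2) \<partial>law) =
      integral {a..b} (\<lambda>\<theta>. (1 / (1 + c / (\<rho> k * (sin \<theta>)\<^sup>2))) ^ (CARD('r) - CARD('n) + 1))"
proof -
  interpret law: prob_space law by (rule prob_space_law)
  interpret pair: pair_sigma_finite law "lborel :: real measure" ..
  note [measurable] = measurable_compose[OF borel_measurable_matrix_matrix_mult[of F] borel_measurable_pseudo_inv_nth[of k]]
  have [measurable]: "(sin :: real \<Rightarrow> real) \<in> borel_measurable borel"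
    by (intro borel_measurable_continuous_onI continuous_intros)
  let ?t = "\<lambda>x. c / (norm (pseudo_inv (x ** F) $ k))\<^sup>2"
  have t: "?t x \<ge> 0" for x using c by simp
  let ?f = "\<lambda>x \<theta>. exp (- ?t x / (sin \<theta>)\<^sup>2) * indicator {a..b} \<theta> :: real"
  have craig: "craig a b (?t x) = (\<integral>\<theta>. ?f x \<theta> \<partial>lborel)" for x
    unfolding craig_def by (rule integrable_on_bounded_borel(3)[OF craig_integrand[OF t], symmetric])
  have "\<bar>u * indicator {a..b} \<theta>\<bar> \<le> 1" if "\<bar>u\<bar> \<le> 1" for u \<theta> :: real
    using that by (simp add: indicator_def)
  then have bound: "\<bar>?f x \<theta>\<bar> \<le> 1" for x \<theta>
    using craig_integrand(2)[OF t] by blast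
  have int: "integrable (law \<Otimes>\<^sub>M lborel) (\<lambda>(x, \<theta>). ?f x \<theta>)"
  proof (rule integrableI_bounded_set[where A="space law \<times> {a..b}" and B=1])
    show "space law \<times> {a..b} \<in> sets (law \<Otimes>\<^sub>M lborel)" by (intro pair_measureI) auto
    show "(\<lambda>(x, \<theta>). ?f x \<theta>) \<in> borel_measurable (law \<Otimes>\<^sub>M lborel)" by measurable
    show "emeasure (law \<Otimes>\<^sub>M lborel) (space law \<times> {a..b}) < \<infinity>"
      by (subst lborel.emeasure_pair_measure_Times) (auto simp: law.emeasure_space_1[simplified] emeasure_lborel_Icc_eq)
    show "AE x in law \<Otimes>\<^sub>M lborel. x \<in> space law \<times> {a..b} \<longrightarrow> norm (case x of (x, \<theta>) \<Rightarrow> ?f x \<theta>) \<le> 1"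
      by (intro AE_I2 impI) (simp only: case_prod_unfold real_norm_def bound)
    show "AE x in law \<Otimes>\<^sub>M lborel. x \<notin> space law \<times> {a..b} \<longrightarrow> (case x of (x, \<theta>) \<Rightarrow> ?f x \<theta>) = 0"
      by (intro AE_I2) (auto simp: space_pair_measure indicator_def split: if_splits)
  qed
  show "integrable law (\<lambda>x. craig a b (?t x))"
    unfolding craig using pair.integrable_fst'[OF int] by simp
  have "(\<integral>x. craig a b (?t x) \<partial>law) = (\<integral>\<theta>. (\<integral>x. ?f x \<theta> \<partial>law) \<partial>lborel)"
    unfolding craig by (rule pair.Fubini_integral[OF int, symmetric])
  also have "\<dots> = (\<integral>\<theta>. (1 / (1 + c / (\<rho> k * (sin \<theta>)\<^sup>2))) ^ (CARD('r) - CARD('n) + 1) * indicator {a..b} \<theta> \<partial>lborel)"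
  proof (rule Bochner_Integration.integral_cong[OF refl])
    fix \<theta> :: real
    have "(\<integral>x. ?f x \<theta> \<partial>law) = (\<integral>x. exp (- (c / (sin \<theta>)\<^sup>2) / (norm (pseudo_inv (x ** F) $ k))\<^sup>2) \<partial>law) * indicator {a..b} \<theta>"
      by (simp add: mult.commute)
    also have "\<dots> = (1 / (1 + c / (sin \<theta>)\<^sup>2 / \<rho> k)) ^ (CARD('r) - CARD('n) + 1) * indicator {a..b} \<theta>"
      using c by (subst expectation_exp_pseudo_inv[OF card]) auto
    finally show "(\<integral>x. ?f x \<theta> \<partial>law) = (1 / (1 + c / (\<rho> k * (sin \<theta>)\<^sup>2))) ^ (CARD('r) - CARD('n) + 1) * indicator {a..b} \<theta>"
      by (simp add: mult.commute)
  qed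
  also have "\<dots> = integral {a..b} (\<lambda>\<theta>. (1 / (1 + c / (\<rho> k * (sin \<theta>)\<^sup>2))) ^ (CARD('r) - CARD('n) + 1))"
  proof (rule integrable_on_bounded_borel(3)[where B=1])
    fix \<theta>
    have "0 \<le> c / (\<rho> k * (sin \<theta>)\<^sup>2)" using c rho_pos[of k] by simp
    then have "0 \<le> 1 / (1 + c / (\<rho> k * (sin \<theta>)\<^sup>2))" "1 / (1 + c / (\<rho> k * (sin \<theta>)\<^sup>2)) \<le> 1" by auto
    then show "\<bar>(1 / (1 + c / (\<rho> k * (sin \<theta>)\<^sup>2))) ^ (CARD('r) - CARD('n) + 1)\<bar> \<le> 1"
      by (rule abs_power_le_one)
  qed measurable
  finally show "(\<integral>x. craig a b (?t x) \<partial>law) =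
      integral {a..b} (\<lambda>\<theta>. (1 / (1 + c / (\<rho> k * (sin \<theta>)\<^sup>2))) ^ (CARD('r) - CARD('n) + 1))" .
qed

end

section \<open>Convexity in the diagonal entry\<close>

lemma has_real_derivative_power_inverse:
  fixes c x :: real
  assumes "x + c \<noteq> 0"
  shows "((\<lambda>x. x ^ Suc a * inverse (x + c) ^ Suc b) has_real_derivative
    real (Suc a) * x ^ a * inverse (x + c) ^ Suc b - real (Suc b) * x ^ Suc a * inverse (x + c) ^ Suc (Suc b)) (at x)"
proof -
  have "((\<lambda>x. x + c) has_real_derivative 1) (at x)" by (auto intro!: derivative_eq_intros)
  from DERIV_inverse_fun[OF this assms]
  have "((\<lambda>x. inverse (x + c)) has_real_derivative - (inverse (x + c) * inverse (x + c))) (at x)" by simp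
  from DERIV_mult[OF DERIV_pow[of "Suc a"] DERIV_power_Suc[OF this, of b]]
  show ?thesis by (rule DERIV_cong) (simp add: algebra_simps)
qed

lemma convex_on_ratio_power:
  fixes c :: real and N :: nat
  assumes c: "c > 0" and N: "N \<ge> 2" and T: "T \<le> (real N - 1) * c / 2"
  shows "convex_on {0<..<T} (\<lambda>x. (1 / (1 + c / x)) ^ N)"
proof -
  \<comment> \<open>N \<ge> 2 keeps the exponent N - 2 of the second derivative a natural
    number.\<close>
  obtain m where m: "N = Suc (Suc m)" by (rule that[of "N - 2"]) (use N in simp)
  have "convex_on {0<..<T} (\<lambda>x. x ^ N * inverse (x + c) ^ N)"
  proof (rule f''_ge0_imp_convex)
    show "convex {0<..<T}" by simp
    fix x assume x: "x \<in> {0<..<T}"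
    define w where "w = inverse (x + c)"
    have x0: "x > 0" "x + c > 0" using x c by auto
    \<comment> \<open>The identity 1 - x w = c w collapses the two terms of each derivative into
      one, so that the sign of the second derivative is that of (N - 1) c - 2 x.\<close>
    have w: "1 - x * w = c * w" "w > 0" using x0 by (simp_all add: w_def field_simps)
    have "real N * x ^ Suc m * w ^ N - real N * x ^ N * w ^ Suc N = real N * x ^ Suc m * w ^ N * (1 - x * w)"
      by (simp add: m algebra_simps)
    also have "\<dots> = real N * c * (x ^ Suc m * w ^ Suc N)" unfolding w by simp
    finally show "((\<lambda>x. x ^ N * inverse (x + c) ^ N) has_real_derivative
      real N * c * (x ^ Suc m * inverse (x + c) ^ Suc N)) (at x)"
      using has_real_derivative_power_inverse[of x c "Suc m" "Suc m"] x0 unfolding w_def m by simp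
    have "real (Suc m) * x ^ m * w ^ Suc N - real (Suc N) * x ^ Suc m * w ^ Suc (Suc N) =
      x ^ m * w ^ Suc N * (real (Suc m) * (1 - x * w) - 2 * (x * w))"
      by (simp add: m algebra_simps)
    also have "\<dots> = x ^ m * w ^ Suc (Suc N) * ((real N - 1) * c - 2 * x)"
      unfolding w by (simp add: m algebra_simps)
    finally have "((\<lambda>x. x ^ Suc m * inverse (x + c) ^ Suc N) has_real_derivative
      x ^ m * inverse (x + c) ^ Suc (Suc N) * ((real N - 1) * c - 2 * x)) (at x)"
      using has_real_derivative_power_inverse[of x c m N] x0 unfolding w_def by simp
    from DERIV_cmult[OF this, of "real N * c"]
    show "((\<lambda>x. real N * c * (x ^ Suc m * inverse (x + c) ^ Suc N)) has_real_derivative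
      real N * c * (x ^ m * inverse (x + c) ^ Suc (Suc N) * ((real N - 1) * c - 2 * x))) (at x)" .
    show "0 \<le> real N * c * (x ^ m * inverse (x + c) ^ Suc (Suc N) * ((real N - 1) * c - 2 * x))"
      using x0 x c T by (intro mult_nonneg_nonneg) auto
  qed
  note conv = this
  have eq: "(1 / (1 + c / x)) ^ N = x ^ N * inverse (x + c) ^ N" if "x > 0" for x
  proof -
    have "1 / (1 + c / x) = x * inverse (x + c)" using that c by (simp add: field_simps)
    then show ?thesis by (simp only: power_mult_distrib)
  qed
  show ?thesis
  proof (rule convex_onI)
    fix t x y :: real
    assume t: "0 < t" "t < 1" and x: "x \<in> {0<..<T}" and y: "y \<in> {0<..<T}"
    have "(1 - t) *\<^sub>R x + t *\<^sub>R y > 0" using t x y by (auto intro!: add_pos_pos)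
    then show "(1 / (1 + c / ((1 - t) *\<^sub>R x + t *\<^sub>R y))) ^ N \<le>
      (1 - t) * (1 / (1 + c / x)) ^ N + t * (1 / (1 + c / y)) ^ N"
      using convex_onD[OF conv, of t x y] t x y by (simp only: eq greaterThanLessThan_iff less_imp_le)
  qed simp
qed

text \<open>The integrand at angle \<theta> is the ratio power with constant c / sin^2 \<theta>
  \<ge> c, so one bound \<open>T\<close> serves all angles and the convexity inequality may be
  integrated.\<close>

lemma convex_on_craig_average:
  fixes c :: real and N :: nat
  assumes c: "c \<ge> 0" and N: "N \<ge> 2" and T: "T \<le> (real N - 1) * c / 2"
  shows "convex_on {0<..<T} (\<lambda>x. integral {a..b} (\<lambda>\<theta>. (1 / (1 + c / (x * (sin \<theta>)\<^sup>2))) ^ N))"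
proof (rule convex_onI)
  have [measurable]: "(sin :: real \<Rightarrow> real) \<in> borel_measurable borel"
    by (intro borel_measurable_continuous_onI continuous_intros)
  let ?f = "\<lambda>x \<theta>. (1 / (1 + c / (x * (sin \<theta>)\<^sup>2))) ^ N"
  have int: "?f x integrable_on {a..b}" if "x > 0" for x
  proof (rule integrable_on_bounded_borel(2)[where B=1])
    fix \<theta>
    have "0 \<le> c / (x * (sin \<theta>)\<^sup>2)" using c that by simp
    then have "0 \<le> 1 / (1 + c / (x * (sin \<theta>)\<^sup>2))" "1 / (1 + c / (x * (sin \<theta>)\<^sup>2)) \<le> 1" by auto
    then show "\<bar>?f x \<theta>\<bar> \<le> 1"
      by (rule abs_power_le_one)
  qed measurable
  have int_mult: "(\<lambda>\<theta>. r * ?f x \<theta>) integrable_on {a..b}" if "x > 0" for x r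
    using integrable_cmul[OF int[OF that], of r] by simp
  fix t x y :: real
  assume t: "0 < t" "t < 1" and x: "x \<in> {0<..<T}" and y: "y \<in> {0<..<T}"
  have z: "(1 - t) *\<^sub>R x + t *\<^sub>R y > 0" using t x y by (auto intro!: add_pos_pos)
  have conv: "?f ((1 - t) *\<^sub>R x + t *\<^sub>R y) \<theta> \<le> (1 - t) * ?f x \<theta> + t * ?f y \<theta>" for \<theta>
  \<comment> \<open>In the excluded case the integrand is 1 for all \<open>x\<close>.\<close>
  proof (cases "c = 0 \<or> sin \<theta> = 0")
    case True
    then show ?thesis by auto
  next
    case False
    then have s: "0 < (sin \<theta>)\<^sup>2" "(sin \<theta>)\<^sup>2 \<le> 1" and c0: "c > 0"
      using c by (auto simp: power_le_one_iff abs_square_le_1)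
    have "(real N - 1) * c / 2 \<le> (real N - 1) * (c / (sin \<theta>)\<^sup>2) / 2"
      using s c0 N by (intro divide_right_mono mult_left_mono) (auto simp: field_simps)
    then have T': "T \<le> (real N - 1) * (c / (sin \<theta>)\<^sup>2) / 2" using T by linarith
    have "convex_on {0<..<T} (\<lambda>x. (1 / (1 + (c / (sin \<theta>)\<^sup>2) / x)) ^ N)"
      by (rule convex_on_ratio_power[OF _ N T']) (use s c0 in simp)
    from convex_onD[OF this, of t x y] show ?thesis
      using t x y by (simp add: mult.commute)
  qed
  have "integral {a..b} (?f ((1 - t) *\<^sub>R x + t *\<^sub>R y)) \<le> integral {a..b} (\<lambda>\<theta>. (1 - t) * ?f x \<theta> + t * ?f y \<theta>)"
    using x y z by (intro integral_le int int_mult Henstock_Kurzweil_Integration.integrable_add conv) auto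
  also have "\<dots> = (1 - t) * integral {a..b} (?f x) + t * integral {a..b} (?f y)"
    using x y by (subst Henstock_Kurzweil_Integration.integral_add) (simp_all add: int_mult)
  finally show "integral {a..b} (?f ((1 - t) *\<^sub>R x + t *\<^sub>R y)) \<le>
    (1 - t) * integral {a..b} (?f x) + t * integral {a..b} (?f y)" .
qed simp

section \<open>The zero-forcing system\<close>

text \<open>The constellation is an arbitrary finite nonempty set, so that PAM, PSK and QAM share
  the reduction of the system to \<open>symbol_error\<close>.\<close>

locale zf_system = prob_space P
  for P :: "'a measure" +
  fixes H :: "'a \<Rightarrow> complex ^ 'n::finite ^ 'r::finite"
    and s :: "'a \<Rightarrow> complex ^ 'n"
    and \<xi> :: "'a \<Rightarrow> complex ^ 'r"
    and \<Sigma> F :: "complex ^ 'n ^ 'n"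
    and \<sigma> :: real
    and S :: "complex set"
  assumes card: "CARD('n) \<le> CARD('r)"
    and sigma: "\<sigma> \<noteq> 0"
    and Sigma: "hermitian_pos_def \<Sigma>"
    and F: "invertible F"
    and H_rows_indep: "indep_vars (\<lambda>_. borel) (\<lambda>m \<omega>. H \<omega> $ m) UNIV"
    and H_rows_gaussian: "\<And>m. gaussian_vector P (\<lambda>\<omega>. H \<omega> $ m)"
    and H_rows_circular: "\<And>m. circularly_symmetric P (\<lambda>\<omega>. H \<omega> $ m)"
    and H_rows_cov:
      "\<And>m. (\<chi> i j. integral\<^sup>L P (\<lambda>\<omega>. cnj (H \<omega> $ m $ i) * (H \<omega> $ m $ j))) = \<Sigma>"
    and xi_gaussian: "gaussian_vector P \<xi>"
    and xi_circular: "circularly_symmetric P \<xi>"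
    and xi_cov: "covariance_matrix P \<xi> = mat (complex_of_real (\<sigma>\<^sup>2))"
    and s_uniform: "\<And>k. distr P borel (\<lambda>\<omega>. s \<omega> $ k) = distr (measure_pmf (pmf_of_set S)) borel (\<lambda>a. a)"
    and H_s_xi_indep: "indep_triple P H s \<xi>"
    and S: "finite S" "S \<noteq> {}"
begin

lemma measurable_HsX [measurable]:
  "H \<in> borel_measurable P" "s \<in> borel_measurable P" "\<xi> \<in> borel_measurable P"
  using H_s_xi_indep unfolding indep_triple_def by blast+

text \<open>The row maps combine into a block-diagonal map \<open>M\<close> with row-wise adjoint.
  Covariances are inner products of adjoints, so they add up over the rows without cross
  terms.\<close>

lemma channel_law:
  obtains L where "distr P borel H = distr std_gaussian borel L" "correlated_channel L \<Sigma> F"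
proof -
  have "\<exists>L :: complex ^ 'n \<Rightarrow> complex ^ 'n. linear L \<and> distr P borel (\<lambda>\<omega>. H \<omega> $ m) = distr std_gaussian borel L \<and>
    (\<forall>a b. (\<integral>\<omega>. (H \<omega> $ m \<bullet> a) * (H \<omega> $ m \<bullet> b) \<partial>P) =
      Re (\<Sum>i\<in>UNIV. \<Sum>j\<in>UNIV. cnj (a $ i) * b $ j * \<Sigma> $ j $ i) / 2)" for m
  proof -
    obtain L :: "complex ^ 'n \<Rightarrow> complex ^ 'n" where L: "linear L"
        "distr P borel (\<lambda>\<omega>. H \<omega> $ m) = distr std_gaussian borel L"
      and cov: "\<And>a b. (\<integral>\<omega>. (H \<omega> $ m \<bullet> a) * (H \<omega> $ m \<bullet> b) \<partial>P) =
        Re (\<Sum>i\<in>UNIV. \<Sum>j\<in>UNIV. cnj (a $ i) * b $ j * (\<integral>\<omega>. H \<omega> $ m $ i * cnj (H \<omega> $ m $ j) \<partial>P)) / 2"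
      by (rule circular_gaussian[OF prob_space_axioms H_rows_gaussian[of m] H_rows_circular[of m]]) (rule that)
    \<comment> \<open>The conjugate has moved to the second factor, which transposes the indices of
      \<Sigma>.\<close>
    have "(\<integral>\<omega>. H \<omega> $ m $ i * cnj (H \<omega> $ m $ j) \<partial>P) = \<Sigma> $ j $ i" for i j
      unfolding H_rows_cov[of m, symmetric] by (simp add: mult.commute)
    then show ?thesis using L cov by auto
  qed
  then obtain L :: "'r \<Rightarrow> complex ^ 'n \<Rightarrow> complex ^ 'n" where L: "\<And>m. linear (L m)"
    and law: "\<And>m. distr P borel (\<lambda>\<omega>. H \<omega> $ m) = distr std_gaussian borel (L m)"
    and cov: "\<And>m a b. (\<integral>\<omega>. (H \<omega> $ m \<bullet> a) * (H \<omega> $ m \<bullet> b) \<partial>P) =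
      Re (\<Sum>i\<in>UNIV. \<Sum>j\<in>UNIV. cnj (a $ i) * b $ j * \<Sigma> $ j $ i) / 2"
    by metis
  define M where "M z = (\<chi> m. L m (z $ m))" for z
  have linM: "linear M"
    unfolding M_def by (rule linearI) (simp_all add: vec_eq_iff linear_add[OF L] linear_cmul[OF L])
  have H_law: "distr P borel H = distr std_gaussian borel M"
    unfolding M_def by (rule distr_indep_gaussian_rows(2)[OF H_rows_indep L law])
  have adjM: "adjoint M = (\<lambda>a. \<chi> m. adjoint (L m) (a $ m))"
  proof (rule adjoint_unique, intro allI)
    fix x y :: "complex ^ 'n ^ 'r"
    show "M x \<bullet> y = x \<bullet> (\<chi> m. adjoint (L m) (y $ m))"
      unfolding inner_vec_def[of "M x" y] inner_vec_def[of x "\<chi> m. adjoint (L m) (y $ m)"]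
      by (simp only: M_def vec_lambda_beta adjoint_works[OF L])
  qed
  note [measurable] = linear_borel_measurable[OF linM] linear_borel_measurable[OF L]
  have "(\<integral>x. (x \<bullet> a) * (x \<bullet> b) \<partial>distr std_gaussian borel M) =
      Re (\<Sum>m\<in>UNIV. \<Sum>i\<in>UNIV. \<Sum>j\<in>UNIV. cnj (a $ m $ i) * b $ m $ j * \<Sigma> $ j $ i) / 2" for a b
  proof -
    have row: "adjoint (L m) u \<bullet> adjoint (L m) v = Re (\<Sum>i\<in>UNIV. \<Sum>j\<in>UNIV. cnj (u $ i) * v $ j * \<Sigma> $ j $ i) / 2" for m u v
    proof -
      have "adjoint (L m) u \<bullet> adjoint (L m) v = (\<integral>z. (L m z \<bullet> u) * (L m z \<bullet> v) \<partial>std_gaussian)"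
        by (simp add: std_gaussian_inner_covariance flip: adjoint_works[OF L])
      also have "\<dots> = (\<integral>x. (x \<bullet> u) * (x \<bullet> v) \<partial>distr P borel (\<lambda>\<omega>. H \<omega> $ m))"
        unfolding law by (subst integral_distr) auto
      also have "\<dots> = (\<integral>\<omega>. (H \<omega> $ m \<bullet> u) * (H \<omega> $ m \<bullet> v) \<partial>P)"
        by (subst integral_distr) auto
      finally show ?thesis unfolding cov .
    qed
    have "(\<integral>x. (x \<bullet> a) * (x \<bullet> b) \<partial>distr std_gaussian borel M) = (\<integral>z. (M z \<bullet> a) * (M z \<bullet> b) \<partial>std_gaussian)"
      by (subst integral_distr) auto
    also have "\<dots> = adjoint M a \<bullet> adjoint M b"
      by (simp add: std_gaussian_inner_covariance flip: adjoint_works[OF linM])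
    also have "\<dots> = (\<Sum>m\<in>UNIV. adjoint (L m) (a $ m) \<bullet> adjoint (L m) (b $ m))"
      unfolding adjM by (simp add: inner_vec_def[of "\<chi> m. adjoint (L m) (a $ m)"])
    finally show ?thesis unfolding row by (simp only: Re_sum sum_divide_distrib)
  qed
  then have "correlated_channel M \<Sigma> F"
    by (intro correlated_channel.intro linM Sigma F)
  with H_law show ?thesis by (rule that)
qed

lemma noise_law:
  assumes w: "w \<noteq> 0"
  shows "distr (distr P borel \<xi>) borel (\<lambda>z. \<Sum>m\<in>UNIV. w $ m * z $ m) =
    distr std_gaussian borel (\<lambda>y::complex. (\<bar>\<sigma>\<bar> * norm w / sqrt 2) *\<^sub>R y)"
proof -
  obtain L :: "complex ^ 'r \<Rightarrow> complex ^ 'r" where L: "linear L" and law: "distr P borel \<xi> = distr std_gaussian borel L"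
    and cov: "\<And>a b. (\<integral>\<omega>. (\<xi> \<omega> \<bullet> a) * (\<xi> \<omega> \<bullet> b) \<partial>P) =
      Re (\<Sum>i\<in>UNIV. \<Sum>j\<in>UNIV. cnj (a $ i) * b $ j * (\<integral>\<omega>. \<xi> \<omega> $ i * cnj (\<xi> \<omega> $ j) \<partial>P)) / 2"
    by (rule circular_gaussian[OF prob_space_axioms xi_gaussian xi_circular]) (rule that)
  note [measurable] = linear_borel_measurable[OF L]
  \<comment> \<open>With mean zero, the entries of the covariance matrix are plain second
    moments.\<close>
  have "(\<integral>\<omega>. \<xi> \<omega> $ i \<partial>P) = 0" for i
  proof -
    have bl: "bounded_linear (\<lambda>z. L z $ i)"
      using bounded_linear_compose[OF bounded_linear_vec_nth[of i], of L] L by (simp add: linear_conv_bounded_linear)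
    have "(\<integral>\<omega>. \<xi> \<omega> $ i \<partial>P) = (\<integral>x. x $ i \<partial>distr P borel \<xi>)" by (subst integral_distr) auto
    also have "\<dots> = (\<integral>z. L z $ i \<partial>std_gaussian)" unfolding law by (subst integral_distr) auto
    also have "\<dots> = L (\<integral>z. z \<partial>std_gaussian) $ i"
      by (rule integral_bounded_linear[OF bl std_gaussian_mean(1)])
    finally show ?thesis by (simp add: std_gaussian_mean linear_0[OF L])
  qed
  then have C: "(\<integral>\<omega>. \<xi> \<omega> $ i * cnj (\<xi> \<omega> $ j) \<partial>P) = (if i = j then complex_of_real (\<sigma>\<^sup>2) else 0)" for i j
    using arg_cong[OF xi_cov, of "\<lambda>A. A $ i $ j"] by (simp add: covariance_matrix_def mat_def)
  \<comment> \<open>\<sigma> may be negative; the deviation is its absolute value.\<close>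
  have "(\<integral>x. (x \<bullet> a) * (x \<bullet> b) \<partial>distr std_gaussian borel L) =
      Re (\<Sum>i\<in>UNIV. \<Sum>j\<in>UNIV. cnj (a $ i) * b $ j * (if i = j then complex_of_real (\<bar>\<sigma>\<bar>\<^sup>2) else 0)) / 2" for a b
    unfolding law[symmetric] power2_abs C[symmetric] cov[symmetric] by (subst integral_distr) auto
  then show ?thesis unfolding law using sigma w by (intro distr_noise_projection L) auto
qed

lemma prob_symbol: "a \<in> S \<Longrightarrow> prob (s -` {v. v $ k = a} \<inter> space P) = 1 / real (card S)"
  and AE_symbol: "AE \<omega> in P. s \<omega> $ k \<in> S"
proof -
  have *: "prob {\<omega> \<in> space P. s \<omega> $ k \<in> A} = measure_pmf.prob (pmf_of_set S) A" if [measurable]: "A \<in> sets borel" for A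
  proof -
    have "prob {\<omega> \<in> space P. s \<omega> $ k \<in> A} = measure (distr P borel (\<lambda>\<omega>. s \<omega> $ k)) A"
      by (subst measure_distr) (auto simp: vimage_def Int_def conj_commute)
    also have "\<dots> = measure_pmf.prob (pmf_of_set S) A"
      unfolding s_uniform by (subst measure_distr) auto
    finally show ?thesis .
  qed
  have m: "(\<lambda>\<omega>. s \<omega> $ k) \<in> borel_measurable P" by measurable
  have "closed S" using S(1) by (rule finite_imp_closed)
  then have "prob {\<omega> \<in> space P. s \<omega> $ k \<in> S} = 1"
    using S by (subst *) (auto simp: measure_pmf_of_set)
  moreover have "{\<omega> \<in> space P. s \<omega> $ k \<in> S} \<in> events"
    using measurable_sets[OF m, of S] borel_closed[OF \<open>closed S\<close>]
    by (simp add: vimage_def Int_def conj_commute)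
  ultimately show "AE \<omega> in P. s \<omega> $ k \<in> S" by (simp add: prob_Collect_eq_1)
  assume "a \<in> S"
  then have "prob {\<omega> \<in> space P. s \<omega> $ k \<in> {a}} = 1 / real (card S)"
    using S by (subst *) (auto simp: measure_pmf_of_set)
  then show "prob (s -` {v. v $ k = a} \<inter> space P) = 1 / real (card S)"
    by (simp add: vimage_def Int_def conj_commute)
qed

text \<open>Conditionally on the channel \<open>x\<close> the detector sees symbol \<open>k\<close> through circular Gaussian noise
  whose deviation is proportional to the norm of the \<open>k\<close>-th row of the pseudo-inverse.\<close>

lemma prob_symbol_error:
  assumes law: "distr P borel H = distr std_gaussian borel L" and L: "correlated_channel L \<Sigma> F"
    and h: "h \<in> borel_measurable borel"
    and err: "\<And>x. pseudo_inv (x ** F) $ k \<noteq> 0 \<Longrightarrow> symbol_error S (\<bar>\<sigma>\<bar> * norm (pseudo_inv (x ** F) $ k) / sqrt 2) = h x"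
  shows "prob {\<omega> \<in> space P. zf_decision S (H \<omega>) F (received (H \<omega>) F (s \<omega>) (\<xi> \<omega>)) $ k \<noteq> s \<omega> $ k} =
    (\<integral>x. h x \<partial>distr std_gaussian borel L)"
proof -
  interpret correlated_channel L \<Sigma> F by fact
  interpret law: prob_space law by (rule prob_space_law)
  interpret noise: prob_space "distr P borel \<xi>" by (rule prob_space_distr) simp
  note [measurable] = measurable_nearest_symbol[OF S(1)]
  define w where "w x = pseudo_inv (x ** F) $ k" for x :: "complex ^ 'n ^ 'r"
  have w_meas: "w \<in> borel_measurable borel"
    unfolding w_def by (rule measurable_compose[OF borel_measurable_matrix_matrix_mult[of F] borel_measurable_pseudo_inv_nth[of k]])
  note [measurable] = w_meas
  \<comment> \<open>The pairs of channel and noise for which the sent value \<open>a\<close> is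
    misjudged. For an injective channel the pseudo-inverse returns the sent vector plus projected
    noise, so the other symbols do not occur.\<close>
  define B where "B a = {(x, z). nearest_symbol S (a + (\<Sum>m\<in>UNIV. w x $ m * z $ m)) \<noteq> a}" for a
  have B [measurable]: "B a \<in> sets (borel \<Otimes>\<^sub>M borel)" for a
  proof -
    have "{p \<in> space (borel \<Otimes>\<^sub>M borel). nearest_symbol S (a + (\<Sum>m\<in>UNIV. w (fst p) $ m * snd p $ m)) \<noteq> a} \<in> sets (borel \<Otimes>\<^sub>M borel)"
      by measurable
    then show ?thesis by (simp add: B_def space_pair_measure case_prod_unfold)
  qed
  have dec: "zf_decision S (H \<omega>) F (received (H \<omega>) F (s \<omega>) (\<xi> \<omega>)) $ k =
     nearest_symbol S (\<Sum>m\<in>UNIV. w (H \<omega>) $ m * (((H \<omega> ** F) *v s \<omega>) $ m + \<xi> \<omega> $ m))" for \<omega>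
    by (simp add: zf_decision_def received_def w_def matrix_vector_mult_def[of "pseudo_inv _"])
  have [measurable]: "(\<lambda>\<omega>. ((H \<omega> ** F) *v s \<omega>) $ m) \<in> borel_measurable P" for m
    unfolding matrix_vector_mult_def matrix_matrix_mult_def by simp
  have E [measurable]: "{\<omega> \<in> space P. zf_decision S (H \<omega>) F (received (H \<omega>) F (s \<omega>) (\<xi> \<omega>)) $ k \<noteq> s \<omega> $ k} \<in> events"
    unfolding dec by measurable
  have EB [measurable]: "{\<omega> \<in> space P. s \<omega> \<in> {v. v $ k = a} \<and> (H \<omega>, \<xi> \<omega>) \<in> B a} \<in> events" for a
  proof -
    have [measurable]: "Measurable.pred P (\<lambda>\<omega>. (H \<omega>, \<xi> \<omega>) \<in> B a)"
      using B by measurable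
    show ?thesis by (simp) measurable
  qed
  have inj: "AE \<omega> in P. injective_matrix (H \<omega> ** F)"
    using AE_injective[OF card] unfolding law[symmetric] by (rule AE_distrD[rotated]) simp
  \<comment> \<open>The error event is split over the finitely many values of symbol
    \<open>k\<close>, each of positive probability, so that \<open>indep_triple_cond\<close> applies
    to every piece.\<close>
  have "prob {\<omega> \<in> space P. zf_decision S (H \<omega>) F (received (H \<omega>) F (s \<omega>) (\<xi> \<omega>)) $ k \<noteq> s \<omega> $ k} =
    prob (\<Union>a\<in>S. {\<omega> \<in> space P. s \<omega> \<in> {v. v $ k = a} \<and> (H \<omega>, \<xi> \<omega>) \<in> B a})"
  proof (rule finite_measure_eq_AE)
    show "AE \<omega> in P. (\<omega> \<in> {\<omega> \<in> space P. zf_decision S (H \<omega>) F (received (H \<omega>) F (s \<omega>) (\<xi> \<omega>)) $ k \<noteq> s \<omega> $ k}) \<longleftrightarrow>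
       (\<omega> \<in> (\<Union>a\<in>S. {\<omega> \<in> space P. s \<omega> \<in> {v. v $ k = a} \<and> (H \<omega>, \<xi> \<omega>) \<in> B a}))"
      using inj AE_symbol[of k]
    proof eventually_elim
      fix \<omega> assume inj: "injective_matrix (H \<omega> ** F)" and sym: "s \<omega> $ k \<in> S"
      have "(\<Sum>m\<in>UNIV. w (H \<omega>) $ m * ((H \<omega> ** F) *v s \<omega>) $ m) = (pseudo_inv (H \<omega> ** F) *v ((H \<omega> ** F) *v s \<omega>)) $ k"
        by (simp add: w_def matrix_vector_mult_def[of "pseudo_inv _"])
      then have "(\<Sum>m\<in>UNIV. w (H \<omega>) $ m * (((H \<omega> ** F) *v s \<omega>) $ m + \<xi> \<omega> $ m)) = s \<omega> $ k + (\<Sum>m\<in>UNIV. w (H \<omega>) $ m * \<xi> \<omega> $ m)"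
        by (simp add: pseudo_inv_left[OF inj] distrib_left sum.distrib)
      then show "(\<omega> \<in> {\<omega> \<in> space P. zf_decision S (H \<omega>) F (received (H \<omega>) F (s \<omega>) (\<xi> \<omega>)) $ k \<noteq> s \<omega> $ k}) \<longleftrightarrow>
       (\<omega> \<in> (\<Union>a\<in>S. {\<omega> \<in> space P. s \<omega> \<in> {v. v $ k = a} \<and> (H \<omega>, \<xi> \<omega>) \<in> B a}))"
        using sym unfolding dec by (auto simp: B_def)
    qed
  qed (use S(1) E EB in auto)
  also have "\<dots> = (\<Sum>a\<in>S. prob {\<omega> \<in> space P. s \<omega> \<in> {v. v $ k = a} \<and> (H \<omega>, \<xi> \<omega>) \<in> B a})"
    using S(1) EB by (intro finite_measure_finite_Union) (auto simp: disjoint_family_on_def)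
  also have "\<dots> = (\<Sum>a\<in>S. \<integral>x. measure (distr P borel \<xi>) (Pair x -` B a) / real (card S) \<partial>law)"
  proof (rule sum.cong[OF refl])
    fix a assume a: "a \<in> S"
    have pos: "prob (s -` {v. v $ k = a} \<inter> space P) > 0"
      unfolding prob_symbol[OF a] using S by (simp add: card_gt_0_iff)
    have A: "{v :: complex ^ 'n. v $ k = a} \<in> sets borel"
      by (intro borel_closed closed_Collect_eq continuous_intros)
    show "prob {\<omega> \<in> space P. s \<omega> \<in> {v. v $ k = a} \<and> (H \<omega>, \<xi> \<omega>) \<in> B a} =
      (\<integral>x. measure (distr P borel \<xi>) (Pair x -` B a) / real (card S) \<partial>law)"
      unfolding indep_triple_cond[OF prob_space_axioms H_s_xi_indep A pos B] prob_symbol[OF a] law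
      by (subst measure_pair_integral(1)[OF law.prob_space_axioms noise.prob_space_axioms])
        (auto cong: sets_pair_measure_cong)
  qed
  also have "\<dots> = (\<integral>x. (\<Sum>a\<in>S. measure (distr P borel \<xi>) (Pair x -` B a) / real (card S)) \<partial>law)"
  proof (rule Bochner_Integration.integral_sum[symmetric])
    fix a
    have m: "(\<lambda>x. measure (distr P borel \<xi>) (Pair x -` B a)) \<in> borel_measurable law"
      by (rule measure_pair_integral(2)[OF law.prob_space_axioms noise.prob_space_axioms])
        (simp cong: sets_pair_measure_cong)
    show "integrable law (\<lambda>x. measure (distr P borel \<xi>) (Pair x -` B a) / real (card S))"
      by (intro integrable_divide law.integrable_const_bound[where B=1] m) simp
  qed
  \<comment> \<open>For almost every channel the row \<open>w x\<close> is nonzero, and the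
    projected noise is a scaled standard Gaussian by \<open>noise_law\<close>; the inner average is
    then a \<open>symbol_error\<close>.\<close>
  also have "\<dots> = (\<integral>x. h x \<partial>law)"
  proof (rule integral_cong_AE)
    have "(\<lambda>x. measure (distr P borel \<xi>) (Pair x -` B a)) \<in> borel_measurable law" for a
      by (rule measure_pair_integral(2)[OF law.prob_space_axioms noise.prob_space_axioms])
        (simp cong: sets_pair_measure_cong)
    then show "(\<lambda>x. \<Sum>a\<in>S. measure (distr P borel \<xi>) (Pair x -` B a) / real (card S)) \<in> borel_measurable law"
      by (intro borel_measurable_sum borel_measurable_divide) auto
    show "h \<in> borel_measurable law" using h by simp
    show "AE x in law. (\<Sum>a\<in>S. measure (distr P borel \<xi>) (Pair x -` B a) / real (card S)) = h x"
      using AE_injective[OF card]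
    proof eventually_elim
      fix x :: "complex ^ 'n ^ 'r" assume inj: "injective_matrix (x ** F)"
      have w0: "w x \<noteq> 0"
      proof
        assume "w x = 0"
        moreover have "(pseudo_inv (x ** F) *v ((x ** F) *v axis k 1)) $ k = 1" by (simp add: pseudo_inv_left[OF inj])
        ultimately show False by (simp add: w_def matrix_vector_mult_def[of "pseudo_inv _"])
      qed
      let ?\<kappa> = "\<bar>\<sigma>\<bar> * norm (w x) / sqrt 2"
      let ?U = "\<lambda>z. \<Sum>m\<in>UNIV. w x $ m * z $ m"
      have U: "?U \<in> borel_measurable borel"
        by (intro borel_measurable_continuous_onI continuous_intros)
      have "measure (distr P borel \<xi>) (Pair x -` B a) = measure std_gaussian {z. nearest_symbol S (a + ?\<kappa> *\<^sub>R z) \<noteq> a}" for a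
      proof -
        have N: "{y. nearest_symbol S (a + y) \<noteq> a} \<in> sets borel"
          using measurable_sets[of "\<lambda>y. nearest_symbol S (a + y)" borel borel "- {a}"] by (simp add: vimage_def)
        have "measure (distr P borel \<xi>) (Pair x -` B a) = measure (distr (distr P borel \<xi>) borel ?U) {y. nearest_symbol S (a + y) \<noteq> a}"
          using N U by (subst measure_distr) (auto simp: B_def vimage_def)
        also have "\<dots> = measure std_gaussian {z. nearest_symbol S (a + ?\<kappa> *\<^sub>R z) \<noteq> a}"
          unfolding noise_law[OF w0] using N by (subst measure_distr) (auto simp: vimage_def)
        finally show ?thesis .
      qed
      then have "(\<Sum>a\<in>S. measure (distr P borel \<xi>) (Pair x -` B a) / real (card S)) = symbol_error S ?\<kappa>"
        by (simp add: symbol_error_def sum_divide_distrib)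
      then show "(\<Sum>a\<in>S. measure (distr P borel \<xi>) (Pair x -` B a) / real (card S)) = h x"
        using err[of x] w0 by (simp add: w_def)
    qed
  qed
  finally show ?thesis .
qed

end

text \<open>Two Craig terms are what QAM requires. With the deviation |\<sigma>| |w| / sqrt 2 in
  place of \<kappa>, the parameter d / (2 \<kappa>^2) becomes (d / \<sigma>^2) / |w|^2, whose factor
  1 / \<sigma>^2 is the SNR \<eta> of \<open>G\<close>.\<close>

lemma (in zf_system) prob_symbol_error_craig:
  assumes d: "d \<ge> 0"
    and err: "\<And>\<kappa>. \<kappa> > 0 \<Longrightarrow> symbol_error S \<kappa> = C1 * craig a1 b1 (d / (2 * \<kappa>\<^sup>2)) + C2 * craig a2 b2 (d / (2 * \<kappa>\<^sup>2))"
  shows "prob {\<omega> \<in> space P. zf_decision S (H \<omega>) F (received (H \<omega>) F (s \<omega>) (\<xi> \<omega>)) $ k \<noteq> s \<omega> $ k} =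
    C1 * integral {a1..b1} (\<lambda>\<theta>. (1 / (1 + 1 / \<sigma>\<^sup>2 * d / (Re (matrix_inv (adj F ** \<Sigma> ** F) $ k $ k) * (sin \<theta>)\<^sup>2))) ^ (CARD('r) - CARD('n) + 1)) +
    C2 * integral {a2..b2} (\<lambda>\<theta>. (1 / (1 + 1 / \<sigma>\<^sup>2 * d / (Re (matrix_inv (adj F ** \<Sigma> ** F) $ k $ k) * (sin \<theta>)\<^sup>2))) ^ (CARD('r) - CARD('n) + 1))"
proof -
  obtain L where law: "distr P borel H = distr std_gaussian borel L" and L: "correlated_channel L \<Sigma> F"
    by (rule channel_law)
  interpret ch: correlated_channel L \<Sigma> F by fact
  have rho: "Re (matrix_inv (adj F ** \<Sigma> ** F) $ k $ k) = ch.\<rho> k"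
    by (simp add: ch.\<rho>_def ch.R_def)
  define c where "c = 1 / \<sigma>\<^sup>2 * d"
  have c: "c \<ge> 0" using d by (simp add: c_def)
  let ?w = "\<lambda>x :: complex ^ 'n ^ 'r. pseudo_inv (x ** F) $ k"
  define h where "h x = C1 * craig a1 b1 (c / (norm (?w x))\<^sup>2) + C2 * craig a2 b2 (c / (norm (?w x))\<^sup>2)" for x
  note int = ch.expectation_craig(1)[OF card c]
  have hm: "h \<in> borel_measurable borel"
  proof -
    have "(\<lambda>x. craig a b (c / (norm (?w x))\<^sup>2)) \<in> borel_measurable borel" for a b
      using borel_measurable_integrable[OF int[of a b k]] by simp
    then show ?thesis
      unfolding h_def by (intro borel_measurable_add borel_measurable_times borel_measurable_const)
  qed
  have "prob {\<omega> \<in> space P. zf_decision S (H \<omega>) F (received (H \<omega>) F (s \<omega>) (\<xi> \<omega>)) $ k \<noteq> s \<omega> $ k} =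
    (\<integral>x. h x \<partial>distr std_gaussian borel L)"
  proof (rule prob_symbol_error[OF law L hm])
    fix x assume w: "?w x \<noteq> 0"
    let ?\<kappa> = "\<bar>\<sigma>\<bar> * norm (?w x) / sqrt 2"
    have "2 * ?\<kappa>\<^sup>2 = \<sigma>\<^sup>2 * (norm (?w x))\<^sup>2" by (simp add: power_mult_distrib power_divide)
    then have "d / (2 * ?\<kappa>\<^sup>2) = c / (norm (?w x))\<^sup>2" unfolding c_def by simp
    moreover have "?\<kappa> > 0" using w sigma by simp
    ultimately show "symbol_error S ?\<kappa> = h x" using err[of ?\<kappa>] unfolding h_def by simp
  qed
  also have "\<dots> = C1 * (\<integral>x. craig a1 b1 (c / (norm (?w x))\<^sup>2) \<partial>distr std_gaussian borel L) +
     C2 * (\<integral>x. craig a2 b2 (c / (norm (?w x))\<^sup>2) \<partial>distr std_gaussian borel L)"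
    unfolding h_def using int[of a1 b1 k] int[of a2 b2 k] by simp
  finally show ?thesis
    unfolding ch.expectation_craig(2)[OF card c] unfolding rho c_def .
qed

section \<open>Matching the closed forms of \<open>G\<close> and \<open>T\<close>\<close>

lemma power_int_diversity_order:
  fixes t :: real
  assumes "Nr > Nt"
  shows "t powi (- (int Nr - int Nt + 1)) = (1 / t) ^ (Nr - Nt + 1)"
proof -
  have "int Nr - int Nt + 1 = int (Nr - Nt + 1)" using assms by simp
  then show ?thesis by (simp only: power_int_minus power_int_of_nat power_one_over inverse_eq_divide)
qed

lemma G_PAM_eq:
  assumes "Nr > Nt"
  shows "G_PAM \<eta> Nr Nt M = (\<lambda>x. 2 * (real M - 1) / (real M * pi) *
    integral {0..pi / 2} (\<lambda>\<theta>. (1 / (1 + \<eta> * (3 / ((real M)\<^sup>2 - 1)) / (x * (sin \<theta>)\<^sup>2))) ^ (Nr - Nt + 1)))"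
  unfolding G_PAM_def power_int_diversity_order[OF assms] by (simp add: mult_ac fun_eq_iff)

lemma G_PSK_eq:
  assumes "Nr > Nt"
  shows "G_PSK \<eta> Nr Nt M = (\<lambda>x. 1 / pi *
    integral {0..(real M - 1) * pi / real M} (\<lambda>\<theta>. (1 / (1 + \<eta> * (sin (pi / real M))\<^sup>2 / (x * (sin \<theta>)\<^sup>2))) ^ (Nr - Nt + 1)))"
  unfolding G_PSK_def power_int_diversity_order[OF assms] by (simp add: fun_eq_iff)

lemma G_QAM_eq:
  assumes "Nr > Nt"
  shows "G_QAM \<eta> Nr Nt M = (\<lambda>x. 4 * (sqrt (real M) - 1) / (sqrt (real M) * pi) *
    integral {pi / 4..pi / 2} (\<lambda>\<theta>. (1 / (1 + \<eta> * (3 / (2 * (real M - 1))) / (x * (sin \<theta>)\<^sup>2))) ^ (Nr - Nt + 1)) +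
    4 * (sqrt (real M) - 1) / (real M * pi) *
    integral {0..pi / 4} (\<lambda>\<theta>. (1 / (1 + \<eta> * (3 / (2 * (real M - 1))) / (x * (sin \<theta>)\<^sup>2))) ^ (Nr - Nt + 1)))"
proof -
  have "3 * \<eta> / (2 * (real M - 1) * x * y) = \<eta> * (3 / (2 * (real M - 1))) / (x * y)" for x y
    by (simp add: mult_ac)
  then show ?thesis unfolding G_QAM_def power_int_diversity_order[OF assms] by (simp only:)
qed

lemma convex_on_G_PAM:
  assumes "Nr > Nt" "\<eta> > 0" "M \<ge> 2"
  shows "convex_on {0<..<T_PAM \<eta> Nr Nt M} (G_PAM \<eta> Nr Nt M)"
proof -
  have "(real M)\<^sup>2 > 1" using assms by (simp add: one_less_power)
  then show ?thesis
    unfolding G_PAM_eq[OF assms(1)] using assms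
    by (intro convex_on_cmul convex_on_craig_average) (auto simp: T_PAM_def of_nat_diff mult_ac)
qed

lemma convex_on_G_PSK:
  assumes "Nr > Nt" "\<eta> > 0" "M \<ge> 2"
  shows "convex_on {0<..<T_PSK \<eta> Nr Nt M} (G_PSK \<eta> Nr Nt M)"
  unfolding G_PSK_eq[OF assms(1)] using assms
  by (intro convex_on_cmul convex_on_craig_average) (auto simp: T_PSK_def of_nat_diff mult_ac)

lemma convex_on_G_QAM:
  assumes "Nr > Nt" "\<eta> > 0" "M \<ge> 2"
  shows "convex_on {0<..<T_QAM \<eta> Nr Nt M} (G_QAM \<eta> Nr Nt M)"
  unfolding G_QAM_eq[OF assms(1)] using assms
  by (intro convex_on_add convex_on_cmul convex_on_craig_average) (auto simp: T_QAM_def of_nat_diff mult_ac)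

theorem lemma1:
  fixes P :: "'a measure"
    and H :: "'a \<Rightarrow> complex ^ 'n ^ 'r"
    and s :: "'a \<Rightarrow> complex ^ 'n"
    and \<xi> :: "'a \<Rightarrow> complex ^ 'r"
    and \<Sigma> F :: "complex ^ 'n ^ 'n"
    and \<sigma> \<eta> :: real
    and S :: "complex set"
    and M Nr Nt :: nat
  assumes Nr: "Nr = CARD('r)" and Nt: "Nt = CARD('n)" and Nr_gt_Nt: "Nr > Nt"
    and eta: "\<eta> = 1 / \<sigma>\<^sup>2" "\<eta> > 0"
    and Sigma: "hermitian_pos_def \<Sigma>"
    and F: "invertible F"
    and P: "prob_space P"
    and H_rows_indep: "prob_space.indep_vars P (\<lambda>_. borel) (\<lambda>m \<omega>. H \<omega> $ m) UNIV"
    and H_rows_identical: "\<And>m m'. distr P borel (\<lambda>\<omega>. H \<omega> $ m) = distr P borel (\<lambda>\<omega>. H \<omega> $ m')"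
    and H_rows_gaussian: "\<And>m. gaussian_vector P (\<lambda>\<omega>. H \<omega> $ m)"
    and H_rows_circular: "\<And>m. circularly_symmetric P (\<lambda>\<omega>. H \<omega> $ m)"
    and H_rows_zero_mean: "\<And>m. integral\<^sup>L P (\<lambda>\<omega>. H \<omega> $ m) = 0"
    and H_rows_cov:
      "\<And>m. (\<chi> i j. integral\<^sup>L P (\<lambda>\<omega>. cnj (H \<omega> $ m $ i) * (H \<omega> $ m $ j))) = \<Sigma>"
    and xi_gaussian: "gaussian_vector P \<xi>"
    and xi_circular: "circularly_symmetric P \<xi>"
    and xi_cov: "covariance_matrix P \<xi> = mat (complex_of_real (\<sigma>\<^sup>2))"
    and s_indep: "prob_space.indep_vars P (\<lambda>_. borel) (\<lambda>k \<omega>. s \<omega> $ k) UNIV"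
    and s_uniform: "\<And>k. distr P borel (\<lambda>\<omega>. s \<omega> $ k) = distr (measure_pmf (pmf_of_set S)) borel (\<lambda>a. a)"
    and H_s_xi_indep: "indep_triple P H s \<xi>"
  shows
    "(M \<ge> 2 \<and> S = PAM M \<longrightarrow>
        average_SEP P S H s \<xi> F =
          1 / real Nt * (\<Sum>k\<in>UNIV. G_PAM \<eta> Nr Nt M (Re (matrix_inv (adj F ** \<Sigma> ** F) $ k $ k))) \<and>
        convex_on {0<..<T_PAM \<eta> Nr Nt M} (G_PAM \<eta> Nr Nt M)) \<and>
     (M \<ge> 2 \<and> S = PSK M \<longrightarrow>
        average_SEP P S H s \<xi> F =
          1 / real Nt * (\<Sum>k\<in>UNIV. G_PSK \<eta> Nr Nt M (Re (matrix_inv (adj F ** \<Sigma> ** F) $ k $ k))) \<and>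
        convex_on {0<..<T_PSK \<eta> Nr Nt M} (G_PSK \<eta> Nr Nt M)) \<and>
     ((\<exists>q::nat. q \<ge> 2 \<and> M = q\<^sup>2) \<and> S = QAM M \<longrightarrow>
        average_SEP P S H s \<xi> F =
          1 / real Nt * (\<Sum>k\<in>UNIV. G_QAM \<eta> Nr Nt M (Re (matrix_inv (adj F ** \<Sigma> ** F) $ k $ k))) \<and>
        convex_on {0<..<T_QAM \<eta> Nr Nt M} (G_QAM \<eta> Nr Nt M))"
proof -
  have sigma: "\<sigma> \<noteq> 0" using eta by auto
  have system: "zf_system P H s \<xi> \<Sigma> F \<sigma> S" if "finite S" "S \<noteq> {}"
    using Nr Nt Nr_gt_Nt
    by (intro zf_system.intro zf_system_axioms.intro P sigma Sigma F H_rows_indep H_rows_gaussian H_rows_circular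
      H_rows_cov xi_gaussian xi_circular xi_cov s_uniform H_s_xi_indep that) simp
  have sep: "average_SEP P S H s \<xi> F = 1 / real Nt * (\<Sum>k\<in>UNIV. g k)"
    if "\<And>k. measure P {\<omega> \<in> space P. zf_decision S (H \<omega>) F (received (H \<omega>) F (s \<omega>) (\<xi> \<omega>)) $ k \<noteq> s \<omega> $ k} = g k"
    for g :: "'n \<Rightarrow> real"
    unfolding average_SEP_def Nt that ..
  show ?thesis
  proof (intro conjI impI; elim conjE exE)
    assume M: "M \<ge> 2" and S_eq: "S = PAM M"
    have "PAM M \<noteq> {}" using M unfolding PAM_def amplitude_levels_eq by auto
    then interpret zf_system P H s \<xi> \<Sigma> F \<sigma> S
      using finite_PAM by (intro system) (simp_all add: S_eq)
    have d: "0 \<le> 3 / ((real M)\<^sup>2 - 1)" using M by (simp add: one_le_power)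
    \<comment> \<open>A term with coefficient 0 over a degenerate interval brings PAM into the
      two-term form.\<close>
    have err: "symbol_error S \<kappa> = 2 * (real M - 1) / (real M * pi) * craig 0 (pi / 2) (3 / ((real M)\<^sup>2 - 1) / (2 * \<kappa>\<^sup>2))
        + 0 * craig 0 0 (3 / ((real M)\<^sup>2 - 1) / (2 * \<kappa>\<^sup>2))" if "\<kappa> > 0" for \<kappa>
      unfolding S_eq symbol_error_PAM[OF M that] by (simp only: mult_zero_left add_0_right)
    show "average_SEP P S H s \<xi> F =
          1 / real Nt * (\<Sum>k\<in>UNIV. G_PAM \<eta> Nr Nt M (Re (matrix_inv (adj F ** \<Sigma> ** F) $ k $ k)))"
      unfolding G_PAM_eq[OF Nr_gt_Nt] eta(1)
      by (intro sep) (simp only: prob_symbol_error_craig[OF d err] Nr Nt mult_zero_left add_0_right)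
    show "convex_on {0<..<T_PAM \<eta> Nr Nt M} (G_PAM \<eta> Nr Nt M)"
      by (rule convex_on_G_PAM[OF Nr_gt_Nt eta(2) M])
  next
    assume M: "M \<ge> 2" and S_eq: "S = PSK M"
    have "PSK M \<noteq> {}" using M unfolding PSK_def by auto
    then interpret zf_system P H s \<xi> \<Sigma> F \<sigma> S
      using finite_PSK by (intro system) (simp_all add: S_eq)
    have d: "0 \<le> (sin (pi / real M))\<^sup>2" by simp
    have err: "symbol_error S \<kappa> = 1 / pi * craig 0 ((real M - 1) * pi / real M) ((sin (pi / real M))\<^sup>2 / (2 * \<kappa>\<^sup>2))
        + 0 * craig 0 0 ((sin (pi / real M))\<^sup>2 / (2 * \<kappa>\<^sup>2))" if "\<kappa> > 0" for \<kappa>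
      unfolding S_eq symbol_error_PSK[OF M that] by (simp only: mult_zero_left add_0_right)
    show "average_SEP P S H s \<xi> F =
          1 / real Nt * (\<Sum>k\<in>UNIV. G_PSK \<eta> Nr Nt M (Re (matrix_inv (adj F ** \<Sigma> ** F) $ k $ k)))"
      unfolding G_PSK_eq[OF Nr_gt_Nt] eta(1)
      by (intro sep) (simp only: prob_symbol_error_craig[OF d err] Nr Nt mult_zero_left add_0_right)
    show "convex_on {0<..<T_PSK \<eta> Nr Nt M} (G_PSK \<eta> Nr Nt M)"
      by (rule convex_on_G_PSK[OF Nr_gt_Nt eta(2) M])
  next
    fix q :: nat
    assume S_eq: "S = QAM M" and q: "q \<ge> 2" and M: "M = q\<^sup>2"
    have M2: "M \<ge> 2" using q power_mono[of 2 q 2] by (simp add: M)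
    have "QAM M \<noteq> {}" using q unfolding QAM_eq[OF M refl] by auto
    then interpret zf_system P H s \<xi> \<Sigma> F \<sigma> S
      using finite_QAM[OF M] by (intro system) (simp_all add: S_eq)
    have d: "0 \<le> 3 / (2 * (real M - 1))" using M2 by simp
    have err: "symbol_error S \<kappa> =
        4 * (sqrt (real M) - 1) / (sqrt (real M) * pi) * craig (pi / 4) (pi / 2) (3 / (2 * (real M - 1)) / (2 * \<kappa>\<^sup>2)) +
        4 * (sqrt (real M) - 1) / (real M * pi) * craig 0 (pi / 4) (3 / (2 * (real M - 1)) / (2 * \<kappa>\<^sup>2))"
      if "\<kappa> > 0" for \<kappa>
      unfolding S_eq by (rule symbol_error_QAM[OF q M that])
    show "average_SEP P S H s \<xi> F =
          1 / real Nt * (\<Sum>k\<in>UNIV. G_QAM \<eta> Nr Nt M (Re (matrix_inv (adj F ** \<Sigma> ** F) $ k $ k)))"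
      unfolding G_QAM_eq[OF Nr_gt_Nt] eta(1)
      by (intro sep) (simp only: prob_symbol_error_craig[OF d err] Nr Nt)
    show "convex_on {0<..<T_QAM \<eta> Nr Nt M} (G_QAM \<eta> Nr Nt M)"
      by (rule convex_on_G_QAM[OF Nr_gt_Nt eta(2) M2])
  qed
qed

end
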